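(* Let $\Omega\subset\mathbb C^n$ be a connected open subset, $p:\Omega\to\mathbb C$ a non-zero holomorphic function, $X=p^{-1}(0)\subset\Omega$ its zero locus, and $X_s\subset X$ the complement in $X$ of the set $X_r$ of points at which $X$ is a smooth complex hypersurface. Let $V$ be a quasi-complete locally convex (Hausdorff) space. Then every holomorphic function $f:\Omega\setminus X_s\to V$ admits a unique extension to a holomorphic function $\Omega\to V$.
   Context: $X_r$ is the set of points $z\in X$ for which there exists an open neighborhood $U$ of $z$ in $\Omega$ such that $X\cap U$ is a complex submanifold of dimension $n-1$; $X_s=X\setminus X_r$, which is closed in $\Omega$ and has empty interior. "Non-zero" means not identically zero. $V$ is a complex locally convex space. *)

theory Defs
  imports "HOL-Analysis.Analysis"
begin

text \<open>
  A complex locally convex Hausdorff space is the whole of a type of sort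
  \<open>{real_vector, uniform_topological_group_add, topological_ab_group_add, t2_space}\<close>
  together with a complex scalar multiplication extending the real one. The uniformity carries no
  additional information: in the class \<open>uniform_topological_group_add\<close> it is the translation
  uniformity of the topology, i.e. \<open>filtercomap (\<lambda>(x, y). y - x) (nhds 0)\<close>.
\<close>

definition complex_lcs ::
  "(complex \<Rightarrow> 'v \<Rightarrow>
    'v::{real_vector, uniform_topological_group_add, topological_ab_group_add, t2_space}) \<Rightarrow> bool" where
  "complex_lcs scaleC \<longleftrightarrow> vector_space scaleC \<and>
     (\<forall>r x. scaleC (of_real r) x = r *\<^sub>R x) \<and>
     continuous_on UNIV (\<lambda>(c, x). scaleC c x) \<and>
     (\<forall>U :: 'v set. open U \<and> 0 \<in> U \<longrightarrow> (\<exists>C. convex C \<and> 0 \<in> interior C \<and> C \<subseteq> U))"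

text \<open>Boundedness in the sense of von Neumann: absorbed by every neighbourhood of \<open>0\<close>.\<close>

definition tvs_bounded :: "'v::{real_vector, topological_space} set \<Rightarrow> bool" where
  "tvs_bounded B \<longleftrightarrow>
     (\<forall>U. open U \<and> 0 \<in> U \<longrightarrow> (\<exists>r>0. \<forall>t\<ge>r. B \<subseteq> (\<lambda>x. t *\<^sub>R x) ` U))"

text \<open>Completeness of subsets is the library's, i.e. convergence of all Cauchy filters, not only
  of Cauchy sequences.\<close>

definition quasi_complete_lcs ::
  "(complex \<Rightarrow> 'v \<Rightarrow>
    'v::{real_vector, uniform_topological_group_add, topological_ab_group_add, t2_space}) \<Rightarrow> bool" where
  "quasi_complete_lcs scaleC \<longleftrightarrow> complex_lcs scaleC \<and>
     (\<forall>B :: 'v set. closed B \<and> tvs_bounded B \<longrightarrow> complete B)"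

text \<open>
  Complex (Frechet) differentiability at every point of an open set \<open>U \<subseteq> \<complex>\<^sup>n\<close>, for maps into a complex
  topological vector space with scalar multiplication \<open>scaleC\<close>. Continuity of the differential \<open>L\<close>
  is automatic, its domain being finite-dimensional. Only the values of \<open>f\<close> on \<open>U\<close> matter when
  \<open>U\<close> is open.
\<close>

definition holomorphic_wrt ::
  "(complex \<Rightarrow> 'v \<Rightarrow> 'v) \<Rightarrow> (complex^'n \<Rightarrow> 'v::{real_vector, topological_space})
     \<Rightarrow> (complex^'n) set \<Rightarrow> bool" where
  "holomorphic_wrt scaleC f U \<longleftrightarrow>
     (\<forall>z\<in>U. \<exists>L. Vector_Spaces.linear (*s) scaleC L \<and>
        ((\<lambda>h. (1 / norm h) *\<^sub>R (f (z + h) - f z - L h)) \<longlongrightarrow> 0) (at 0))"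

definition biholomorphic ::
  "(complex^'n \<Rightarrow> complex^'n) \<Rightarrow> (complex^'n) set \<Rightarrow> (complex^'n) set \<Rightarrow> bool" where
  "biholomorphic \<phi> W W' \<longleftrightarrow> open W \<and> open W' \<and> bij_betw \<phi> W W' \<and>
     holomorphic_wrt (*s) \<phi> W \<and> holomorphic_wrt (*s) (inv_into W \<phi>) W'"

text \<open>Embedded complex submanifolds of \<open>\<complex>\<^sup>n\<close> of pure dimension \<open>k\<close>: around each of its points some
  biholomorphic chart of \<open>\<complex>\<^sup>n\<close> straightens \<open>S\<close> to a \<open>k\<close>-dimensional coordinate subspace. As the index
  type \<open>'n\<close> is unordered, the set \<open>I\<close> of the \<open>k\<close> free coordinates is part of the chart.\<close>

definition complex_submanifold :: "nat \<Rightarrow> (complex^'n) set \<Rightarrow> bool" where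
  "complex_submanifold k S \<longleftrightarrow>
     (\<forall>w\<in>S. \<exists>W W' \<phi> I. w \<in> W \<and> biholomorphic \<phi> W W' \<and> card I = k \<and>
        \<phi> ` (S \<inter> W) = {y \<in> W'. \<forall>i. i \<notin> I \<longrightarrow> y $ i = 0})"

definition zero_locus :: "(complex^'n) set \<Rightarrow> (complex^'n \<Rightarrow> complex) \<Rightarrow> (complex^'n) set" where
  "zero_locus \<Omega> p = {z \<in> \<Omega>. p z = 0}"

definition regular_points :: "(complex^'n) set \<Rightarrow> (complex^'n) set \<Rightarrow> (complex^'n) set" where
  "regular_points \<Omega> X =
     {z \<in> X. \<exists>U. open U \<and> z \<in> U \<and> U \<subseteq> \<Omega> \<and> complex_submanifold (CARD('n) - 1) (X \<inter> U)}"

definition singular_points :: "(complex^'n) set \<Rightarrow> (complex^'n) set \<Rightarrow> (complex^'n) set" where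
  "singular_points \<Omega> X = X - regular_points \<Omega> X"

text \<open>For maps into a normed space the differentiability condition is the library's.\<close>

lemma holomorphic_wrt_iff_has_derivative:
  fixes f :: "complex^'n \<Rightarrow> 'b::real_normed_vector"
  assumes scaleC: "\<And>r x. scaleC (of_real r) x = r *\<^sub>R x"
  shows "holomorphic_wrt scaleC f U \<longleftrightarrow>
    (\<forall>z\<in>U. \<exists>L. Vector_Spaces.linear (*s) scaleC L \<and> (f has_derivative L) (at z))"
proof -
  have "bounded_linear L" if "Vector_Spaces.linear (*s) scaleC L" for L :: "complex^'n \<Rightarrow> 'b"
  proof -
    interpret L: Vector_Spaces.linear "(*s)" scaleC L by (fact that)
    have "r *\<^sub>R x = complex_of_real r *s x" for r and x :: "complex^'n"
      by (simp add: vec_eq_iff scaleR_conv_of_real [where 'a = complex])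
    then have "linear L"
      by (intro linearI) (simp_all add: L.add L.scale scaleC)
    then show ?thesis
      by (simp add: linear_conv_bounded_linear)
  qed
  moreover have "((\<lambda>h. (1 / norm h) *\<^sub>R (f (z + h) - f z - L h)) \<longlongrightarrow> 0) (at 0) \<longleftrightarrow>
      ((\<lambda>h. norm (f (z + h) - f z - L h) / norm h) \<longlongrightarrow> 0) (at 0)" for L z
    by (subst tendsto_norm_zero_iff [symmetric]) simp
  ultimately show ?thesis
    unfolding holomorphic_wrt_def has_derivative_at by meson
qed

end

theory Submission
  imports Defs "HOL-Complex_Analysis.Residue_Theorem"
begin

text \<open>
  The extension is an average over circles. Near a point \<open>z\<^sub>0\<close> of \<open>\<Omega>\<close> choose a direction \<open>v\<close> and a
  radius \<open>r\<close> such that \<open>p\<close> does not vanish on the circle \<open>z\<^sub>0 + \<zeta> v\<close>, \<open>\<bar>\<zeta>\<bar> = r\<close>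
  (\<open>nonvanishing_circle_exists\<close>). For all \<open>z\<close> in a neighbourhood \<open>B\<close> of \<open>z\<^sub>0\<close> the translated circle still
  avoids the zero locus, so the mean \<open>g z\<close> of \<open>f\<close> over the circle around \<open>z\<close> is defined and holomorphic
  on all of \<open>B\<close> (\<open>circle_mean_holomorphic\<close>), whether or not the disc inside meets \<open>X\<^sub>s\<close>. If it does not,
  then \<open>g z = f z\<close> by the mean value property. Everything therefore rests on one geometric fact: the
  \<open>z\<close> whose disc \<open>z + \<zeta> v\<close>, \<open>\<bar>\<zeta>\<bar> \<le> r\<close>, misses \<open>X\<^sub>s\<close> are dense in \<open>B\<close> (\<open>regular_discs_dense\<close>). By
  continuity \<open>g = f\<close> then holds on \<open>B - X\<^sub>s\<close>, and the local extensions agree on overlaps because \<open>X\<close> has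
  empty interior (\<open>zeros_nowhere_dense\<close>).

  The density replaces the statement that \<open>X\<^sub>s\<close> is an analytic set of codimension at least two. Given a
  small open set, let \<open>w\<close> be one of its points for which \<open>\<zeta> \<mapsto> p (w + \<zeta> v)\<close> has the largest possible
  number of distinct zeros in the disc; the argument principle bounds this number. Under a small
  perturbation of \<open>w\<close> none of these zeros can disappear, and by maximality none of them can split. So
  each of them continues to a unique zero \<open>a w\<close>, which is holomorphic in \<open>w\<close> since it is a quotient of two
  integrals of logarithmic derivatives (\<open>unique_zero_line_holomorphic\<close>). Hence \<open>X\<close> is the graph of a
  holomorphic function near every point in which it meets the disc, and all these points are regular
  (\<open>zero_graph_regular\<close>).

  Vector values are reduced to complex ones. By a Hahn-Banach argument every neighbourhood of \<open>0\<close> in \<open>V\<close> is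
  controlled by an equicontinuous family of functionals (\<open>norming_functionals\<close>), so that estimates
  for \<open>l \<circ> f\<close> which are uniform in \<open>l\<close> become estimates in \<open>V\<close>. In this way Riemann sums converge by
  quasi-completeness (\<open>cfunctional_integral_exists\<close>), and a continuous map all of whose compositions with
  functionals are holomorphic is itself holomorphic (\<open>weakly_holomorphic_imp_holomorphic_wrt\<close>).
\<close>

section \<open>The Hahn-Banach theorem for sublinear functionals\<close>

definition sublinear :: "('v::real_vector \<Rightarrow> real) \<Rightarrow> bool" where
  "sublinear q \<longleftrightarrow> (\<forall>x y. q (x + y) \<le> q x + q y) \<and> (\<forall>x. \<forall>c\<ge>0. q (c *\<^sub>R x) = c * q x)"

lemma sublinearI:
  assumes "\<And>x y. q (x + y) \<le> q x + q y" and "q 0 = 0"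
    and le: "\<And>c x. c > 0 \<Longrightarrow> q (c *\<^sub>R x) \<le> c * q x"
  shows "sublinear q"
proof -
  have "q (c *\<^sub>R x) = c * q x" if "c > 0" for c x
  proof -
    have "q x \<le> inverse c * q (c *\<^sub>R x)"
      using le[of "inverse c" "c *\<^sub>R x"] that by simp
    then have "c * q x \<le> q (c *\<^sub>R x)"
      using that by (simp add: field_simps)
    then show ?thesis
      using le[OF that, of x] by simp
  qed
  then show ?thesis
    using assms(1,2) unfolding sublinear_def by (metis mult_zero_left order_le_less scaleR_zero_left)
qed

lemma sublinear_zero: "sublinear q \<Longrightarrow> q 0 = 0"
  unfolding sublinear_def by (metis mult_zero_left order_refl scaleR_zero_left)

lemma sublinear_ge_minus: "sublinear q \<Longrightarrow> - q (- x) \<le> q x"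
  using sublinear_zero[of q] unfolding sublinear_def
  by (metis add.right_inverse diff_le_eq diff_0)

text \<open>
  The infimum of \<open>q (x + t y) - t q y\<close> over \<open>t \<ge> 0\<close> is still sublinear, and \<open>t = 1\<close> at \<open>x = - y\<close> gives
  the bound at \<open>- y\<close>. This one construction has two uses: applied to a minimal functional it forces
  linearity, and applied to \<open>q\<close> it prepares the value of the Hahn-Banach functional at a given point.
\<close>

lemma sublinear_lower:
  fixes q :: "'v::real_vector \<Rightarrow> real"
  assumes q: "sublinear q"
  obtains q' where "sublinear q'" "\<And>x. q' x \<le> q x" "q' (- y) \<le> - q y"
proof -
  define S where "S x = (\<lambda>t. q (x + t *\<^sub>R y) - t * q y) ` {0..}" for x
  define q' where "q' x = Inf (S x)" for x
  have add: "q (a + b) \<le> q a + q b" and scale: "c \<ge> 0 \<Longrightarrow> q (c *\<^sub>R a) = c * q a" for a b c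
    using q by (auto simp: sublinear_def)
  have "- q (- x) \<le> q (x + t *\<^sub>R y) - t * q y" if "t \<ge> 0" for x t
    using add[of "x + t *\<^sub>R y" "- x"] scale[OF that, of y] by simp
  then have bdd: "bdd_below (S x)" for x
    by (intro bdd_belowI[of _ "- q (- x)"]) (auto simp: S_def)
  have low: "q' x \<le> q (x + t *\<^sub>R y) - t * q y" if "t \<ge> 0" for x t
    unfolding q'_def using that by (intro cInf_lower[OF _ bdd]) (auto simp: S_def)
  have great: "m \<le> q' x" if "\<And>t. t \<ge> 0 \<Longrightarrow> m \<le> q (x + t *\<^sub>R y) - t * q y" for m x
    unfolding q'_def using that by (intro cInf_greatest) (auto simp: S_def)
  have "sublinear q'"
  proof (rule sublinearI)
    fix x z
    have "q' (x + z) - (q (z + s *\<^sub>R y) - s * q y) \<le> q (x + t *\<^sub>R y) - t * q y"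
      if "t \<ge> 0" "s \<ge> 0" for s t
    proof -
      have "q' (x + z) \<le> q ((x + z) + (t + s) *\<^sub>R y) - (t + s) * q y"
        using that by (intro low) auto
      also have "(x + z) + (t + s) *\<^sub>R y = (x + t *\<^sub>R y) + (z + s *\<^sub>R y)"
        by (simp add: algebra_simps)
      finally show ?thesis
        using add[of "x + t *\<^sub>R y" "z + s *\<^sub>R y"] by (simp add: algebra_simps)
    qed
    then have "q' (x + z) - (q (z + s *\<^sub>R y) - s * q y) \<le> q' x" if "s \<ge> 0" for s
      using that by (intro great) auto
    then have "q' (x + z) - q' x \<le> q' z"
      by (intro great) (simp add: algebra_simps)
    then show "q' (x + z) \<le> q' x + q' z" by simp
  next
    have "q' 0 \<le> 0" using low[of 0 0] sublinear_zero[OF q] by simp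
    moreover have "0 \<le> q' 0" by (rule great) (simp add: scale)
    ultimately show "q' 0 = 0" by simp
  next
    fix c :: real and x assume c: "c > 0"
    have "inverse c * q' (c *\<^sub>R x) \<le> q' x"
    proof (rule great)
      fix t :: real assume "t \<ge> 0"
      have "q' (c *\<^sub>R x) \<le> q (c *\<^sub>R x + (c * t) *\<^sub>R y) - (c * t) * q y"
        using c \<open>t \<ge> 0\<close> by (intro low) auto
      also have "c *\<^sub>R x + (c * t) *\<^sub>R y = c *\<^sub>R (x + t *\<^sub>R y)"
        by (simp add: algebra_simps)
      also have "q \<dots> - (c * t) * q y = c * (q (x + t *\<^sub>R y) - t * q y)"
        using c scale[of c "x + t *\<^sub>R y"] by (simp add: right_diff_distrib)
      finally show "inverse c * q' (c *\<^sub>R x) \<le> q (x + t *\<^sub>R y) - t * q y"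
        using c by (simp add: field_simps)
    qed
    then show "q' (c *\<^sub>R x) \<le> c * q' x" using c by (simp add: field_simps)
  qed
  moreover have "q' x \<le> q x" for x using low[of 0 x] by simp
  moreover have "q' (- y) \<le> - q y" using low[of 1 "- y"] sublinear_zero[OF q] by simp
  ultimately show ?thesis by (rule that)
qed

text \<open>
  Lowering a minimal \<open>m\<close> in the direction \<open>y\<close> cannot change it, which yields \<open>m (- y) \<le> - m y\<close>. An odd
  subadditive function is additive.
\<close>

lemma minimal_sublinear_imp_linear:
  assumes m: "sublinear m" and min: "\<And>m'. sublinear m' \<Longrightarrow> m' \<le> m \<Longrightarrow> m' = m"
  shows "linear m"
proof -
  have odd: "m (- y) = - m y" for y
  proof -
    obtain m' where "sublinear m'" "\<And>x. m' x \<le> m x" "m' (- y) \<le> - m y"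
      using sublinear_lower[OF m] by blast
    moreover from this have "m' = m" by (intro min) (auto simp: le_fun_def)
    ultimately show ?thesis using sublinear_ge_minus[OF m, of "- y"] by simp
  qed
  show ?thesis
  proof (rule linearI)
    fix x y
    have "m (x + y) \<le> m x + m y" "m (- x + - y) \<le> m (- x) + m (- y)"
      using m unfolding sublinear_def by blast+
    moreover have "- x + - y = - (x + y)" by simp
    ultimately show "m (x + y) = m x + m y" using odd by (metis antisym minus_add_distrib neg_le_iff_le)
  next
    fix c :: real and x
    show "m (c *\<^sub>R x) = c *\<^sub>R m x"
    proof (cases "c \<ge> 0")
      case True then show ?thesis using m by (auto simp: sublinear_def)
    next
      case False
      then have "m ((- c) *\<^sub>R x) = (- c) * m x" using m unfolding sublinear_def by (meson less_eq_real_def neg_0_le_iff_le not_le)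
      then show ?thesis using odd[of "c *\<^sub>R x"] by simp
    qed
  qed
qed

text \<open>
  The bound is the pointwise infimum. It is finite because every member is at least \<open>- q (- x)\<close> at \<open>x\<close>,
  and subadditive because any two members of a chain can be replaced by the smaller one.
\<close>

lemma sublinear_chain_bound:
  fixes C :: "('v::real_vector \<Rightarrow> real) set"
  assumes "C \<noteq> {}" and sub: "\<And>p. p \<in> C \<Longrightarrow> sublinear p" and le: "\<And>p. p \<in> C \<Longrightarrow> p \<le> q"
    and chain: "\<And>p p'. p \<in> C \<Longrightarrow> p' \<in> C \<Longrightarrow> p \<le> p' \<or> p' \<le> p"
  obtains u where "sublinear u" "\<And>p. p \<in> C \<Longrightarrow> u \<le> p"
proof -
  define u where "u x = Inf ((\<lambda>p. p x) ` C)" for x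
  have bdd: "bdd_below ((\<lambda>p. p x) ` C)" for x
  proof (rule bdd_belowI)
    fix r assume "r \<in> (\<lambda>p. p x) ` C"
    then obtain p where "p \<in> C" "r = p x" by auto
    then show "- q (- x) \<le> r"
      using sublinear_ge_minus[OF sub, of p x] le[of p] by (force simp: le_fun_def dest: spec[of _ "- x"])
  qed
  have low: "u x \<le> p x" if "p \<in> C" for p x
    unfolding u_def using that by (intro cInf_lower[OF _ bdd]) auto
  have great: "m \<le> u x" if "\<And>p. p \<in> C \<Longrightarrow> m \<le> p x" for m x
    unfolding u_def using that \<open>C \<noteq> {}\<close> by (intro cInf_greatest) auto
  have "sublinear u"
  proof (rule sublinearI)
    fix x y
    have "u (x + y) - p' y \<le> p x" if pp: "p \<in> C" "p' \<in> C" for p p'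
    proof -
      obtain r where "r \<in> C" "r \<le> p" "r \<le> p'" using chain[OF pp] pp by (metis order_refl)
      moreover from this have "r (x + y) \<le> r x + r y" using sub by (auto simp: sublinear_def)
      ultimately show ?thesis using low[of r "x + y"] by (smt (verit) le_funD)
    qed
    then have "u (x + y) - p' y \<le> u x" if "p' \<in> C" for p'
      using that by (intro great) auto
    then have "u (x + y) - u x \<le> u y" by (intro great) (simp add: algebra_simps)
    then show "u (x + y) \<le> u x + u y" by simp
  next
    obtain p where "p \<in> C" using \<open>C \<noteq> {}\<close> by auto
    then have "u 0 \<le> 0" using low[of p 0] sublinear_zero[OF sub, of p] by simp
    moreover have "0 \<le> u 0" by (rule great) (simp add: sublinear_zero[OF sub])
    ultimately show "u 0 = 0" by simp
  next
    fix c :: real and x assume c: "c > 0"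
    have "inverse c * u (c *\<^sub>R x) \<le> u x"
    proof (rule great)
      fix p assume "p \<in> C"
      then have "u (c *\<^sub>R x) \<le> c * p x"
        using low[of p "c *\<^sub>R x"] sub[of p] c by (auto simp: sublinear_def)
      then show "inverse c * u (c *\<^sub>R x) \<le> p x" using c by (simp add: field_simps)
    qed
    then show "u (c *\<^sub>R x) \<le> c * u x" using c by (simp add: field_simps)
  qed
  then show ?thesis using that low by (auto simp: le_fun_def)
qed

text \<open>
  Minimal sublinear functionals take the place of extensions from subspaces: Zorn's lemma provides one
  below a sublinear \<open>q0 \<le> q\<close> with \<open>q0 (- x0) \<le> - q x0\<close>. It is linear, and its value at \<open>- x0\<close> forces the
  value \<open>q x0\<close> at \<open>x0\<close>.
\<close>

lemma Hahn_Banach_sublinear: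
  fixes q :: "'v::real_vector \<Rightarrow> real"
  assumes q: "sublinear q"
  obtains l where "linear l" "\<And>x. l x \<le> q x" "l x0 = q x0"
proof -
  obtain q0 where q0: "sublinear q0" "\<And>x. q0 x \<le> q x" "q0 (- x0) \<le> - q x0"
    using sublinear_lower[OF q] by blast
  define A where "A = {p. sublinear p \<and> p \<le> q0}"
  have "\<exists>m\<in>A. \<forall>a\<in>A. a \<le> m \<longrightarrow> a = m"
  proof (rule predicate_Zorn)
    show "partial_order_on A (relation_of (\<lambda>m a. a \<le> m) A)"
      by (rule partial_order_on_relation_ofI) auto
    fix C assume C: "C \<in> Chains (relation_of (\<lambda>m a. a \<le> m) A)"
    show "\<exists>u\<in>A. \<forall>a\<in>C. u \<le> a"
    proof (cases "C = {}")
      case True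
      then show ?thesis using q0(1) by (auto simp: A_def)
    next
      case False
      have CA: "\<And>p. p \<in> C \<Longrightarrow> p \<in> A"
        and chain: "\<And>p p'. p \<in> C \<Longrightarrow> p' \<in> C \<Longrightarrow> p \<le> p' \<or> p' \<le> p"
        using C by (auto simp: Chains_def relation_of_def)
      obtain u where u: "sublinear u" "\<And>p. p \<in> C \<Longrightarrow> u \<le> p"
        using sublinear_chain_bound[OF False, of q0] CA chain unfolding A_def by (smt (verit) mem_Collect_eq)
      moreover obtain p where "p \<in> C" using False by auto
      ultimately have "u \<le> q0" using CA[of p] unfolding A_def
        by (metis (no_types, lifting) mem_Collect_eq order_trans)
      then show ?thesis using u by (auto simp: A_def)
    qed
  qed
  then obtain m where m: "sublinear m" "m \<le> q0" "\<And>a. sublinear a \<Longrightarrow> a \<le> m \<Longrightarrow> a = m"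
    unfolding A_def by (smt (verit) mem_Collect_eq order_trans)
  have lin: "linear m" using m by (intro minimal_sublinear_imp_linear) auto
  have le: "m x \<le> q x" for x using m(2) q0(2)[of x] by (meson le_funD order_trans)
  have "- m x0 = m (- x0)" using lin by (simp add: linear_neg)
  also have "\<dots> \<le> - q x0" using m(2) q0(3) by (meson le_funD order_trans)
  finally have "m x0 = q x0" using le[of x0] by simp
  with lin le show ?thesis by (rule that)
qed

section \<open>Functionals on locally convex spaces\<close>

definition cfunctional ::
  "(complex \<Rightarrow> 'v \<Rightarrow> 'v::{ab_group_add, topological_space}) \<Rightarrow> ('v \<Rightarrow> complex) \<Rightarrow> bool" where
  "cfunctional scaleC l \<longleftrightarrow> Vector_Spaces.linear scaleC (*) l \<and> continuous_on UNIV l"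

lemma cfunctional_simps:
  assumes "cfunctional scaleC l"
  shows "l (x + y) = l x + l y" "l (x - y) = l x - l y" "l 0 = 0" "l (scaleC c x) = c * l x"
    "l (sum h A) = (\<Sum>a\<in>A. l (h a))"
proof -
  interpret l: Vector_Spaces.linear scaleC "(*)" l
    using assms by (simp add: cfunctional_def)
  show "l (x + y) = l x + l y" "l (x - y) = l x - l y" "l 0 = 0" "l (scaleC c x) = c * l x"
    "l (sum h A) = (\<Sum>a\<in>A. l (h a))"
    by (simp_all add: l.add l.diff l.scale l.sum)
qed

lemma complex_lcs_scaleR:
  assumes "complex_lcs scaleC"
  shows "scaleC (of_real r) x = r *\<^sub>R x"
  using assms by (simp add: complex_lcs_def)

lemma complex_lcs_tendsto_scaleC:
  fixes scaleC :: "complex \<Rightarrow> 'v \<Rightarrow>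
    'v::{real_vector, uniform_topological_group_add, topological_ab_group_add, t2_space}"
    and x :: "'t \<Rightarrow> 'v"
  assumes "complex_lcs scaleC" and "(c \<longlongrightarrow> a) F" and "(x \<longlongrightarrow> y) F"
  shows "((\<lambda>t. scaleC (c t) (x t)) \<longlongrightarrow> scaleC a y) F"
proof -
  have "isCont (\<lambda>(c, x). scaleC c x) (a, y)"
    using assms(1) by (auto simp: complex_lcs_def continuous_on_eq_continuous_at)
  from isCont_tendsto_compose[OF this tendsto_Pair[OF assms(2,3)]] show ?thesis by simp
qed

lemma complex_lcs_continuous_on_scaleC:
  fixes scaleC :: "complex \<Rightarrow> 'v \<Rightarrow>
    'v::{real_vector, uniform_topological_group_add, topological_ab_group_add, t2_space}"
  assumes lcs: "complex_lcs scaleC" and c: "continuous_on S c" and x: "continuous_on S x"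
  shows "continuous_on S (\<lambda>t. scaleC (c t) (x t))"
  unfolding continuous_on_def
proof
  fix t assume "t \<in> S"
  then show "((\<lambda>t. scaleC (c t) (x t)) \<longlongrightarrow> scaleC (c t) (x t)) (at t within S)"
    using c x by (intro complex_lcs_tendsto_scaleC[OF lcs]) (auto simp: continuous_on_def)
qed

lemma complex_lcs_tendsto_scaleR:
  fixes scaleC :: "complex \<Rightarrow> 'v \<Rightarrow>
    'v::{real_vector, uniform_topological_group_add, topological_ab_group_add, t2_space}"
    and x :: "'t \<Rightarrow> 'v"
  assumes "complex_lcs scaleC" and "(c \<longlongrightarrow> a) F" and "(x \<longlongrightarrow> y) F"
  shows "((\<lambda>t. c t *\<^sub>R x t) \<longlongrightarrow> a *\<^sub>R y) F"
  using complex_lcs_tendsto_scaleC[OF assms(1) tendsto_of_real[OF assms(2), where 'a = complex] assms(3)]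
  by (simp add: complex_lcs_scaleR[OF assms(1)])

text \<open>
  The function is the Minkowski functional of \<open>C\<close>. Its limit at \<open>0\<close> is \<open>0\<close> because \<open>x\<close> lies in \<open>(a / 2) C\<close>
  for all \<open>x\<close> near \<open>0\<close>.
\<close>

lemma gauge_exists:
  fixes scaleC :: "complex \<Rightarrow> 'v \<Rightarrow>
    'v::{real_vector, uniform_topological_group_add, topological_ab_group_add, t2_space}"
  assumes lcs: "complex_lcs scaleC" and C: "convex (C::'v set)" "0 \<in> interior C"
  obtains q :: "'v \<Rightarrow> real" where "sublinear q" "\<And>x. q x \<ge> 0" "\<And>x. x \<notin> C \<Longrightarrow> q x \<ge> 1"
    "(q \<longlongrightarrow> 0) (nhds 0)"
proof -
  define G where "G x = {t. t > 0 \<and> inverse t *\<^sub>R x \<in> C}" for x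
  define q where "q x = Inf (G x)" for x
  have C0: "0 \<in> C" using C(2) interior_subset by blast
  have bdd: "bdd_below (G x)" for x
    by (rule bdd_belowI[of _ 0]) (auto simp: G_def)
  have ne: "G x \<noteq> {}" for x
  proof -
    have "((\<lambda>t::real. inverse t *\<^sub>R x) \<longlongrightarrow> 0 *\<^sub>R x) at_top"
      by (intro complex_lcs_tendsto_scaleR[OF lcs] tendsto_inverse_0_at_top filterlim_ident tendsto_const)
    then have "\<forall>\<^sub>F t in at_top. inverse t *\<^sub>R x \<in> interior C"
      using C(2) by (auto dest: topological_tendstoD)
    then have "\<forall>\<^sub>F t in at_top. t > 0 \<and> inverse t *\<^sub>R x \<in> interior C"
      using eventually_gt_at_top[of "0::real"] by eventually_elim auto
    then obtain t::real where "t > 0" "inverse t *\<^sub>R x \<in> interior C"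
      using eventually_happens'[OF trivial_limit_at_top_linorder] by blast
    then show ?thesis using interior_subset by (force simp: G_def)
  qed
  have low: "q x \<le> t" if "t \<in> G x" for t x
    unfolding q_def using that by (intro cInf_lower[OF _ bdd]) auto
  have great: "m \<le> q x" if "\<And>t. t \<in> G x \<Longrightarrow> m \<le> t" for m x
    unfolding q_def using that ne by (intro cInf_greatest) auto
  have q0: "q x \<ge> 0" for x by (rule great) (auto simp: G_def)
  have G_add: "s + t \<in> G (x + y)" if "s \<in> G x" "t \<in> G y" for s t x y
  proof -
    have pos: "s > 0" "t > 0" using that by (auto simp: G_def)
    have "(s / (s+t)) *\<^sub>R (inverse s *\<^sub>R x) + (t / (s+t)) *\<^sub>R (inverse t *\<^sub>R y) \<in> C"
      using that pos by (intro convexD[OF C(1)]) (auto simp: G_def simp flip: add_divide_distrib)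
    also have "(s / (s+t)) *\<^sub>R (inverse s *\<^sub>R x) + (t / (s+t)) *\<^sub>R (inverse t *\<^sub>R y)
      = inverse (s + t) *\<^sub>R (x + y)"
      using pos by (simp add: scaleR_add_right field_simps)
    finally show ?thesis using pos by (simp add: G_def)
  qed
  have "sublinear q"
  proof (rule sublinearI)
    fix x y
    have "q (x + y) - t \<le> q x" if "t \<in> G y" for t
      using low[OF G_add[OF _ that]] by (intro great) (simp add: algebra_simps)
    then have "q (x + y) - q x \<le> q y" by (intro great) (simp add: algebra_simps)
    then show "q (x + y) \<le> q x + q y" by simp
  next
    have "q 0 \<le> e" if "e > 0" for e
      using that C0 by (intro low) (simp add: G_def)
    then have "q 0 \<le> 0" using field_le_epsilon[of "q 0" 0] by simp
    then show "q 0 = 0" using q0[of 0] by simp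
  next
    fix c :: real and x assume c: "c > 0"
    have "q (c *\<^sub>R x) / c \<le> q x"
    proof (rule great)
      fix t assume "t \<in> G x"
      then have "c * t \<in> G (c *\<^sub>R x)" using c by (auto simp: G_def field_simps)
      then have "q (c *\<^sub>R x) \<le> c * t" by (rule low)
      then show "q (c *\<^sub>R x) / c \<le> t" using c by (simp add: field_simps)
    qed
    then show "q (c *\<^sub>R x) \<le> c * q x" using c by (simp add: field_simps)
  qed
  moreover have "q x \<ge> 1" if "x \<notin> C" for x
  proof (rule great, rule ccontr)
    fix t assume t: "t \<in> G x" "\<not> 1 \<le> t"
    have "(1 - t) *\<^sub>R 0 + t *\<^sub>R (inverse t *\<^sub>R x) \<in> C"
      using t C0 by (intro convexD[OF C(1)]) (auto simp: G_def)
    then show False using that t by (simp add: G_def)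
  qed
  moreover have "(q \<longlongrightarrow> 0) (nhds 0)"
  proof (rule order_tendstoI)
    fix a :: real assume "a < 0"
    then show "\<forall>\<^sub>F x in nhds 0. a < q x" using q0 by (intro always_eventually) (smt (verit))
  next
    fix a :: real assume a: "0 < a"
    have "((\<lambda>x::'v. inverse (a/2) *\<^sub>R x) \<longlongrightarrow> inverse (a/2) *\<^sub>R 0) (nhds 0)"
      by (intro complex_lcs_tendsto_scaleR[OF lcs] tendsto_const filterlim_ident)
    then have "\<forall>\<^sub>F x in nhds 0. inverse (a/2) *\<^sub>R x \<in> interior C"
      using C(2) by (auto dest: topological_tendstoD)
    then show "\<forall>\<^sub>F x in nhds 0. q x < a"
    proof eventually_elim
      case (elim x)
      then have "a/2 \<in> G x" using a subsetD[OF interior_subset elim] by (simp add: G_def)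
      then show ?case using low[of "a/2" x] a by simp
    qed
  qed
  ultimately show ?thesis using q0 that by blast
qed

text \<open>
  Subadditivity gives \<open>\<bar>q x - q a\<bar> \<le> \<bar>q (x - a)\<bar> + \<bar>q (a - x)\<bar>\<close>, so continuity at \<open>0\<close> is enough.
\<close>

lemma sublinear_continuous:
  fixes q :: "'v::{real_vector, topological_ab_group_add} \<Rightarrow> real"
  assumes q: "sublinear q" and lim: "(q \<longlongrightarrow> 0) (nhds 0)"
  shows "continuous_on UNIV q"
proof -
  have "(q \<longlongrightarrow> q a) (at a)" for a
  proof -
    have sub: "q (x + y) \<le> q x + q y" for x y using q by (simp add: sublinear_def)
    have "((\<lambda>x. x - a) \<longlongrightarrow> a - a) (at a)" "((\<lambda>x. a - x) \<longlongrightarrow> a - a) (at a)"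
      by (intro tendsto_intros)+
    then have "((\<lambda>x. q (x - a)) \<longlongrightarrow> 0) (at a)" "((\<lambda>x. q (a - x)) \<longlongrightarrow> 0) (at a)"
      using filterlim_compose[OF lim] by simp_all
    then have "((\<lambda>x. \<bar>q (x - a)\<bar> + \<bar>q (a - x)\<bar>) \<longlongrightarrow> 0) (at a)"
      by (auto intro!: tendsto_add_zero tendsto_rabs_zero)
    moreover have "\<forall>\<^sub>F x in at a. norm (q x - q a) \<le> \<bar>q (x - a)\<bar> + \<bar>q (a - x)\<bar>"
    proof (rule always_eventually, rule allI)
      fix x
      show "norm (q x - q a) \<le> \<bar>q (x - a)\<bar> + \<bar>q (a - x)\<bar>"
        using sub[of "x - a" a] sub[of "a - x" x] by (simp add: abs_le_iff) (smt (verit))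
    qed
    ultimately have "((\<lambda>x. q x - q a) \<longlongrightarrow> 0) (at a)"
      by (rule Lim_null_comparison[rotated])
    then show ?thesis by (simp add: LIM_zero_iff)
  qed
  then show ?thesis by (simp add: continuous_on_def)
qed

text \<open>
  A real-linear functional is the real part of a complex-linear one. A gauge \<open>q\<close> need not be
  balanced, so the modulus is estimated by the sum of \<open>q\<close> over the four directions \<open>x\<close>, \<open>- x\<close>, \<open>\<i> x\<close>
  and \<open>- \<i> x\<close>.
\<close>

lemma cfunctional_of_real_functional:
  fixes scaleC :: "complex \<Rightarrow> 'v \<Rightarrow>
    'v::{real_vector, uniform_topological_group_add, topological_ab_group_add, t2_space}"
    and l :: "'v \<Rightarrow> real"
  assumes lcs: "complex_lcs scaleC" and l: "linear l"
    and q: "continuous_on UNIV q" "q 0 = 0" "\<And>x. q x \<ge> 0" and le: "\<And>x. l x \<le> q x"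
  defines "L \<equiv> \<lambda>x. Complex (l x) (- l (scaleC \<i> x))"
  shows "cfunctional scaleC L"
    and "cmod (L x) \<le> q x + q (- x) + q (scaleC \<i> x) + q (- scaleC \<i> x)"
    and "continuous_on UNIV (\<lambda>x. q x + q (- x) + q (scaleC \<i> x) + q (- scaleC \<i> x))"
proof -
  interpret V: vector_space scaleC using lcs by (simp add: complex_lcs_def)
  interpret l: linear l by (fact l)
  define Q where "Q x = q x + q (- x) + q (scaleC \<i> x) + q (- scaleC \<i> x)" for x
  have bound: "\<bar>l x\<bar> \<le> q x + q (- x)" for x
    using le[of x] le[of "- x"] q(3)[of x] q(3)[of "-x"] by (auto simp: l.neg abs_le_iff)
  have L_le: "cmod (L x) \<le> Q x" for x
    using cmod_le[of "L x"] bound[of x] bound[of "scaleC \<i> x"] by (simp add: L_def Q_def)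
  then show "cmod (L x) \<le> q x + q (- x) + q (scaleC \<i> x) + q (- scaleC \<i> x)"
    by (simp add: Q_def)
  have q_nhds: "(q \<longlongrightarrow> q a) (nhds a)" for a
    using q(1) by (auto simp: continuous_on_eq_continuous_at isCont_def tendsto_at_iff_tendsto_nhds)
  have i_lim: "((\<lambda>x. scaleC \<i> x) \<longlongrightarrow> scaleC \<i> a) (nhds a)" for a
    by (intro complex_lcs_tendsto_scaleC[OF lcs] tendsto_const filterlim_ident)
  have Q_lim: "(Q \<longlongrightarrow> Q a) (nhds a)" for a
    unfolding Q_def
    by (intro tendsto_add q_nhds filterlim_compose[OF q_nhds i_lim]
        filterlim_compose[OF q_nhds tendsto_minus[OF filterlim_ident]]
        filterlim_compose[OF q_nhds tendsto_minus[OF i_lim]])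
  then have Q_cont: "continuous_on UNIV Q"
    by (auto simp: continuous_on_eq_continuous_at isCont_def tendsto_at_iff_tendsto_nhds)
  then show "continuous_on UNIV (\<lambda>x. q x + q (- x) + q (scaleC \<i> x) + q (- scaleC \<i> x))"
    by (simp add: Q_def [abs_def])
  have Q0: "Q 0 = 0" by (simp add: Q_def q(2))
  have L_add: "L (x + y) = L x + L y" for x y
    by (simp add: L_def l.add V.scale_right_distrib complex_eq_iff)
  have L_real: "L (scaleC (of_real r) x) = of_real r * L x" for r x
  proof -
    have "scaleC \<i> (scaleC (of_real r) x) = scaleC (of_real r) (scaleC \<i> x)"
      by (simp add: mult.commute)
    then show ?thesis
      by (simp add: L_def complex_lcs_scaleR[OF lcs] l.scaleR complex_eq_iff del: V.scale_scale)
  qed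
  have L_i: "L (scaleC \<i> x) = \<i> * L x" for x
    by (simp add: L_def complex_eq_iff l.neg)
  have L_scale: "L (scaleC c x) = c * L x" for c x
  proof -
    have "scaleC c x = scaleC (of_real (Re c)) x + scaleC \<i> (scaleC (of_real (Im c)) x)"
      by (metis V.scale_left_distrib V.scale_scale complex_eq)
    then have "L (scaleC c x) = of_real (Re c) * L x + \<i> * (of_real (Im c) * L x)"
      by (simp add: L_add L_real L_i del: V.scale_scale)
    also have "\<dots> = c * L x" by (metis complex_eq distrib_right mult.assoc)
    finally show ?thesis .
  qed
  interpret L: Vector_Spaces.linear scaleC "(*)" L
    by unfold_locales (auto simp: L_add L_scale algebra_simps)
  have "(L \<longlongrightarrow> L a) (at a)" for a
  proof -
    have "((\<lambda>x. x - a) \<longlongrightarrow> a - a) (at a)" by (intro tendsto_intros)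
    then have "((\<lambda>x. Q (x - a)) \<longlongrightarrow> 0) (at a)"
      using filterlim_compose[OF Q_lim] Q0 by (metis cancel_comm_monoid_add_class.diff_cancel)
    moreover have "\<forall>\<^sub>F x in at a. norm (L x - L a) \<le> Q (x - a)"
      using L_le by (simp flip: L.diff)
    ultimately have "((\<lambda>x. L x - L a) \<longlongrightarrow> 0) (at a)"
      by (rule Lim_null_comparison[rotated])
    then show ?thesis by (simp add: LIM_zero_iff)
  qed
  then show "cfunctional scaleC L"
    unfolding cfunctional_def continuous_on_def using L.linear_axioms by auto
qed

text \<open>
  The interface to local convexity that the later parts use. The family is equicontinuous, being
  dominated by one continuous function that vanishes at \<open>0\<close>, and it is large enough to confine to \<open>U\<close> all
  points on which its members are small.
\<close>

definition norming_family ::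
  "(complex \<Rightarrow> 'v \<Rightarrow> 'v::{ab_group_add, topological_space}) \<Rightarrow> 'v set \<Rightarrow> ('v \<Rightarrow> complex) set \<Rightarrow> ('v \<Rightarrow> real) \<Rightarrow> bool"
  where "norming_family scaleC U \<L> Q \<longleftrightarrow> continuous_on UNIV Q \<and> Q 0 = 0 \<and>
    (\<forall>l\<in>\<L>. cfunctional scaleC l \<and> (\<forall>x. cmod (l x) \<le> Q x)) \<and>
    (\<forall>x. (\<forall>l\<in>\<L>. cmod (l x) \<le> 1/2) \<longrightarrow> x \<in> U)"

lemma norming_familyD:
  assumes "norming_family scaleC U \<L> Q"
  shows "continuous_on UNIV Q" "Q 0 = 0"
    "\<And>l. l \<in> \<L> \<Longrightarrow> cfunctional scaleC l" "\<And>l x. l \<in> \<L> \<Longrightarrow> cmod (l x) \<le> Q x"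
    "\<And>x. (\<And>l. l \<in> \<L> \<Longrightarrow> cmod (l x) \<le> 1/2) \<Longrightarrow> x \<in> U"
  using assms by (simp_all add: norming_family_def)

text \<open>
  A point outside a convex \<open>C \<subseteq> U\<close> has gauge at least \<open>1\<close>, and a Hahn-Banach functional attains this
  gauge there. All functionals dominated by the gauge in the four directions thus form a norming
  family.
\<close>

lemma norming_functionals:
  fixes scaleC :: "complex \<Rightarrow> 'v \<Rightarrow>
    'v::{real_vector, uniform_topological_group_add, topological_ab_group_add, t2_space}"
  assumes lcs: "complex_lcs scaleC" and U: "open U" "0 \<in> U"
  obtains \<L> Q where "norming_family scaleC U \<L> Q"
proof -
  interpret V: vector_space scaleC using lcs by (simp add: complex_lcs_def)
  obtain C where C: "convex C" "0 \<in> interior C" "C \<subseteq> U"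
    using lcs U unfolding complex_lcs_def by meson
  obtain q where q: "sublinear q" "\<And>x. q x \<ge> 0" "\<And>x. x \<notin> C \<Longrightarrow> q x \<ge> 1" "(q \<longlongrightarrow> 0) (nhds 0)"
    using gauge_exists[OF lcs C(1,2)] by metis
  have qc: "continuous_on UNIV q" and qz: "q 0 = 0"
    using q sublinear_continuous sublinear_zero by blast+
  define Q where "Q x = q x + q (- x) + q (scaleC \<i> x) + q (- scaleC \<i> x)" for x
  define \<L> where "\<L> = {l. cfunctional scaleC l \<and> (\<forall>x. cmod (l x) \<le> Q x)}"
  have L: "\<exists>L\<in>\<L>. cmod (L x) \<ge> q x" for x
  proof -
    obtain l where l: "linear l" "\<And>y. l y \<le> q y" "l x = q x"
      using Hahn_Banach_sublinear[OF q(1)] by metis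
    define L where "L y = Complex (l y) (- l (scaleC \<i> y))" for y
    have "L \<in> \<L>"
      using cfunctional_of_real_functional(1,2)[OF lcs l(1) qc qz q(2) l(2)]
      by (auto simp: \<L>_def Q_def L_def [abs_def])
    moreover have "cmod (L x) \<ge> q x"
      using complex_Re_le_cmod[of "L x"] by (simp add: L_def l(3))
    ultimately show ?thesis by blast
  qed
  have "x \<in> U" if *: "\<forall>l\<in>\<L>. cmod (l x) \<le> 1/2" for x
  proof (rule ccontr)
    assume "x \<notin> U"
    then have "q x \<ge> 1" using q(3) C(3) by blast
    then show False using L[of x] * by fastforce
  qed
  moreover have "continuous_on UNIV Q"
    unfolding Q_def [abs_def]
    by (rule cfunctional_of_real_functional(3)[OF lcs _ qc qz q(2), of "\<lambda>_. 0"])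
      (auto simp: linear_iff q(2))
  moreover have "Q 0 = 0" by (simp add: Q_def qz)
  ultimately have "norming_family scaleC U \<L> Q"
    by (simp add: norming_family_def \<L>_def)
  then show ?thesis by (rule that)
qed

lemma tendsto_zero_lcs:
  fixes scaleC :: "complex \<Rightarrow> 'v \<Rightarrow>
    'v::{real_vector, uniform_topological_group_add, topological_ab_group_add, t2_space}"
  assumes "complex_lcs scaleC"
    and "\<And>U \<L> Q. norming_family scaleC U \<L> Q \<Longrightarrow> \<forall>\<^sub>F x in F. \<forall>l\<in>\<L>. cmod (l (h x)) \<le> 1/2"
  shows "(h \<longlongrightarrow> (0::'v)) F"
proof (rule topological_tendstoI)
  fix U :: "'v set" assume "open U" "0 \<in> U"
  then obtain \<L> Q where fam: "norming_family scaleC U \<L> Q"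
    using norming_functionals[OF assms(1)] by metis
  from assms(2)[OF this] show "\<forall>\<^sub>F x in F. h x \<in> U"
    by eventually_elim (use norming_familyD(5)[OF fam] in blast)
qed

lemma cfunctionals_separate:
  fixes scaleC :: "complex \<Rightarrow> 'v \<Rightarrow>
    'v::{real_vector, uniform_topological_group_add, topological_ab_group_add, t2_space}"
  assumes lcs: "complex_lcs scaleC" and eq: "\<And>l. cfunctional scaleC l \<Longrightarrow> l x = l y"
  shows "x = y"
proof (rule ccontr)
  assume "x \<noteq> y"
  then obtain U where U: "open U" "0 \<in> U" "x - y \<notin> U"
    using t1_space[of 0 "x - y"] by auto
  obtain \<L> Q where "norming_family scaleC U \<L> Q"
    using norming_functionals[OF lcs U(1,2)] .
  note fam = norming_familyD[OF this]
  have "cmod (l (x - y)) \<le> 1/2" if "l \<in> \<L>" for l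
    using eq[OF fam(3)[OF that]] by (simp add: cfunctional_simps[OF fam(3)[OF that]])
  then show False using fam(5) U(3) by blast
qed

lemma cfunctional_scaleR:
  assumes "complex_lcs scaleC" "cfunctional scaleC l"
  shows "l (r *\<^sub>R x) = r *\<^sub>R l x"
  using cfunctional_simps(4)[OF assms(2), of "of_real r" x] complex_lcs_scaleR[OF assms(1)]
  by (simp add: scaleR_conv_of_real)

section \<open>Integrals with values in quasi-complete spaces\<close>

text \<open>
  The error is expressed by a modulus of continuity alone, so that it is uniform over families of
  functionals and over compact sets of parameters.
\<close>

lemma riemann_sum_error:
  fixes \<phi> :: "real \<Rightarrow> complex"
  assumes cont: "continuous_on {0..1} \<phi>" and N: "N > 0"
    and e: "\<And>s t. s \<in> {0..1} \<Longrightarrow> t \<in> {0..1} \<Longrightarrow> \<bar>s - t\<bar> \<le> 1 / real N \<Longrightarrow> cmod (\<phi> s - \<phi> t) \<le> e"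
  shows "cmod ((\<Sum>j<N. of_real (1 / real N) * \<phi> (real j / real N)) - integral {0..1} \<phi>) \<le> e"
proof -
  have "k \<le> N \<Longrightarrow> cmod ((\<Sum>j<k. of_real (1 / real N) * \<phi> (real j / real N))
      - integral {0..real k / real N} \<phi>) \<le> real k * (e / real N)" for k
  proof (induction k)
    case 0
    then show ?case by simp
  next
    case (Suc k)
    define a b where "a = real k / real N" and "b = real (Suc k) / real N"
    have ab: "0 \<le> a" "a \<le> b" "b \<le> 1" "b - a = 1 / real N"
      using Suc.prems N by (auto simp: a_def b_def field_simps)
    have int: "\<phi> integrable_on {0..b}"
      using cont ab by (intro integrable_continuous_interval) (auto elim: continuous_on_subset)
    then have split: "integral {0..b} \<phi> = integral {0..a} \<phi> + integral {a..b} \<phi>"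
      using Henstock_Kurzweil_Integration.integral_combine[OF ab(1,2) int] by simp
    have cab: "continuous_on {a..b} \<phi>"
      using cont ab by (auto elim: continuous_on_subset)
    have "cmod (integral {a..b} (\<lambda>t. \<phi> a - \<phi> t)) \<le> e * (b - a)"
    proof (rule integral_bound)
      fix t assume "t \<in> {a..b}"
      then show "cmod (\<phi> a - \<phi> t) \<le> e" using ab by (intro e) auto
    qed (use ab cab in \<open>auto intro!: continuous_intros\<close>)
    also have "integral {a..b} (\<lambda>t. \<phi> a - \<phi> t) = of_real (1 / real N) * \<phi> a - integral {a..b} \<phi>"
      using ab integrable_continuous_interval[OF cab]
      by (subst Henstock_Kurzweil_Integration.integral_diff) (auto simp: scaleR_conv_of_real)
    finally have step: "cmod (of_real (1 / real N) * \<phi> a - integral {a..b} \<phi>) \<le> e / real N"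
      using ab by simp
    have "(\<Sum>j<Suc k. of_real (1 / real N) * \<phi> (real j / real N)) - integral {0..b} \<phi>
      = ((\<Sum>j<k. of_real (1 / real N) * \<phi> (real j / real N)) - integral {0..a} \<phi>)
        + (of_real (1 / real N) * \<phi> a - integral {a..b} \<phi>)"
      by (simp add: split a_def)
    also have "cmod \<dots> \<le> real k * (e / real N) + e / real N"
      using Suc step by (intro norm_triangle_mono) (auto simp: a_def)
    also have "\<dots> = real (Suc k) * (e / real N)" by (simp add: distrib_right add_divide_distrib)
    finally show ?case by (simp add: b_def)
  qed
  from this[of N] show ?thesis using N by simp
qed

text \<open>
  The real function \<open>Q (h s - h t)\<close> is uniformly continuous on \<open>K \<times> K\<close> and vanishes on the diagonal.
\<close>

lemma uniform_modulus_on_compact: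
  fixes h :: "'a::metric_space \<Rightarrow> 'v::topological_ab_group_add" and Q :: "'v \<Rightarrow> real"
  assumes Q: "continuous_on UNIV Q" "Q 0 = 0" and h: "continuous_on K h" and K: "compact K"
    and "e > 0"
  obtains d where "d > 0" "\<And>s t. s \<in> K \<Longrightarrow> t \<in> K \<Longrightarrow> dist s t < d \<Longrightarrow> Q (h s - h t) < e"
proof -
  have "continuous_on (K \<times> K) (\<lambda>x. h (fst x) - h (snd x))"
    by (intro continuous_intros continuous_on_compose2[OF h]) auto
  then have "continuous_on (K \<times> K) (\<lambda>x. Q (h (fst x) - h (snd x)))"
    by (rule continuous_on_compose2[OF Q(1)]) auto
  then have "uniformly_continuous_on (K \<times> K) (\<lambda>x. Q (h (fst x) - h (snd x)))"
    by (intro compact_uniformly_continuous compact_Times K)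
  then obtain d where d: "d > 0" "\<And>x y. x \<in> K \<times> K \<Longrightarrow> y \<in> K \<times> K \<Longrightarrow> dist y x < d \<Longrightarrow>
     dist (Q (h (fst y) - h (snd y))) (Q (h (fst x) - h (snd x))) < e"
    using \<open>e > 0\<close> unfolding uniformly_continuous_on_def by metis
  show ?thesis
  proof (rule that[OF d(1)])
    fix s t assume "s \<in> K" "t \<in> K" "dist s t < d"
    then have "dist (Q (h s - h t)) (Q (h t - h t)) < e"
      using d(2)[of "(t, t)" "(s, t)"] by (simp add: dist_Pair_Pair)
    then show "Q (h s - h t) < e" using Q(2) by (simp add: dist_real_def)
  qed
qed

text \<open>
  The value \<open>I\<close> is a limit of Riemann sums. For all members of a norming family the errors obey a common
  bound, so the sums form a Cauchy sequence. They remain in a closed bounded set, which is complete by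
  quasi-completeness.
\<close>

lemma cfunctional_integral_exists:
  fixes scaleC :: "complex \<Rightarrow> 'v \<Rightarrow>
    'v::{real_vector, uniform_topological_group_add, topological_ab_group_add, t2_space}"
  assumes qc: "quasi_complete_lcs scaleC" and h: "continuous_on {0..1} h"
  shows "\<exists>I::'v. \<forall>l. cfunctional scaleC l \<longrightarrow> ((\<lambda>t::real. l (h t)) has_integral l I) {0..1}"
proof -
  have lcs: "complex_lcs scaleC"
    using qc by (simp add: quasi_complete_lcs_def)
  have lh: "continuous_on {0..1} (\<lambda>t. l (h t))" if "cfunctional scaleC l" for l
    using that h by (auto simp: cfunctional_def intro: continuous_on_compose2)
  define S where "S N = (\<Sum>j<Suc N. scaleC (of_real (1 / real (Suc N))) (h (real j / real (Suc N))))" for N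
  have lS: "l (S N) = (\<Sum>j<Suc N. of_real (1 / real (Suc N)) * l (h (real j / real (Suc N))))"
    if "cfunctional scaleC l" for l N
    unfolding S_def by (simp only: cfunctional_simps[OF that])
  have conv: "\<exists>M. \<forall>N\<ge>M. \<forall>l\<in>\<L>. cmod (l (S N) - integral {0..1} (\<lambda>t. l (h t))) \<le> e"
    if "norming_family scaleC U \<L> Q" and "e > 0" for U \<L> Q e
  proof -
    note Q = norming_familyD(1,2)[OF that(1)] and \<L> = norming_familyD(3,4)[OF that(1)]
    obtain d where d: "d > 0" "\<And>s t. s \<in> {0..1} \<Longrightarrow> t \<in> {0..1} \<Longrightarrow> dist s t < d \<Longrightarrow> Q (h s - h t) < e"
      using uniform_modulus_on_compact[OF Q h _ \<open>e > 0\<close>] by (metis compact_Icc)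
    obtain M where M: "1 / real (Suc M) < d"
      using d(1) nat_approx_posE by blast
    show ?thesis
    proof (intro exI[of _ M] allI impI ballI)
      fix N l assume N: "M \<le> N" and l: "l \<in> \<L>"
      have "1 / real (Suc N) \<le> 1 / real (Suc M)" using N by (simp add: frac_le)
      then have small: "1 / real (Suc N) < d" using M by simp
      show "cmod (l (S N) - integral {0..1} (\<lambda>t. l (h t))) \<le> e"
        unfolding lS[OF \<L>(1)[OF l]]
      proof (rule riemann_sum_error[OF lh[OF \<L>(1)[OF l]]])
        fix s t :: real assume st: "s \<in> {0..1}" "t \<in> {0..1}" "\<bar>s - t\<bar> \<le> 1 / real (Suc N)"
        have "cmod (l (h s) - l (h t)) = cmod (l (h s - h t))"
          by (simp add: cfunctional_simps[OF \<L>(1)[OF l]])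
        also have "\<dots> \<le> Q (h s - h t)" by (rule \<L>(2)[OF l])
        also have "\<dots> < e" using st small by (intro d(2)) (auto simp: dist_real_def)
        finally show "cmod (l (h s) - l (h t)) \<le> e" by simp
      qed simp
    qed
  qed
  have "Cauchy S"
    unfolding Cauchy_uniform_iff
  proof (intro allI impI)
    fix P :: "'v \<times> 'v \<Rightarrow> bool" assume "eventually P uniformity"
    then have "eventually P (filtercomap (\<lambda>(x, y). y - x) (nhds 0))"
      by (simp only: cauchy_seq_finset_iff_vanishing)
    then obtain R where R: "eventually R (nhds 0)" "\<And>z. R (case z of (x, y) \<Rightarrow> y - x) \<Longrightarrow> P z"
      unfolding eventually_filtercomap by metis
    from R(1) obtain U where "open U" "0 \<in> U" "\<forall>x\<in>U. R x"
      unfolding eventually_nhds by metis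
    then have U: "open U" "0 \<in> U" "\<And>x y. y - x \<in> U \<Longrightarrow> P (x, y)"
      using R(2)[of "(_, _)"] by auto
    obtain \<L> Q where fam: "norming_family scaleC U \<L> Q"
      using norming_functionals[OF lcs U(1,2)] .
    note \<L> = norming_familyD[OF fam]
    obtain M where M: "\<And>N l. N \<ge> M \<Longrightarrow> l \<in> \<L> \<Longrightarrow> cmod (l (S N) - integral {0..1} (\<lambda>t. l (h t))) \<le> 1/4"
      using conv[OF fam, of "1/4"] by auto
    show "\<exists>N. \<forall>n\<ge>N. \<forall>m\<ge>N. P (S n, S m)"
    proof (intro exI[of _ M] allI impI U(3) \<L>(5))
      fix n m l assume "M \<le> n" "M \<le> m" "l \<in> \<L>"
      then have "cmod (l (S m) - l (S n)) \<le> 1/4 + 1/4"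
        using norm_diff_triangle_le[OF M[of m l], of "l (S n)" "1/4"] M[of n l]
        by (simp add: norm_minus_commute)
      then show "cmod (l (S m - S n)) \<le> 1/2"
        using \<L>(3)[OF \<open>l \<in> \<L>\<close>] by (simp add: cfunctional_simps)
    qed
  qed
  moreover have "tvs_bounded (closure (range S))"
    unfolding tvs_bounded_def
  proof (intro allI impI, elim conjE)
    fix U :: "'v set" assume U: "open U" "0 \<in> U"
    obtain \<L> Q where fam: "norming_family scaleC U \<L> Q"
      using norming_functionals[OF lcs U(1,2)] .
    note \<L> = norming_familyD[OF fam]
    have "compact ((\<lambda>t. Q (h t)) ` {0..1})"
      by (intro compact_continuous_image continuous_on_compose2[OF \<L>(1) h]) auto
    then obtain K where K: "\<And>t. t \<in> {0..1} \<Longrightarrow> Q (h t) \<le> K" "K > 0"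
      using compact_imp_bounded bounded_pos
      by (metis (no_types, lifting) abs_le_iff image_eqI real_norm_def)
    have "cmod (l x) \<le> K" if "l \<in> \<L>" "x \<in> closure (range S)" for l x
    proof -
      have "closed {x. cmod (l x) \<le> K}"
        using \<L>(3)[OF that(1)] by (intro closed_Collect_le continuous_intros) (auto simp: cfunctional_def)
      moreover have "range S \<subseteq> {x. cmod (l x) \<le> K}"
      proof clarsimp
        fix N
        have "cmod (l (S N)) \<le> (\<Sum>j<Suc N. (1 / real (Suc N)) * K)"
          unfolding lS[OF \<L>(3)[OF that(1)]]
        proof (rule order_trans[OF norm_sum], rule sum_mono)
          fix j assume "j \<in> {..<Suc N}"
          then have "real j / real (Suc N) \<in> {0..1}" by auto
          then have "cmod (l (h (real j / real (Suc N)))) \<le> K"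
            using \<L>(4)[OF that(1)] K(1) order_trans by blast
          then show "cmod (of_real (1 / real (Suc N)) * l (h (real j / real (Suc N)))) \<le> 1 / real (Suc N) * K"
            unfolding norm_mult norm_of_real by (intro mult_mono) auto
        qed
        also have "\<dots> = K" by simp
        finally show "cmod (l (S N)) \<le> K" .
      qed
      ultimately show ?thesis using closure_minimal that(2) by blast
    qed
    note bound = this
    show "\<exists>r>0. \<forall>t\<ge>r. closure (range S) \<subseteq> (\<lambda>x. t *\<^sub>R x) ` U"
    proof (intro exI[of _ "2 * K"] conjI allI impI subsetI)
      fix t x assume t: "2 * K \<le> t" and x: "x \<in> closure (range S)"
      have "inverse t *\<^sub>R x \<in> U"
      proof (rule \<L>(5))
        fix l assume l: "l \<in> \<L>"
        have "l (inverse t *\<^sub>R x) = of_real (inverse t) * l x"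
          using cfunctional_simps(4)[OF \<L>(3)[OF l]] complex_lcs_scaleR[OF lcs] by metis
        then have "cmod (l (inverse t *\<^sub>R x)) = cmod (l x) / t"
          using t K(2) by (simp add: norm_mult norm_inverse divide_inverse mult.commute)
        also have "\<dots> \<le> K / (2 * K)"
          using bound[OF l x] t K(2) by (intro frac_le) auto
        finally show "cmod (l (inverse t *\<^sub>R x)) \<le> 1 / 2" using K(2) by simp
      qed
      moreover have "x = t *\<^sub>R (inverse t *\<^sub>R x)" using t K(2) by simp
      ultimately show "x \<in> (\<lambda>x. t *\<^sub>R x) ` U" by blast
    qed (use K(2) in simp)
  qed
  then have "complete (closure (range S))"
    using qc by (simp add: quasi_complete_lcs_def)
  moreover have "filtermap S sequentially \<le> principal (closure (range S))"
    using closure_subset[of "range S"]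
    by (auto simp: le_principal eventually_filtermap intro!: always_eventually)
  ultimately obtain I where "filtermap S sequentially \<le> nhds I"
    unfolding Cauchy_uniform using cauchy_filter_complete_converges
    by (metis filtermap_bot_iff trivial_limit_sequentially)
  then have S_lim: "S \<longlonglongrightarrow> I" by (simp add: filterlim_def)
  show ?thesis
  proof (intro exI[of _ I] allI impI)
    fix l assume l: "cfunctional scaleC l"
    have "(\<lambda>N. l (S N)) \<longlonglongrightarrow> integral {0..1} (\<lambda>t. l (h t))"
    proof (rule LIMSEQ_I)
      fix r :: real assume "r > 0"
      have "norming_family scaleC UNIV {l} (\<lambda>x. cmod (l x))"
        using l by (auto simp: norming_family_def cfunctional_simps[OF l] cfunctional_def intro: continuous_intros)
      from conv[OF this, of "r/2"] \<open>r > 0\<close>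
      obtain M where "\<forall>N\<ge>M. cmod (l (S N) - integral {0..1} (\<lambda>t. l (h t))) \<le> r/2" by auto
      then show "\<exists>M. \<forall>N\<ge>M. norm (l (S N) - integral {0..1} (\<lambda>t. l (h t))) < r"
        using \<open>r > 0\<close> by (intro exI[of _ M]) force
    qed
    moreover have "(\<lambda>N. l (S N)) \<longlonglongrightarrow> l I"
      using l S_lim by (auto simp: cfunctional_def continuous_on_eq_continuous_at intro: isCont_tendsto_compose)
    ultimately have "integral {0..1} (\<lambda>t. l (h t)) = l I" by (rule LIMSEQ_unique)
    then show "((\<lambda>t::real. l (h t)) has_integral l I) {0..1}"
      using integrable_integral[OF integrable_continuous_interval[OF lh[OF l]]] by simp
  qed
qed

section \<open>Functions holomorphic along complex lines\<close>

lemma norm_vector_scalar_mult: "norm (c *s x) = cmod c * norm (x :: complex^'n)"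
  by (simp add: norm_vec_def norm_mult L2_set_right_distrib)

lemma continuous_on_line [continuous_intros]:
  "continuous_on S h \<Longrightarrow> continuous_on S k \<Longrightarrow> continuous_on S (\<lambda>x. h x *s (k x :: complex^'n))"
  unfolding vector_scalar_mult_def by (intro continuous_intros)

lemma tendsto_vector_scalar_mult [tendsto_intros]:
  "(h \<longlongrightarrow> a) F \<Longrightarrow> (k \<longlongrightarrow> b) F \<Longrightarrow> ((\<lambda>x. h x *s (k x :: complex^'n)) \<longlongrightarrow> a *s b) F"
  unfolding vector_scalar_mult_def by (intro tendsto_intros)

lemma open_Collect_mem:
  "open U \<Longrightarrow> continuous_on UNIV h \<Longrightarrow> open {x. h x \<in> U}"
  using open_vimage[of U h] by (simp add: vimage_def)

lemma open_line_preimage: "open U \<Longrightarrow> open {\<zeta>. z + \<zeta> *s u \<in> (U :: (complex^'n) set)}"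
  by (erule open_Collect_mem) (intro continuous_intros)

text \<open>
  Continuity together with holomorphy on every complex line. This form of holomorphy in several variables
  passes to integrals and derivatives by one-variable theory alone; its equivalence with complex
  differentiability follows in the next part.
\<close>

definition line_holomorphic :: "(complex^'n \<Rightarrow> complex) \<Rightarrow> (complex^'n) set \<Rightarrow> bool" where
  "line_holomorphic \<phi> U \<longleftrightarrow> continuous_on U \<phi> \<and>
     (\<forall>z u. (\<lambda>\<zeta>. \<phi> (z + \<zeta> *s u)) holomorphic_on {\<zeta>. z + \<zeta> *s u \<in> U})"

lemma line_holomorphic_transform:
  assumes "line_holomorphic \<phi> U" and eq: "\<And>z. z \<in> U \<Longrightarrow> \<phi> z = \<psi> z"
  shows "line_holomorphic \<psi> U"
  unfolding line_holomorphic_def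
proof (intro conjI allI)
  show "continuous_on U \<psi>"
    using assms by (simp add: line_holomorphic_def cong: continuous_on_cong)
  fix z u
  have "(\<lambda>\<zeta>. \<phi> (z + \<zeta> *s u)) holomorphic_on {\<zeta>. z + \<zeta> *s u \<in> U}"
    using assms by (simp add: line_holomorphic_def)
  then show "(\<lambda>\<zeta>. \<psi> (z + \<zeta> *s u)) holomorphic_on {\<zeta>. z + \<zeta> *s u \<in> U}"
    by (rule holomorphic_transform) (simp add: eq)
qed

lemma line_holomorphic_subset: "line_holomorphic \<phi> U \<Longrightarrow> V \<subseteq> U \<Longrightarrow> line_holomorphic \<phi> V"
  unfolding line_holomorphic_def
  by (meson continuous_on_subset holomorphic_on_subset Collect_mono subsetD)

lemma line_holomorphic_local:
  assumes "\<And>z. z \<in> U \<Longrightarrow> \<exists>N. open N \<and> z \<in> N \<and> line_holomorphic \<phi> N"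
  shows "line_holomorphic \<phi> U"
  unfolding line_holomorphic_def
proof (intro conjI allI)
  show "continuous_on U \<phi>"
    unfolding continuous_on_eq_continuous_within
    by (metis assms line_holomorphic_def continuous_on_eq_continuous_at continuous_at_imp_continuous_at_within)
  fix z u
  show "(\<lambda>\<zeta>. \<phi> (z + \<zeta> *s u)) holomorphic_on {\<zeta>. z + \<zeta> *s u \<in> U}"
    unfolding holomorphic_on_def
  proof
    fix \<zeta> assume "\<zeta> \<in> {\<zeta>. z + \<zeta> *s u \<in> U}"
    then obtain N where N: "open N" "z + \<zeta> *s u \<in> N" "line_holomorphic \<phi> N"
      using assms by blast
    then have "(\<lambda>\<zeta>. \<phi> (z + \<zeta> *s u)) holomorphic_on {\<zeta>. z + \<zeta> *s u \<in> N}"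
      by (simp add: line_holomorphic_def)
    then show "(\<lambda>\<zeta>. \<phi> (z + \<zeta> *s u)) field_differentiable at \<zeta> within {\<zeta>. z + \<zeta> *s u \<in> U}"
      using open_line_preimage[OF N(1), of z u] N(2)
      by (auto simp: holomorphic_on_open field_differentiable_def intro: has_field_derivative_at_within)
  qed
qed

lemma line_holomorphic_const: "line_holomorphic (\<lambda>_. c) U"
  by (simp add: line_holomorphic_def)

lemma line_holomorphic_component: "line_holomorphic (\<lambda>z. z $ i) U"
  by (auto simp: line_holomorphic_def intro!: continuous_intros holomorphic_intros)

lemma line_holomorphic_add:
  "line_holomorphic \<phi> U \<Longrightarrow> line_holomorphic \<psi> U \<Longrightarrow> line_holomorphic (\<lambda>z. \<phi> z + \<psi> z) U"
  by (auto simp: line_holomorphic_def intro!: continuous_intros holomorphic_intros)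

lemma line_holomorphic_diff:
  "line_holomorphic \<phi> U \<Longrightarrow> line_holomorphic \<psi> U \<Longrightarrow> line_holomorphic (\<lambda>z. \<phi> z - \<psi> z) U"
  by (auto simp: line_holomorphic_def intro!: continuous_intros holomorphic_intros)

lemma line_holomorphic_mult:
  "line_holomorphic \<phi> U \<Longrightarrow> line_holomorphic \<psi> U \<Longrightarrow> line_holomorphic (\<lambda>z. \<phi> z * \<psi> z) U"
  by (auto simp: line_holomorphic_def intro!: continuous_intros holomorphic_intros)

lemma line_holomorphic_divide:
  "line_holomorphic \<phi> U \<Longrightarrow> line_holomorphic \<psi> U \<Longrightarrow> (\<And>z. z \<in> U \<Longrightarrow> \<psi> z \<noteq> 0) \<Longrightarrow>
    line_holomorphic (\<lambda>z. \<phi> z / \<psi> z) U"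
  by (auto simp: line_holomorphic_def intro!: continuous_intros holomorphic_intros)

lemmas line_holomorphic_intros = line_holomorphic_const line_holomorphic_component
  line_holomorphic_add line_holomorphic_diff line_holomorphic_mult line_holomorphic_divide

text \<open>
  The map \<open>A\<close> is affine over the complex numbers, with linear part \<open>B\<close>, so it carries lines to lines.
\<close>

lemma line_holomorphic_compose_affine:
  fixes A :: "complex^'n \<Rightarrow> complex^'m"
  assumes \<phi>: "line_holomorphic \<phi> U" and A: "continuous_on V A" "A ` V \<subseteq> U"
    and aff: "\<And>z \<zeta> u. A (z + \<zeta> *s u) = A z + \<zeta> *s B u"
  shows "line_holomorphic (\<lambda>z. \<phi> (A z)) V"
  unfolding line_holomorphic_def
proof (intro conjI allI)
  have "continuous_on U \<phi>" using \<phi> by (simp add: line_holomorphic_def)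
  then show "continuous_on V (\<lambda>z. \<phi> (A z))"
    using A by (rule continuous_on_compose2)
  fix z u
  have "(\<lambda>\<zeta>. \<phi> (A z + \<zeta> *s B u)) holomorphic_on {\<zeta>. A z + \<zeta> *s B u \<in> U}"
    using \<phi> by (simp add: line_holomorphic_def)
  moreover have "{\<zeta>. z + \<zeta> *s u \<in> V} \<subseteq> {\<zeta>. A z + \<zeta> *s B u \<in> U}"
    using A(2) aff by (metis (mono_tags, lifting) Collect_mono image_subset_iff)
  ultimately show "(\<lambda>\<zeta>. \<phi> (A (z + \<zeta> *s u))) holomorphic_on {\<zeta>. z + \<zeta> *s u \<in> V}"
    unfolding aff by (rule holomorphic_on_subset)
qed

lemma line_holomorphic_shift:
  fixes \<phi> :: "complex^'n \<Rightarrow> complex"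
  assumes "line_holomorphic \<phi> U" "\<And>z. z \<in> V \<Longrightarrow> z + a \<in> U"
  shows "line_holomorphic (\<lambda>z. \<phi> (z + a)) V"
proof (rule line_holomorphic_compose_affine[where A = "\<lambda>z. z + a" and B = "\<lambda>u. u", OF assms(1)])
  show "continuous_on V (\<lambda>z. z + a)" by (intro continuous_intros)
  show "(\<lambda>z. z + a) ` V \<subseteq> U" using assms(2) by auto
qed (simp add: add_ac)

text \<open>
  Riemann sums are holomorphic along lines and converge locally uniformly in the parameter, by uniform
  continuity of \<open>\<Phi>\<close> on compact sets.
\<close>

lemma line_holomorphic_integral:
  fixes \<Phi> :: "complex^'n \<Rightarrow> real \<Rightarrow> complex"
  assumes U: "open U" and cont: "continuous_on (U \<times> {0..1}) (\<lambda>(z, t). \<Phi> z t)"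
    and hol: "\<And>t. t \<in> {0..1} \<Longrightarrow> line_holomorphic (\<lambda>z. \<Phi> z t) U"
  shows "line_holomorphic (\<lambda>z. integral {0..1} (\<Phi> z)) U"
  unfolding line_holomorphic_def
proof (intro conjI allI)
  show "continuous_on U (\<lambda>z. integral {0..1} (\<Phi> z))"
    using integral_continuous_on_param[of U 0 1 \<Phi>] cont by (simp add: cbox_interval)
  fix z u :: "complex^'n"
  define S where "S = {\<zeta>. z + \<zeta> *s u \<in> U}"
  define H where "H N \<zeta> = (\<Sum>j<Suc N. of_real (1 / real (Suc N)) * \<Phi> (z + \<zeta> *s u) (real j / real (Suc N)))" for N \<zeta>
  have "open S" unfolding S_def by (rule open_line_preimage[OF U])
  show "(\<lambda>\<zeta>. integral {0..1} (\<Phi> (z + \<zeta> *s u))) holomorphic_on {\<zeta>. z + \<zeta> *s u \<in> U}"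
    unfolding S_def [symmetric]
  proof (rule holomorphic_uniform_sequence[OF \<open>open S\<close>, of H])
    fix N
    show "H N holomorphic_on S"
      unfolding H_def
    proof (intro holomorphic_on_sum holomorphic_on_mult holomorphic_on_const)
      fix j assume "j \<in> {..<Suc N}"
      then have "real j / real (Suc N) \<in> {0..1}" by auto
      from hol[OF this] show "(\<lambda>\<zeta>. \<Phi> (z + \<zeta> *s u) (real j / real (Suc N))) holomorphic_on S"
        by (simp add: line_holomorphic_def S_def)
    qed
  next
    fix x assume "x \<in> S"
    then obtain d where d: "d > 0" "cball x d \<subseteq> S"
      using \<open>open S\<close> open_contains_cball by blast
    define K where "K = cball x d \<times> {0..1::real}"
    have "continuous_on K (\<lambda>y. (\<lambda>(z, t). \<Phi> z t) (z + fst y *s u, snd y))"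
      using d(2) by (intro continuous_on_compose2[OF cont] continuous_intros) (auto simp: K_def S_def)
    then have uc: "uniformly_continuous_on K (\<lambda>y. \<Phi> (z + fst y *s u) (snd y))"
      unfolding K_def by (intro compact_uniformly_continuous compact_Times) auto
    have "uniform_limit (cball x d) H (\<lambda>\<zeta>. integral {0..1} (\<Phi> (z + \<zeta> *s u))) sequentially"
      unfolding uniform_limit_sequentially_iff
    proof (intro allI impI)
      fix e :: real assume "e > 0"
      then obtain d' where d': "d' > 0" "\<And>a b. a \<in> K \<Longrightarrow> b \<in> K \<Longrightarrow> dist b a < d' \<Longrightarrow>
          dist (\<Phi> (z + fst b *s u) (snd b)) (\<Phi> (z + fst a *s u) (snd a)) < e / 2"
        using uc unfolding uniformly_continuous_on_def by (metis half_gt_zero)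
      obtain M where M: "1 / real (Suc M) < d'"
        using d'(1) nat_approx_posE by blast
      show "\<exists>N. \<forall>n\<ge>N. \<forall>\<zeta>\<in>cball x d. dist (H n \<zeta>) (integral {0..1} (\<Phi> (z + \<zeta> *s u))) < e"
      proof (intro exI[of _ M] allI impI ballI)
        fix N \<zeta> assume N: "M \<le> N" and \<zeta>: "\<zeta> \<in> cball x d"
        have "1 / real (Suc N) \<le> 1 / real (Suc M)" using N by (simp add: frac_le)
        then have small: "1 / real (Suc N) < d'" using M by simp
        have "z + \<zeta> *s u \<in> U" using \<zeta> d(2) by (auto simp: S_def)
        then have "continuous_on {0..1} (\<lambda>t. (\<lambda>(z, t). \<Phi> z t) (z + \<zeta> *s u, t))"
          by (intro continuous_on_compose2[OF cont] continuous_intros) auto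
        then have "cmod (H N \<zeta> - integral {0..1} (\<Phi> (z + \<zeta> *s u))) \<le> e / 2"
          unfolding H_def
        proof (intro riemann_sum_error)
          fix s t :: real assume st: "s \<in> {0..1}" "t \<in> {0..1}" "\<bar>s - t\<bar> \<le> 1 / real (Suc N)"
          then show "cmod (\<Phi> (z + \<zeta> *s u) s - \<Phi> (z + \<zeta> *s u) t) \<le> e / 2"
            using d'(2)[of "(\<zeta>, t)" "(\<zeta>, s)"] \<zeta> small
            by (auto simp: K_def dist_Pair_Pair dist_norm)
        qed auto
        then show "dist (H N \<zeta>) (integral {0..1} (\<Phi> (z + \<zeta> *s u))) < e"
          using \<open>e > 0\<close> by (simp add: dist_norm)
      qed
    qed
    then show "\<exists>d>0. cball x d \<subseteq> S \<and>
        uniform_limit (cball x d) H (\<lambda>\<zeta>. integral {0..1} (\<Phi> (z + \<zeta> *s u))) sequentially"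
      using d by blast
  qed
qed

text \<open>
  The parameter runs through \<open>[0, 1]\<close>, as for \<open>circlepath\<close>.
\<close>

definition ucirc :: "real \<Rightarrow> complex" where
  "ucirc t = exp (2 * complex_of_real pi * \<i> * of_real t)"

lemma norm_ucirc [simp]: "cmod (ucirc t) = 1"
  by (simp add: ucirc_def norm_exp_eq_Re)

lemma ucirc_nonzero [simp]: "ucirc t \<noteq> 0"
  by (simp add: ucirc_def)

lemma continuous_on_ucirc [continuous_intros]: "continuous_on S ucirc"
  unfolding ucirc_def by (intro continuous_intros)

lemma continuous_on_ucirc_comp [continuous_intros]:
  "continuous_on S h \<Longrightarrow> continuous_on S (\<lambda>x. ucirc (h x))"
  unfolding ucirc_def by (intro continuous_intros)

lemma has_contour_integral_circlepath_ucirc: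
  assumes "(f has_contour_integral (2 * pi * \<i> * I)) (circlepath c r)"
  shows "((\<lambda>t. f (c + r * ucirc t) * (r * ucirc t)) has_integral I) {0..1}"
proof -
  have "((\<lambda>t. f (c + r * ucirc t) * (2 * pi * \<i> * (r * ucirc t))) has_integral (2 * pi * \<i> * I)) {0..1}"
    using assms unfolding has_contour_integral_def
  proof (rule has_integral_eq[rotated])
    fix t :: real assume t: "t \<in> {0..1}"
    show "f (circlepath c r t) * vector_derivative (circlepath c r) (at t within {0..1}) =
        f (c + r * ucirc t) * (2 * pi * \<i> * (r * ucirc t))"
      using vector_derivative_circlepath01[of t c r] t
      by (simp add: circlepath[of c r, THEN fun_cong] ucirc_def)
  qed
  from has_integral_mult_right[OF this, of "1 / (2 * pi * \<i>)"] show ?thesis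
    by (simp add: field_simps)
qed

lemma mean_value_circle:
  assumes "continuous_on (cball c r) f" "f holomorphic_on ball c r" "r > 0"
  shows "((\<lambda>t. f (c + r * ucirc t)) has_integral f c) {0..1}"
proof -
  have "((\<lambda>u. f u / (u - c)) has_contour_integral (2 * pi * \<i> * f c)) (circlepath c r)"
    using Cauchy_integral_circlepath[OF assms(1,2), of c] assms(3) by simp
  from has_contour_integral_circlepath_ucirc[OF this] show ?thesis
    using assms(3) by simp
qed

lemma deriv_circle_integral:
  assumes "continuous_on (cball c r) f" "f holomorphic_on ball c r" "r > 0"
  shows "((\<lambda>t. f (c + r * ucirc t) / (r * ucirc t)) has_integral deriv f c) {0..1}"
proof -
  have "((\<lambda>u. f u / (u - c)\<^sup>2) has_contour_integral (2 * pi * \<i> * deriv f c)) (circlepath c r)"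
  proof -
    have c: "c \<in> ball c r" using assms(3) by simp
    note D = Cauchy_derivative_integral_circlepath[OF assms(1,2) c]
    have "deriv f c = 1 / (2 * of_real pi * \<i>) * contour_integral (circlepath c r) (\<lambda>u. f u / (u - c)\<^sup>2)"
      by (rule DERIV_imp_deriv[OF D(2)])
    then show ?thesis
      using has_contour_integral_integral[OF D(1)] by simp
  qed
  from has_contour_integral_circlepath_ucirc[OF this] show ?thesis
    using assms(3) by (simp add: power2_eq_square)
qed

section \<open>Derivatives along lines and complex differentiability\<close>

definition line_deriv :: "(complex^'n \<Rightarrow> complex) \<Rightarrow> complex^'n \<Rightarrow> complex^'n \<Rightarrow> complex" where
  "line_deriv \<phi> u z = deriv (\<lambda>\<zeta>. \<phi> (z + \<zeta> *s u)) 0"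

lemma line_holomorphic_has_field_derivative:
  assumes "open U" "line_holomorphic \<phi> U" "z + \<zeta> *s u \<in> U"
  shows "((\<lambda>\<zeta>. \<phi> (z + \<zeta> *s u)) has_field_derivative line_deriv \<phi> u (z + \<zeta> *s u)) (at \<zeta>)"
proof -
  have "(\<lambda>\<eta>. \<phi> ((z + \<zeta> *s u) + \<eta> *s u)) holomorphic_on {\<eta>. (z + \<zeta> *s u) + \<eta> *s u \<in> U}"
    using assms(2) by (simp add: line_holomorphic_def)
  then have "((\<lambda>\<eta>. \<phi> ((z + \<zeta> *s u) + \<eta> *s u)) has_field_derivative line_deriv \<phi> u (z + \<zeta> *s u)) (at 0)"
    unfolding line_deriv_def
    by (rule holomorphic_derivI[OF _ open_line_preimage[OF assms(1)]]) (simp add: assms(3))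
  then have "((\<lambda>\<eta>. \<phi> (z + (\<eta> + \<zeta>) *s u)) has_field_derivative line_deriv \<phi> u (z + \<zeta> *s u)) (at 0)"
    by (simp add: vector_sadd_rdistrib add_ac)
  then show ?thesis
    using DERIV_shift[of "\<lambda>\<zeta>. \<phi> (z + \<zeta> *s u)" "line_deriv \<phi> u (z + \<zeta> *s u)" 0 \<zeta>] by simp
qed

lemma line_deriv_scale:
  assumes "open U" "line_holomorphic \<phi> U" "z \<in> U"
  shows "line_deriv \<phi> (c *s u) z = c * line_deriv \<phi> u z"
proof -
  have "((\<lambda>\<zeta>. \<phi> (z + \<zeta> *s u)) has_field_derivative line_deriv \<phi> u z) (at (c * 0))"
    using line_holomorphic_has_field_derivative[OF assms(1,2), of z 0 u] assms(3) by simp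
  moreover have "((\<lambda>\<zeta>. c * \<zeta>) has_field_derivative c) (at 0)"
    by (auto intro!: derivative_eq_intros)
  ultimately have "((\<lambda>\<zeta>. \<phi> (z + (c * \<zeta>) *s u)) has_field_derivative line_deriv \<phi> u z * c) (at 0)"
    by (rule DERIV_chain2)
  then show ?thesis
    unfolding line_deriv_def[of _ "c *s u"]
    by (intro DERIV_imp_deriv) (simp add: vector_smult_assoc mult.commute)
qed

text \<open>
  Cauchy's inequality on discs of radius \<open>1/2\<close> bounds the second derivative by \<open>8 M\<close>; Taylor's theorem does
  the rest.
\<close>

lemma holomorphic_remainder_bound:
  assumes cont: "continuous_on (cball 0 1) \<psi>" and hol: "\<psi> holomorphic_on ball 0 1"
    and M: "\<And>x. x \<in> cball 0 1 \<Longrightarrow> cmod (\<psi> x) \<le> M" and s: "cmod s \<le> 1/2"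
  shows "cmod (\<psi> s - \<psi> 0 - s * deriv \<psi> 0) \<le> 8 * M * (cmod s)\<^sup>2"
proof -
  have sub: "cball x (1/2) \<subseteq> cball 0 1" "ball x (1/2) \<subseteq> ball 0 1" "x \<in> ball 0 1"
    if "x \<in> cball 0 (1/2)" for x :: complex
    using that by (auto simp: cball_subset_cball_iff ball_subset_ball_iff dist_norm)
  have "cmod (((deriv ^^ 0) \<psi>) s - (\<Sum>i\<le>1. (deriv ^^ i) \<psi> 0 * (s - 0) ^ i / fact i))
      \<le> 8 * M * cmod (s - 0) ^ Suc 1 / fact 1"
  proof (rule complex_Taylor[where S = "cball 0 (1/2)"])
    fix i x assume "x \<in> cball (0::complex) (1/2)"
    from sub(3)[OF this] have "((deriv ^^ i) \<psi> has_field_derivative deriv ((deriv ^^ i) \<psi>) x) (at x)"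
      by (intro holomorphic_derivI[OF holomorphic_higher_deriv[OF hol]]) auto
    then show "((deriv ^^ i) \<psi> has_field_derivative (deriv ^^ Suc i) \<psi> x) (at x within cball 0 (1/2))"
      by (simp add: has_field_derivative_at_within)
  next
    fix x assume x: "x \<in> cball (0::complex) (1/2)"
    have "cmod ((deriv ^^ 2) \<psi> x) \<le> fact 2 * M / (1/2)^2"
    proof (rule Cauchy_inequality)
      show "\<psi> holomorphic_on ball x (1/2)" using holomorphic_on_subset[OF hol sub(2)[OF x]] .
      show "continuous_on (cball x (1/2)) \<psi>" using continuous_on_subset[OF cont sub(1)[OF x]] .
      fix y assume "cmod (x - y) = 1/2"
      then have "y \<in> cball x (1/2)" by (simp add: dist_norm)
      then show "cmod (\<psi> y) \<le> M" using sub(1)[OF x] by (intro M) blast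
    qed simp
    then show "cmod ((deriv ^^ Suc 1) \<psi> x) \<le> 8 * M" by (simp add: numeral_2_eq_2 power2_eq_square)
  qed (use s in auto)
  then show ?thesis by (simp add: algebra_simps power2_eq_square)
qed

text \<open>
  The right-hand side depends on \<open>\<phi>\<close> through the bound \<open>M\<close> only. For compositions of a vector-valued map with
  the members of a norming family the estimate is therefore uniform.
\<close>

lemma line_holomorphic_remainder_bound:
  fixes \<phi> :: "complex^'n \<Rightarrow> complex"
  assumes U: "open U" and \<phi>: "line_holomorphic \<phi> U" and R: "R > 0" "cball z R \<subseteq> U"
    and M: "\<And>w. w \<in> cball z R \<Longrightarrow> cmod (\<phi> w) \<le> M" and h: "norm h \<le> R / 2"
  shows "cmod (\<phi> (z + h) - \<phi> z - line_deriv \<phi> h z) \<le> 8 * M * (norm h)\<^sup>2 / R\<^sup>2"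
proof (cases "h = 0")
  case True
  then show ?thesis by (simp add: line_deriv_def)
next
  case False
  define u where "u = of_real (R / norm h) *s h"
  have u: "norm u = R" using False R(1) by (simp add: u_def norm_vector_scalar_mult norm_divide)
  define s where "s = complex_of_real (norm h / R)"
  have su: "s *s u = h" using False R(1) by (simp add: s_def u_def vector_smult_assoc)
  have s: "cmod s = norm h / R" using R(1) by (simp add: s_def norm_divide)
  have in_cball: "z + x *s u \<in> cball z R" if "cmod x \<le> 1" for x
    using that R(1) mult_right_mono[OF that, of R] by (simp add: dist_norm norm_vector_scalar_mult u)
  have zU: "z \<in> U" using R by auto
  have hol: "(\<lambda>x. \<phi> (z + x *s u)) holomorphic_on {x. z + x *s u \<in> U}"
    using \<phi> by (simp add: line_holomorphic_def)
  have sub: "cball 0 1 \<subseteq> {x. z + x *s u \<in> U}" using in_cball R(2) by (auto simp: dist_norm)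
  have "cmod (\<phi> (z + s *s u) - \<phi> (z + 0 *s u) - s * deriv (\<lambda>x. \<phi> (z + x *s u)) 0)
      \<le> 8 * M * (cmod s)\<^sup>2"
  proof (rule holomorphic_remainder_bound)
    show "continuous_on (cball 0 1) (\<lambda>x. \<phi> (z + x *s u))"
      using holomorphic_on_imp_continuous_on[OF holomorphic_on_subset[OF hol sub]] .
    show "(\<lambda>x. \<phi> (z + x *s u)) holomorphic_on ball 0 1"
      using holomorphic_on_subset[OF hol sub] by (rule holomorphic_on_subset) auto
    show "cmod s \<le> 1 / 2" using h R(1) by (simp add: s field_simps)
    show "cmod (\<phi> (z + x *s u)) \<le> M" if "x \<in> cball 0 1" for x
      using that by (intro M in_cball) simp
  qed
  also have "s * deriv (\<lambda>x. \<phi> (z + x *s u)) 0 = line_deriv \<phi> h z"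
    using line_deriv_scale[OF U \<phi> zU, of s u] by (simp add: su line_deriv_def)
  finally show ?thesis by (simp add: su s power_divide)
qed

lemma continuous_bounded_cball:
  fixes \<phi> :: "'a::heine_borel \<Rightarrow> 'b::real_normed_vector"
  assumes "continuous_on U \<phi>" "cball z R \<subseteq> U"
  obtains M where "M > 0" "\<And>w. w \<in> cball z R \<Longrightarrow> norm (\<phi> w) \<le> M"
proof -
  have "compact (\<phi> ` cball z R)"
    using assms by (intro compact_continuous_image compact_cball) (rule continuous_on_subset)
  then obtain M where "M > 0" "\<forall>x\<in>\<phi> ` cball z R. norm x \<le> M"
    using compact_imp_bounded bounded_pos by blast
  then show ?thesis using that by auto
qed

text \<open>
  Locally the derivative is a Cauchy integral over a circle of fixed radius in the direction \<open>u\<close>.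
\<close>

lemma line_holomorphic_line_deriv:
  fixes \<phi> :: "complex^'n \<Rightarrow> complex"
  assumes U: "open U" and \<phi>: "line_holomorphic \<phi> U"
  shows "line_holomorphic (line_deriv \<phi> u) U"
proof (rule line_holomorphic_local)
  fix z assume "z \<in> U"
  then obtain R where R: "R > 0" "cball z (2 * R) \<subseteq> U"
    using U open_contains_cball[of U] by (metis field_sum_of_halves mult_2 half_gt_zero)
  \<comment> \<open>circles of radius \<open>\<rho>\<close> in the direction \<open>u\<close> move points by at most \<open>R\<close>, also for \<open>u = 0\<close>\<close>
  define \<rho> where "\<rho> = R / (norm u + 1)"
  have \<rho>: "\<rho> > 0" "\<rho> * norm u \<le> R"
    using R(1) by (auto simp: \<rho>_def field_simps add_pos_nonneg)
  have inU: "w + x *s u \<in> U" if "w \<in> ball z R" "cmod x \<le> \<rho>" for w x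
  proof -
    have "norm (x *s u) \<le> \<rho> * norm u"
      using that(2) by (simp add: norm_vector_scalar_mult mult_right_mono)
    then have "dist z (w + x *s u) \<le> R + R"
      using that(1) \<rho>(2) norm_triangle_ineq4[of "z - w" "x *s u"] by (simp add: dist_norm algebra_simps)
    then show ?thesis using R(2) by (auto simp: subset_iff)
  qed
  have "line_holomorphic (\<lambda>w. integral {0..1} (\<lambda>t. \<phi> (w + (\<rho> * ucirc t) *s u) / (\<rho> * ucirc t))) (ball z R)"
  proof (rule line_holomorphic_integral)
    have "continuous_on U \<phi>" using \<phi> by (simp add: line_holomorphic_def)
    then have "continuous_on (ball z R \<times> {0..1}) (\<lambda>y. \<phi> (fst y + (\<rho> * ucirc (snd y)) *s u))"
    proof (rule continuous_on_compose2)
      show "continuous_on (ball z R \<times> {0..1}) (\<lambda>y. fst y + (\<rho> * ucirc (snd y)) *s u)"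
        by (intro continuous_intros)
      show "(\<lambda>y. fst y + (\<rho> * ucirc (snd y)) *s u) ` (ball z R \<times> {0..1}) \<subseteq> U"
        using inU \<rho>(1) by (auto simp: norm_mult)
    qed
    then have "continuous_on (ball z R \<times> {0..1}) (\<lambda>y. \<phi> (fst y + (\<rho> * ucirc (snd y)) *s u) / (\<rho> * ucirc (snd y)))"
      using \<rho>(1) by (intro continuous_on_divide continuous_on_mult continuous_on_ucirc_comp
          continuous_on_snd continuous_on_id continuous_on_const) auto
    then show "continuous_on (ball z R \<times> {0..1}) (\<lambda>(w, t). \<phi> (w + (\<rho> * ucirc t) *s u) / (\<rho> * ucirc t))"
      by (simp add: case_prod_unfold)
    fix t :: real
    show "line_holomorphic (\<lambda>w. \<phi> (w + (\<rho> * ucirc t) *s u) / (\<rho> * ucirc t)) (ball z R)"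
      using \<rho>(1) inU by (intro line_holomorphic_divide line_holomorphic_const line_holomorphic_shift[OF \<phi>])
        (auto simp: norm_mult)
  qed simp
  moreover have "integral {0..1} (\<lambda>t. \<phi> (w + (\<rho> * ucirc t) *s u) / (\<rho> * ucirc t)) = line_deriv \<phi> u w"
    if w: "w \<in> ball z R" for w
  proof -
    have "(\<lambda>x. \<phi> (w + x *s u)) holomorphic_on cball 0 \<rho>"
    proof (rule holomorphic_on_subset)
      show "(\<lambda>x. \<phi> (w + x *s u)) holomorphic_on {x. w + x *s u \<in> U}"
        using \<phi> by (simp add: line_holomorphic_def)
    qed (use inU[OF w] in auto)
    then have "((\<lambda>t. \<phi> (w + (0 + \<rho> * ucirc t) *s u) / (\<rho> * ucirc t)) has_integral deriv (\<lambda>x. \<phi> (w + x *s u)) 0) {0..1}"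
      using \<rho>(1) holomorphic_on_subset[OF _ ball_subset_cball]
      by (intro deriv_circle_integral holomorphic_on_imp_continuous_on) blast+
    then show ?thesis by (simp add: line_deriv_def integral_unique)
  qed
  ultimately have "line_holomorphic (line_deriv \<phi> u) (ball z R)"
    by (rule line_holomorphic_transform)
  then show "\<exists>N. open N \<and> z \<in> N \<and> line_holomorphic (line_deriv \<phi> u) N"
    using R(1) by (intro exI[of _ "ball z R"]) auto
qed

text \<open>
  The step from \<open>z\<close> to \<open>z + t (h + k)\<close> is compared with the two steps along \<open>t h\<close> and \<open>t k\<close>. The second one
  starts at \<open>z + t h\<close>, and continuity of the derivative in its base point moves it back to \<open>z\<close>.
\<close>

lemma line_deriv_add:
  fixes \<phi> :: "complex^'n \<Rightarrow> complex"
  assumes U: "open U" and \<phi>: "line_holomorphic \<phi> U" and z: "z \<in> U"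
  shows "line_deriv \<phi> (h + k) z = line_deriv \<phi> h z + line_deriv \<phi> k z"
proof -
  obtain R where R: "R > 0" "cball z (2 * R) \<subseteq> U"
    using z U open_contains_cball[of U] by (metis field_sum_of_halves mult_2 half_gt_zero)
  have cont: "continuous_on U \<phi>" using \<phi> by (simp add: line_holomorphic_def)
  obtain M where M: "M > 0" "\<And>w. w \<in> cball z (2 * R) \<Longrightarrow> cmod (\<phi> w) \<le> M"
    using continuous_bounded_cball[OF cont R(2)] by blast
  define D where "D x = line_deriv \<phi> x" for x
  have rem: "cmod (\<phi> (w + x) - \<phi> w - D x w) \<le> 8 * M * (norm x)\<^sup>2 / R\<^sup>2"
    if "w \<in> cball z R" "norm x \<le> R / 2" for w x
  proof -
    have "cball w R \<subseteq> cball z (2 * R)"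
      using that(1) by (auto simp: cball_subset_cball_iff dist_commute)
    then show ?thesis
      unfolding D_def using R M that(2)
      by (intro line_holomorphic_remainder_bound[OF U \<phi>]) auto
  qed
  have scale: "D (of_real t *s x) w = of_real t * D x w" if "w \<in> U" for t x w
    unfolding D_def by (rule line_deriv_scale[OF U \<phi> that])
  define C where "C = 8 * M * ((norm (h + k))\<^sup>2 + (norm h)\<^sup>2 + (norm k)\<^sup>2) / R\<^sup>2"
  define d where "d = R / (2 * (norm (h + k) + norm h + norm k + 1))"
  have "d > 0" using R(1) by (simp add: d_def add_nonneg_pos)
  have bound: "cmod (D (h + k) z - D h z - D k (z + of_real t *s h)) \<le> C * t" if t: "0 < t" "t < d" for t
  proof -
    let ?t = "complex_of_real t"
    have "2 * (norm (h + k) + norm h + norm k + 1) > 0"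
      by (simp add: add_nonneg_pos)
    then have "t * (2 * (norm (h + k) + norm h + norm k + 1)) \<le> R"
      using t(2) unfolding d_def by (simp only: pos_less_divide_eq less_imp_le)
    then have "2 * (t * norm (h + k)) + 2 * (t * norm h) + 2 * (t * norm k) + 2 * t \<le> R"
      by (simp add: algebra_simps)
    moreover have "0 \<le> t * norm (h + k)" "0 \<le> t * norm h" "0 \<le> t * norm k"
      using t(1) by simp_all
    ultimately have small: "t * norm (h + k) \<le> R / 2" "t * norm h \<le> R / 2" "t * norm k \<le> R / 2"
      using t(1) by linarith+
    have n: "norm (?t *s x) = t * norm x" for x :: "complex^'n"
      using t(1) by (simp add: norm_vector_scalar_mult)
    have zR: "z \<in> cball z R" "z + ?t *s h \<in> cball z R"
      using R(1) small(2) by (auto simp: dist_norm n)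
    then have zU: "z \<in> U" "z + ?t *s h \<in> U" using R by auto
    have 1: "cmod (\<phi> (z + ?t *s (h + k)) - \<phi> z - ?t * D (h + k) z) \<le> 8 * M * (t * norm (h + k))\<^sup>2 / R\<^sup>2"
      using rem[OF zR(1), of "?t *s (h + k)"] small(1) unfolding n scale[OF zU(1)] .
    have 2: "cmod (\<phi> (z + ?t *s h) - \<phi> z - ?t * D h z) \<le> 8 * M * (t * norm h)\<^sup>2 / R\<^sup>2"
      using rem[OF zR(1), of "?t *s h"] small(2) unfolding n scale[OF zU(1)] .
    have 3: "cmod (\<phi> (z + ?t *s h + ?t *s k) - \<phi> (z + ?t *s h) - ?t * D k (z + ?t *s h)) \<le> 8 * M * (t * norm k)\<^sup>2 / R\<^sup>2"
      using rem[OF zR(2), of "?t *s k"] small(3) unfolding n scale[OF zU(2)] .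
    have eq: "z + ?t *s (h + k) = z + ?t *s h + ?t *s k" by (simp add: vector_add_ldistrib add_ac)
    have "?t * (D (h + k) z - D h z - D k (z + ?t *s h)) =
        (\<phi> (z + ?t *s h + ?t *s k) - \<phi> (z + ?t *s h) - ?t * D k (z + ?t *s h))
        + (\<phi> (z + ?t *s h) - \<phi> z - ?t * D h z)
        - (\<phi> (z + ?t *s (h + k)) - \<phi> z - ?t * D (h + k) z)"
      unfolding eq by (simp add: algebra_simps)
    also have "cmod \<dots> \<le> (8 * M * (t * norm k)\<^sup>2 / R\<^sup>2 + 8 * M * (t * norm h)\<^sup>2 / R\<^sup>2)
        + 8 * M * (t * norm (h + k))\<^sup>2 / R\<^sup>2"
      by (rule order_trans[OF norm_triangle_ineq4 add_mono[OF order_trans[OF norm_triangle_ineq add_mono[OF 3 2]] 1]])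
    also have "\<dots> = t * (C * t)"
      by (simp add: C_def power_mult_distrib power2_eq_square add_divide_distrib algebra_simps)
    finally have "t * cmod (D (h + k) z - D h z - D k (z + ?t *s h)) \<le> t * (C * t)"
      using t(1) by (simp add: norm_mult)
    then show ?thesis using t(1) by simp
  qed
  have "((\<lambda>t. D (h + k) z - D h z - D k (z + of_real t *s h)) \<longlongrightarrow> 0) (at_right 0)"
  proof (rule Lim_null_comparison)
    show "\<forall>\<^sub>F t in at_right 0. cmod (D (h + k) z - D h z - D k (z + of_real t *s h)) \<le> C * t"
      by (rule eventually_at_rightI[of 0 d]) (use bound \<open>d > 0\<close> in auto)
    have "((\<lambda>t. C * t) \<longlongrightarrow> C * 0) (at_right 0)" by (intro tendsto_intros)
    then show "((\<lambda>t. C * t) \<longlongrightarrow> 0) (at_right 0)" by simp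
  qed
  moreover have "((\<lambda>t. D (h + k) z - D h z - D k (z + of_real t *s h)) \<longlongrightarrow> D (h + k) z - D h z - D k z) (at_right 0)"
  proof -
    have "((\<lambda>t. z + complex_of_real t *s h) \<longlongrightarrow> z + of_real 0 *s h) (at_right 0)"
      by (intro tendsto_intros)
    moreover have "isCont (D k) z"
      using line_holomorphic_line_deriv[OF U \<phi>, of k] z U
      by (auto simp: line_holomorphic_def D_def continuous_on_eq_continuous_at)
    ultimately have "((\<lambda>t. D k (z + complex_of_real t *s h)) \<longlongrightarrow> D k z) (at_right 0)"
      using isCont_tendsto_compose by fastforce
    then show ?thesis by (intro tendsto_intros)
  qed
  ultimately have "0 = D (h + k) z - D h z - D k z"
    using tendsto_unique trivial_limit_at_right_real by blast
  then show ?thesis by (simp add: D_def algebra_simps)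
qed

lemma linear_line_deriv:
  fixes \<phi> :: "complex^'n \<Rightarrow> complex"
  assumes "open U" "line_holomorphic \<phi> U" "z \<in> U"
  shows "Vector_Spaces.linear (*s) (*) (\<lambda>h. line_deriv \<phi> h z)"
  by unfold_locales
    (auto simp: line_deriv_add[OF assms] line_deriv_scale[OF assms] vec_eq_iff algebra_simps)

lemma line_holomorphic_tendsto:
  fixes \<phi> :: "complex^'n \<Rightarrow> complex"
  assumes U: "open U" and \<phi>: "line_holomorphic \<phi> U" and z: "z \<in> U"
  shows "((\<lambda>h. (1 / norm h) *\<^sub>R (\<phi> (z + h) - \<phi> z - line_deriv \<phi> h z)) \<longlongrightarrow> 0) (at 0)"
proof -
  obtain R where R: "R > 0" "cball z R \<subseteq> U"
    using z U open_contains_cball by blast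
  have cont: "continuous_on U \<phi>" using \<phi> by (simp add: line_holomorphic_def)
  obtain M where M: "M > 0" "\<And>w. w \<in> cball z R \<Longrightarrow> cmod (\<phi> w) \<le> M"
    using continuous_bounded_cball[OF cont R(2)] by blast
  have "((\<lambda>h::complex^'n. 8 * M * norm h / R\<^sup>2) \<longlongrightarrow> 8 * M * norm (0::complex^'n) / R\<^sup>2) (at 0)"
    using R(1) by (intro tendsto_intros) auto
  then have "((\<lambda>h::complex^'n. 8 * M * norm h / R\<^sup>2) \<longlongrightarrow> 0) (at 0)" by simp
  then show ?thesis
  proof (rule Lim_null_comparison[rotated])
    show "\<forall>\<^sub>F h in at 0. norm ((1 / norm h) *\<^sub>R (\<phi> (z + h) - \<phi> z - line_deriv \<phi> h z)) \<le> 8 * M * norm h / R\<^sup>2"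
      unfolding eventually_at
    proof (intro exI[of _ "R/2"] conjI ballI impI)
      fix h :: "complex^'n" assume h: "h \<noteq> 0 \<and> dist h 0 < R / 2"
      then have "cmod (\<phi> (z + h) - \<phi> z - line_deriv \<phi> h z) \<le> 8 * M * (norm h)\<^sup>2 / R\<^sup>2"
        using R M by (intro line_holomorphic_remainder_bound[OF U \<phi>]) auto
      then have "(1 / norm h) * cmod (\<phi> (z + h) - \<phi> z - line_deriv \<phi> h z)
          \<le> (1 / norm h) * (8 * M * (norm h)\<^sup>2 / R\<^sup>2)"
        by (intro mult_left_mono) auto
      also have "\<dots> = 8 * M * norm h / R\<^sup>2" using h by (simp add: power2_eq_square)
      finally show "norm ((1 / norm h) *\<^sub>R (\<phi> (z + h) - \<phi> z - line_deriv \<phi> h z)) \<le> 8 * M * norm h / R\<^sup>2"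
        by (simp only: norm_scaleR abs_of_nonneg norm_ge_zero zero_le_divide_1_iff)
    qed (use R in simp)
  qed
qed

lemma line_holomorphic_components_imp_holomorphic_wrt:
  fixes \<phi> :: "complex^'m \<Rightarrow> complex^'n"
  assumes U: "open U" and \<phi>: "\<And>i. line_holomorphic (\<lambda>z. \<phi> z $ i) U"
  shows "holomorphic_wrt (*s) \<phi> U"
  unfolding holomorphic_wrt_def
proof
  fix z assume z: "z \<in> U"
  define L where "L h = (\<chi> i. line_deriv (\<lambda>z. \<phi> z $ i) h z)" for h
  have "Vector_Spaces.linear (*s) (*s) L"
    by unfold_locales
      (auto simp: L_def line_deriv_add[OF U \<phi> z] line_deriv_scale[OF U \<phi> z] vec_eq_iff algebra_simps)
  moreover have "((\<lambda>h. (1 / norm h) *\<^sub>R (\<phi> (z + h) - \<phi> z - L h)) \<longlongrightarrow> 0) (at 0)"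
    by (rule vec_tendstoI) (use line_holomorphic_tendsto[OF U \<phi> z] in \<open>simp add: L_def\<close>)
  ultimately show "\<exists>L. Vector_Spaces.linear (*s) (*s) L \<and>
      ((\<lambda>h. (1 / norm h) *\<^sub>R (\<phi> (z + h) - \<phi> z - L h)) \<longlongrightarrow> 0) (at 0)"
    by blast
qed

lemma holomorphic_wrt_imp_line_holomorphic:
  fixes \<phi> :: "complex^'n \<Rightarrow> complex"
  assumes U: "open U" and \<phi>: "holomorphic_wrt (*) \<phi> U"
  shows "line_holomorphic \<phi> U"
proof -
  have D: "\<exists>L. Vector_Spaces.linear (*s) (*) L \<and> (\<phi> has_derivative L) (at z)" if "z \<in> U" for z
    using \<phi> that by (subst (asm) holomorphic_wrt_iff_has_derivative) (auto simp: scaleR_conv_of_real)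
  show ?thesis
    unfolding line_holomorphic_def
  proof (intro conjI allI)
    show "continuous_on U \<phi>"
      using D has_derivative_continuous by (fastforce intro: continuous_at_imp_continuous_on)
    fix z u
    show "(\<lambda>\<zeta>. \<phi> (z + \<zeta> *s u)) holomorphic_on {\<zeta>. z + \<zeta> *s u \<in> U}"
    proof (rule holomorphic_onI)
      fix \<zeta> assume "\<zeta> \<in> {\<zeta>. z + \<zeta> *s u \<in> U}"
      then obtain L where L: "Vector_Spaces.linear (*s) (*) L" "(\<phi> has_derivative L) (at (z + \<zeta> *s u))"
        using D by blast
      have "bounded_linear (\<lambda>\<zeta>. \<zeta> *s u)"
        by (intro bounded_linearI'[where 'a = complex])
          (auto simp: vec_eq_iff algebra_simps)
      then have "((\<lambda>\<zeta>. z + \<zeta> *s u) has_derivative (\<lambda>\<zeta>. \<zeta> *s u)) (at \<zeta>)"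
        by (auto intro!: derivative_eq_intros bounded_linear_imp_has_derivative)
      from has_derivative_compose[OF this L(2)]
      have "((\<lambda>\<zeta>. \<phi> (z + \<zeta> *s u)) has_derivative (\<lambda>\<zeta>. L (\<zeta> *s u))) (at \<zeta>)" .
      moreover interpret L: Vector_Spaces.linear "(*s)" "(*)" L by (fact L(1))
      have "L (\<zeta> *s u) = L u * \<zeta>" for \<zeta>
        using L.scale by (simp add: mult.commute)
      ultimately have "((\<lambda>\<zeta>. \<phi> (z + \<zeta> *s u)) has_field_derivative L u) (at \<zeta>)"
        by (simp add: has_field_derivative_def)
      then show "(\<lambda>\<zeta>. \<phi> (z + \<zeta> *s u)) field_differentiable at \<zeta> within {\<zeta>. z + \<zeta> *s u \<in> U}"
        using field_differentiable_at_within field_differentiable_def by blast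
    qed
  qed
qed

lemma holomorphic_wrt_transform:
  fixes g h :: "complex^'n \<Rightarrow> 'v::{real_vector, topological_space}"
  assumes "open U" and g: "holomorphic_wrt scaleC g U" and eq: "\<And>z. z \<in> U \<Longrightarrow> g z = h z"
  shows "holomorphic_wrt scaleC h U"
  unfolding holomorphic_wrt_def
proof
  fix z assume z: "z \<in> U"
  then obtain L where L: "Vector_Spaces.linear (*s) scaleC L"
    "((\<lambda>x. (1 / norm x) *\<^sub>R (g (z + x) - g z - L x)) \<longlongrightarrow> 0) (at 0)"
    using g unfolding holomorphic_wrt_def by blast
  obtain d where d: "d > 0" "ball z d \<subseteq> U" using \<open>open U\<close> z open_contains_ball by blast
  have "\<forall>\<^sub>F x in at 0. (1 / norm x) *\<^sub>R (g (z + x) - g z - L x) = (1 / norm x) *\<^sub>R (h (z + x) - h z - L x)"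
    unfolding eventually_at
  proof (intro exI[of _ d] conjI ballI impI)
    fix x :: "complex^'n" assume "x \<noteq> 0 \<and> dist x 0 < d"
    then have "z + x \<in> U" using d(2) by (auto simp: dist_norm subset_iff)
    then show "(1 / norm x) *\<^sub>R (g (z + x) - g z - L x) = (1 / norm x) *\<^sub>R (h (z + x) - h z - L x)"
      using eq z by simp
  qed fact
  from Lim_transform_eventually[OF L(2) this] L(1)
  show "\<exists>L. Vector_Spaces.linear (*s) scaleC L \<and>
      ((\<lambda>x. (1 / norm x) *\<^sub>R (h (z + x) - h z - L x)) \<longlongrightarrow> 0) (at 0)"
    by blast
qed

section \<open>Vector-valued holomorphic maps\<close>

lemma cfunctional_comp_holomorphic:
  fixes scaleC :: "complex \<Rightarrow> 'v \<Rightarrow>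
    'v::{real_vector, uniform_topological_group_add, topological_ab_group_add, t2_space}"
    and f :: "complex^'n \<Rightarrow> 'v"
  assumes lcs: "complex_lcs scaleC" and U: "open U" and f: "holomorphic_wrt scaleC f U"
    and l: "cfunctional scaleC l"
  shows "line_holomorphic (\<lambda>z. l (f z)) U"
proof (rule holomorphic_wrt_imp_line_holomorphic[OF U], unfold holomorphic_wrt_def, rule ballI)
  fix z assume "z \<in> U"
  then obtain L where L: "Vector_Spaces.linear (*s) scaleC L"
    "((\<lambda>h. (1 / norm h) *\<^sub>R (f (z + h) - f z - L h)) \<longlongrightarrow> 0) (at 0)"
    using f unfolding holomorphic_wrt_def by blast
  have "Vector_Spaces.linear (*s) (*) (l \<circ> L)"
    using L(1) l unfolding cfunctional_def by (intro Vector_Spaces.linear_compose) auto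
  then have "Vector_Spaces.linear (*s) (*) (\<lambda>h. l (L h))" by (simp add: o_def)
  moreover have "isCont l 0"
    using l by (simp add: cfunctional_def continuous_on_eq_continuous_at)
  from isCont_tendsto_compose[OF this L(2)]
  have "((\<lambda>h. (1 / norm h) *\<^sub>R (l (f (z + h)) - l (f z) - l (L h))) \<longlongrightarrow> 0) (at 0)"
    by (simp only: cfunctional_scaleR[OF lcs l] cfunctional_simps[OF l])
  ultimately show "\<exists>L. Vector_Spaces.linear (*s) (*) L \<and>
      ((\<lambda>h. (1 / norm h) *\<^sub>R (l (f (z + h)) - l (f z) - L h)) \<longlongrightarrow> 0) (at 0)"
    by blast
qed

text \<open>
  The differential is continuous because it is a finite sum of terms \<open>scaleC (h $ i) x\<close>.
\<close>

lemma holomorphic_wrt_imp_continuous_on: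
  fixes scaleC :: "complex \<Rightarrow> 'v \<Rightarrow>
    'v::{real_vector, uniform_topological_group_add, topological_ab_group_add, t2_space}"
    and f :: "complex^'n \<Rightarrow> 'v"
  assumes lcs: "complex_lcs scaleC" and f: "holomorphic_wrt scaleC f U"
  shows "continuous_on U f"
proof (rule continuous_at_imp_continuous_on, rule ballI)
  fix z assume "z \<in> U"
  then obtain L where L: "Vector_Spaces.linear (*s) scaleC L"
    "((\<lambda>h. (1 / norm h) *\<^sub>R (f (z + h) - f z - L h)) \<longlongrightarrow> 0) (at 0)"
    using f unfolding holomorphic_wrt_def by blast
  interpret L: Vector_Spaces.linear "(*s)" scaleC L by (fact L(1))
  interpret V: vector_space scaleC using lcs by (simp add: complex_lcs_def)
  have Lh: "L h = (\<Sum>i\<in>UNIV. scaleC (h $ i) (L (axis i 1)))" for h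
    by (subst basis_expansion[of h, symmetric]) (simp only: L.sum L.scale)
  have "((\<lambda>h. \<Sum>i\<in>UNIV. scaleC (h $ i) (L (axis i 1))) \<longlongrightarrow> (\<Sum>i\<in>UNIV. scaleC ((0::complex^'n) $ i) (L (axis i 1)))) (at 0)"
    by (intro tendsto_sum complex_lcs_tendsto_scaleC[OF lcs] tendsto_intros)
  then have L0: "(L \<longlongrightarrow> 0) (at 0)"
    by (simp flip: Lh)
  have "((\<lambda>h. norm h *\<^sub>R ((1 / norm h) *\<^sub>R (f (z + h) - f z - L h))) \<longlongrightarrow> norm (0::complex^'n) *\<^sub>R 0) (at 0)"
    by (intro complex_lcs_tendsto_scaleR[OF lcs] L(2) tendsto_intros)
  from tendsto_add[OF tendsto_add[OF this L0] tendsto_const[of "f z"]]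
  have "((\<lambda>h. norm h *\<^sub>R ((1 / norm h) *\<^sub>R (f (z + h) - f z - L h)) + L h + f z) \<longlongrightarrow> f z) (at 0)"
    by simp
  then have "((\<lambda>h. f (z + h)) \<longlongrightarrow> f z) (at 0)"
    by (rule Lim_transform_eventually) (auto simp: eventually_at intro!: exI[of _ 1])
  then show "isCont f z"
    by (simp add: isCont_def LIM_offset_zero_iff)
qed

text \<open>
  The partial derivatives exist in \<open>V\<close> as Cauchy integrals over circles in the coordinate directions. The
  remainder of the resulting linear approximation is quadratically small, uniformly over a norming
  family, and this means smallness in \<open>V\<close>.
\<close>

lemma weakly_holomorphic_imp_holomorphic_wrt:
  fixes scaleC :: "complex \<Rightarrow> 'v \<Rightarrow>
    'v::{real_vector, uniform_topological_group_add, topological_ab_group_add, t2_space}"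
    and g :: "complex^'n \<Rightarrow> 'v"
  assumes qc: "quasi_complete_lcs scaleC" and U: "open U" and cont: "continuous_on U g"
    and hol: "\<And>l. cfunctional scaleC l \<Longrightarrow> line_holomorphic (\<lambda>z. l (g z)) U"
  shows "holomorphic_wrt scaleC g U"
  unfolding holomorphic_wrt_def
proof
  fix z assume z: "z \<in> U"
  have lcs: "complex_lcs scaleC" using qc by (simp add: quasi_complete_lcs_def)
  interpret V: vector_space scaleC using lcs by (simp add: complex_lcs_def)
  obtain R where R: "R > 0" "cball z R \<subseteq> U"
    using z U open_contains_cball by blast
  have "\<exists>D. \<forall>l. cfunctional scaleC l \<longrightarrow> l D = line_deriv (\<lambda>z. l (g z)) (axis i 1) z" for i
  proof -
    let ?e = "axis i 1 :: complex^'n"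
    have "norm ?e = 1" by (simp add: norm_eq_1 inner_axis)
    then have in_cball: "z + x *s ?e \<in> cball z R" if "cmod x \<le> R" for x
      using that by (simp add: dist_norm norm_vector_scalar_mult)
    have "continuous_on {0..1} (\<lambda>t. g (z + (R * ucirc t) *s ?e))"
    proof (rule continuous_on_compose2[OF cont])
      show "continuous_on {0..1} (\<lambda>t. z + (R * ucirc t) *s ?e)" by (intro continuous_intros)
      show "(\<lambda>t. z + (R * ucirc t) *s ?e) ` {0..1} \<subseteq> U"
        using in_cball R by (auto simp: norm_mult simp del: mem_cball)
    qed
    moreover have "continuous_on {0..1} (\<lambda>t. 1 / (R * ucirc t))"
      using R(1) by (intro continuous_intros) auto
    ultimately have cont_e: "continuous_on {0..1} (\<lambda>t. scaleC (1 / (R * ucirc t)) (g (z + (R * ucirc t) *s ?e)))"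
      by (intro complex_lcs_continuous_on_scaleC[OF lcs])
    obtain D where D: "\<forall>l. cfunctional scaleC l \<longrightarrow>
        ((\<lambda>t. l (scaleC (1 / (R * ucirc t)) (g (z + (R * ucirc t) *s ?e)))) has_integral l D) {0..1}"
      using cfunctional_integral_exists[OF qc cont_e] by (elim exE)
    have "l D = line_deriv (\<lambda>z. l (g z)) ?e z" if l: "cfunctional scaleC l" for l
    proof -
      have "(\<lambda>x. l (g (z + x *s ?e))) holomorphic_on cball 0 R"
      proof (rule holomorphic_on_subset)
        show "(\<lambda>x. l (g (z + x *s ?e))) holomorphic_on {x. z + x *s ?e \<in> U}"
          using hol[OF l] by (simp add: line_holomorphic_def)
        show "cball 0 R \<subseteq> {x. z + x *s ?e \<in> U}"
          using in_cball R(2) by (auto simp del: mem_cball simp: mem_cball_0)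
      qed
      then have "((\<lambda>t. l (g (z + (0 + R * ucirc t) *s ?e)) / (R * ucirc t)) has_integral deriv (\<lambda>x. l (g (z + x *s ?e))) 0) {0..1}"
        using R(1) holomorphic_on_subset[OF _ ball_subset_cball]
        by (intro deriv_circle_integral holomorphic_on_imp_continuous_on) blast+
      moreover have "((\<lambda>t. l (g (z + (0 + R * ucirc t) *s ?e)) / (R * ucirc t)) has_integral l D) {0..1}"
        using D[rule_format, OF l] by (simp add: cfunctional_simps(4)[OF l])
      ultimately show ?thesis
        unfolding line_deriv_def by (rule has_integral_unique[symmetric])
    qed
    then show ?thesis by blast
  qed
  then obtain D where D: "\<And>i l. cfunctional scaleC l \<Longrightarrow> l (D i) = line_deriv (\<lambda>z. l (g z)) (axis i 1) z"
    by metis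
  define L where "L h = (\<Sum>i\<in>UNIV. scaleC (h $ i) (D i))" for h
  have "Vector_Spaces.linear (*s) scaleC L"
    by unfold_locales
      (auto simp: L_def V.scale_left_distrib sum.distrib V.scale_sum_right vec_eq_iff algebra_simps)
  moreover have lL: "l (L h) = line_deriv (\<lambda>z. l (g z)) h z" if l: "cfunctional scaleC l" for l h
  proof -
    interpret d: Vector_Spaces.linear "(*s)" "(*)" "\<lambda>h. line_deriv (\<lambda>z. l (g z)) h z"
      by (rule linear_line_deriv[OF U hol[OF l] z])
    show ?thesis
      by (subst basis_expansion[of h, symmetric])
        (simp only: L_def cfunctional_simps[OF l] D[OF l] d.sum d.scale)
  qed
  have "((\<lambda>h. (1 / norm h) *\<^sub>R (g (z + h) - g z - L h)) \<longlongrightarrow> 0) (at 0)"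
  proof (rule tendsto_zero_lcs[OF lcs])
    fix U0 \<L> Q assume "norming_family scaleC U0 \<L> Q"
    note fam = norming_familyD[OF this]
    have "continuous_on U (\<lambda>z. Q (g z))"
      by (rule continuous_on_compose2[OF fam(1) cont]) auto
    then obtain M where M: "M > 0" "\<And>w. w \<in> cball z R \<Longrightarrow> norm (Q (g w)) \<le> M"
      using continuous_bounded_cball[OF _ R(2)] by blast
    \<comment> \<open>the second bound on \<open>norm h\<close> makes \<open>8 M norm h / R\<^sup>2\<close> at most \<open>1/2\<close>\<close>
  define d where "d = min (R / 2) (R\<^sup>2 / (16 * M))"
    have "d > 0" using R(1) M(1) by (simp add: d_def)
    show "\<forall>\<^sub>F h in at 0. \<forall>l\<in>\<L>. cmod (l ((1 / norm h) *\<^sub>R (g (z + h) - g z - L h))) \<le> 1/2"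
      unfolding eventually_at
    proof (intro exI[of _ d] conjI ballI impI)
      fix h :: "complex^'n" and l
      assume h: "h \<noteq> 0 \<and> dist h 0 < d" and "l \<in> \<L>"
      note l = fam(3)[OF \<open>l \<in> \<L>\<close>]
      have h': "norm h \<le> R / 2" "norm h \<le> R\<^sup>2 / (16 * M)" using h by (auto simp: d_def)
      have "cmod (l (g w)) \<le> M" if "w \<in> cball z R" for w
        using fam(4)[OF \<open>l \<in> \<L>\<close>, of "g w"] M(2)[OF that] by simp
      then have "cmod (l (g (z + h)) - l (g z) - line_deriv (\<lambda>z. l (g z)) h z) \<le> 8 * M * (norm h)\<^sup>2 / R\<^sup>2"
        using h'(1) by (intro line_holomorphic_remainder_bound[OF U hol[OF l] R])
      then have "cmod (l (g (z + h) - g z - L h)) \<le> 8 * M * (norm h)\<^sup>2 / R\<^sup>2"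
        by (simp add: cfunctional_simps[OF l] lL[OF l])
      then have "(1 / norm h) * cmod (l (g (z + h) - g z - L h)) \<le> (1 / norm h) * (8 * M * (norm h)\<^sup>2 / R\<^sup>2)"
        by (intro mult_left_mono) auto
      also have "\<dots> = 8 * M * norm h / R\<^sup>2" using h by (simp add: power2_eq_square)
      also have "\<dots> \<le> 8 * M * (R\<^sup>2 / (16 * M)) / R\<^sup>2"
        using h'(2) M(1) by (intro divide_right_mono mult_left_mono) auto
      also have "\<dots> = 1/2" using R(1) M(1) by simp
      finally show "cmod (l ((1 / norm h) *\<^sub>R (g (z + h) - g z - L h))) \<le> 1/2"
        by (simp only: cfunctional_scaleR[OF lcs l] norm_scaleR abs_of_nonneg norm_ge_zero zero_le_divide_1_iff)
    qed fact
  qed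
  ultimately show "\<exists>L. Vector_Spaces.linear (*s) scaleC L \<and>
      ((\<lambda>h. (1 / norm h) *\<^sub>R (g (z + h) - g z - L h)) \<longlongrightarrow> 0) (at 0)"
    by blast
qed

text \<open>
  The circles run in \<open>W\<close> while the discs that they bound may leave it, so \<open>g\<close> can be holomorphic where \<open>f\<close>
  is not. The means exist in \<open>V\<close> and
  depend continuously on the centre by uniform continuity on compact sets; their compositions with
  functionals are parameter integrals of holomorphic functions.
\<close>

lemma circle_mean_holomorphic:
  fixes scaleC :: "complex \<Rightarrow> 'v \<Rightarrow>
    'v::{real_vector, uniform_topological_group_add, topological_ab_group_add, t2_space}"
    and f :: "complex^'n \<Rightarrow> 'v"
  assumes qc: "quasi_complete_lcs scaleC" and W: "open W" and f: "holomorphic_wrt scaleC f W"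
    and B: "open B" and circ: "\<And>z t. z \<in> B \<Longrightarrow> z + (of_real r * ucirc t) *s v \<in> W"
  shows "\<exists>g. holomorphic_wrt scaleC g B \<and> (\<forall>l. cfunctional scaleC l \<longrightarrow> (\<forall>z\<in>B.
      ((\<lambda>t. l (f (z + (of_real r * ucirc t) *s v))) has_integral l (g z)) {0..1}))"
proof -
  have lcs: "complex_lcs scaleC" using qc by (simp add: quasi_complete_lcs_def)
  have cf: "continuous_on W f" by (rule holomorphic_wrt_imp_continuous_on[OF lcs f])
  define H where "H y = f (fst y + (of_real r * ucirc (snd y)) *s v)" for y
  have cH: "continuous_on (B \<times> {0..1}) H"
    unfolding H_def
  proof (rule continuous_on_compose2[OF cf])
    show "continuous_on (B \<times> {0..1}) (\<lambda>y. fst y + (of_real r * ucirc (snd y)) *s v)"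
      by (intro continuous_intros)
  qed (use circ in auto)
  have cHz: "continuous_on {0..1} (\<lambda>t. H (z, t))" if "z \<in> B" for z
    using that by (intro continuous_on_compose2[OF cH] continuous_intros) auto
  have "\<exists>I. \<forall>l. cfunctional scaleC l \<longrightarrow> ((\<lambda>t. l (H (z, t))) has_integral l I) {0..1}" if z: "z \<in> B" for z
    by (rule cfunctional_integral_exists[OF qc cHz[OF z]])
  then obtain g where g: "\<And>l z. cfunctional scaleC l \<Longrightarrow> z \<in> B \<Longrightarrow> ((\<lambda>t. l (H (z, t))) has_integral l (g z)) {0..1}"
    by metis
  have "continuous_on B g"
  proof (rule continuous_at_imp_continuous_on, rule ballI)
    fix z assume z: "z \<in> B"
    obtain d where d: "d > 0" "cball z d \<subseteq> B"
      using z B open_contains_cball by blast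
    define K where "K = cball z d \<times> {0..1::real}"
    have "((\<lambda>w. g w - g z) \<longlongrightarrow> 0) (at z)"
    proof (rule tendsto_zero_lcs[OF lcs])
      fix U0 \<L> Q assume "norming_family scaleC U0 \<L> Q"
      note fam = norming_familyD[OF this]
      have "continuous_on K H"
        using cH d(2) by (auto simp: K_def elim!: continuous_on_subset)
      moreover have "compact K" unfolding K_def by (intro compact_Times) auto
      ultimately obtain d' where d': "d' > 0" "\<And>a b. a \<in> K \<Longrightarrow> b \<in> K \<Longrightarrow> dist a b < d' \<Longrightarrow> Q (H a - H b) < 1/2"
        using uniform_modulus_on_compact[OF fam(1,2), of K H "1/2"] by auto
      show "\<forall>\<^sub>F w in at z. \<forall>l\<in>\<L>. cmod (l (g w - g z)) \<le> 1/2"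
        unfolding eventually_at
      proof (intro exI[of _ "min d d'"] conjI ballI impI)
        fix w l assume w: "w \<noteq> z \<and> dist w z < min d d'" and "l \<in> \<L>"
        note l = fam(3)[OF \<open>l \<in> \<L>\<close>]
        have wB: "w \<in> B" using w d(2) by (auto simp: dist_commute)
        have int: "((\<lambda>t. l (H (w, t)) - l (H (z, t))) has_integral l (g w) - l (g z)) {0..1}"
          by (intro has_integral_diff g l wB z)
        have "cmod (l (g w) - l (g z)) \<le> 1/2 * Henstock_Kurzweil_Integration.content {0..1::real}"
        proof (rule has_integral_bound_real[OF _ _ int])
          fix t :: real assume t: "t \<in> {0..1} - {}"
          have "cmod (l (H (w, t) - H (z, t))) \<le> Q (H (w, t) - H (z, t))"
            by (rule fam(4)[OF \<open>l \<in> \<L>\<close>])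
          also have "\<dots> < 1/2"
            using t w d(1) by (intro d'(2)) (auto simp: K_def dist_Pair_Pair dist_commute)
          finally show "cmod (l (H (w, t)) - l (H (z, t))) \<le> 1/2"
            by (simp add: cfunctional_simps[OF l])
        qed auto
        then show "cmod (l (g w - g z)) \<le> 1/2" by (simp add: cfunctional_simps[OF l])
      qed (use d d' in auto)
    qed
    from tendsto_add[OF this tendsto_const[of "g z"]] show "isCont g z"
      by (simp add: isCont_def)
  qed
  moreover have "line_holomorphic (\<lambda>z. l (g z)) B" if l: "cfunctional scaleC l" for l
  proof (rule line_holomorphic_transform)
    have lf: "line_holomorphic (\<lambda>z. l (f z)) W"
      by (rule cfunctional_comp_holomorphic[OF lcs W f l])
    show "line_holomorphic (\<lambda>z. integral {0..1} (\<lambda>t. l (f (z + (of_real r * ucirc t) *s v)))) B"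
    proof (rule line_holomorphic_integral[OF B])
      have "continuous_on (B \<times> {0..1}) (\<lambda>y. l (H y))"
        using l by (intro continuous_on_compose2[OF _ cH, of UNIV l]) (auto simp: cfunctional_def)
      then show "continuous_on (B \<times> {0..1}) (\<lambda>(z, t). l (f (z + (of_real r * ucirc t) *s v)))"
        by (simp add: H_def case_prod_unfold)
      show "line_holomorphic (\<lambda>z. l (f (z + (of_real r * ucirc t) *s v))) B" for t
        by (rule line_holomorphic_shift[OF lf]) (rule circ)
    qed
    show "integral {0..1} (\<lambda>t. l (f (z + (of_real r * ucirc t) *s v))) = l (g z)" if "z \<in> B" for z
      using g[OF l that] by (simp add: H_def integral_unique)
  qed
  ultimately have "holomorphic_wrt scaleC g B"
    by (intro weakly_holomorphic_imp_holomorphic_wrt[OF qc B])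
  then show ?thesis using g by (intro exI[of _ g]) (simp add: H_def)
qed

section \<open>Zeros along a fixed direction\<close>

lemma nhd_shift_compact:
  fixes v :: "complex^'n"
  assumes U: "open U" and K: "compact K" and in_U: "\<And>\<zeta>. \<zeta> \<in> K \<Longrightarrow> x + \<zeta> *s v \<in> U"
  shows "\<exists>d>0. \<forall>w\<in>ball x d. \<forall>\<zeta>\<in>K. w + \<zeta> *s v \<in> U"
proof -
  have "compact ((\<lambda>\<zeta>. x + \<zeta> *s v) ` K)"
    by (intro compact_continuous_image K continuous_intros)
  moreover have "(\<lambda>\<zeta>. x + \<zeta> *s v) ` K \<subseteq> U" using in_U by auto
  ultimately obtain d where d: "d > 0" "(\<Union>y\<in>(\<lambda>\<zeta>. x + \<zeta> *s v) ` K. ball y d) \<subseteq> U"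
    using compact_subset_open_imp_ball_epsilon_subset[OF _ U] by metis
  show ?thesis
  proof (intro exI[of _ d] conjI d(1) ballI)
    fix w \<zeta> assume "w \<in> ball x d" "\<zeta> \<in> K"
    then have "w + \<zeta> *s v \<in> ball (x + \<zeta> *s v) d" by (simp add: dist_norm)
    then show "w + \<zeta> *s v \<in> U" using d(2) \<open>\<zeta> \<in> K\<close> by blast
  qed
qed

text \<open>
  The disc is enlarged slightly to an open disc \<open>T\<close> in which \<open>F\<close> still has only finitely many zeros. There
  the general argument principle applies, and the circle winds once around the zeros inside it and not
  around those outside.
\<close>

lemma argument_principle_circle:
  fixes F :: "complex \<Rightarrow> complex"
  assumes S: "open S" "cball c \<epsilon> \<subseteq> S" and F: "F holomorphic_on S" and \<epsilon>: "\<epsilon> > 0"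
    and nz: "\<forall>\<zeta>\<in>sphere c \<epsilon>. F \<zeta> \<noteq> 0"
  defines "Z \<equiv> {\<zeta> \<in> ball c \<epsilon>. F \<zeta> = 0}"
  shows "finite Z" and "\<And>\<zeta>. \<zeta> \<in> Z \<Longrightarrow> zorder F \<zeta> > 0"
    and "h holomorphic_on UNIV \<Longrightarrow>
      ((\<lambda>\<zeta>. h \<zeta> * deriv F \<zeta> / F \<zeta>) has_contour_integral 2 * pi * \<i> * (\<Sum>\<zeta>\<in>Z. h \<zeta> * of_int (zorder F \<zeta>)))
        (circlepath c \<epsilon>)"
proof -
  obtain d where d: "d > 0" "(\<Union>x\<in>cball c \<epsilon>. ball x d) \<subseteq> S"
    using compact_subset_open_imp_ball_epsilon_subset[OF compact_cball S] by blast
  define R where "R = \<epsilon> + d"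
  define T where "T = ball c (\<epsilon> + d / 2)"
  have R_sub: "ball c R \<subseteq> S"
  proof
    fix x assume x: "x \<in> ball c R"
    show "x \<in> S"
    proof (cases "x \<in> cball c \<epsilon>")
      case False
      \<comment> \<open>the radial projection of \<open>x\<close> to the circle\<close>
      define y where "y = c + of_real (\<epsilon> / dist c x) * (x - c)"
      have pos: "dist c x > \<epsilon>" "dist c x < \<epsilon> + d" using False x by (auto simp: R_def)
      have "x \<noteq> c" using pos(1) \<epsilon> by auto
      then have "dist c y = \<epsilon>" using pos \<epsilon> by (simp add: y_def dist_norm norm_mult norm_divide norm_minus_commute)
      moreover have "x - y = of_real (1 - \<epsilon> / dist c x) * (x - c)"
        by (simp add: y_def algebra_simps)
      then have "dist y x = (1 - \<epsilon> / dist c x) * dist c x"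
        using pos \<epsilon> unfolding dist_commute[of c x] dist_norm
        by (metis norm_minus_commute abs_of_nonneg diff_ge_0_iff_ge divide_le_eq_1_pos less_eq_real_def
            norm_mult norm_of_real order_less_trans dist_norm)
      then have "dist y x < d" using pos \<epsilon> by (simp add: left_diff_distrib)
      ultimately have "y \<in> cball c \<epsilon>" "x \<in> ball y d" by simp_all
      then show ?thesis using d(2) by blast
    qed (use S in auto)
  qed
  have FR: "F holomorphic_on ball c R" using holomorphic_on_subset[OF F R_sub] .
  have T_sub: "T \<subseteq> ball c R" "cball c \<epsilon> \<subseteq> T" "T \<subseteq> cball c (\<epsilon> + d / 2)" "cball c (\<epsilon> + d / 2) \<subseteq> ball c R"
    using d(1) by (auto simp: T_def R_def)
  have FT: "F holomorphic_on T" using holomorphic_on_subset[OF FR T_sub(1)] .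
  have "c + of_real \<epsilon> \<in> sphere c \<epsilon>" using \<epsilon> by (simp add: dist_norm)
  then obtain s where s: "s \<in> sphere c \<epsilon>" "F s \<noteq> 0" using nz by blast
  then have sT: "s \<in> T" using T_sub(2) by auto
  have fin: "finite {\<zeta> \<in> cball c (\<epsilon> + d / 2). F \<zeta> = 0}"
  proof (cases "F constant_on ball c R")
    case True
    then have "F \<zeta> = F s" if "\<zeta> \<in> ball c R" for \<zeta>
      using that sT T_sub(1) unfolding constant_on_def by (metis subsetD)
    then have "{\<zeta> \<in> cball c (\<epsilon> + d / 2). F \<zeta> = 0} = {}" using s(2) T_sub(4) by auto
    then show ?thesis by (metis finite.emptyI)
  next
    case False
    then show ?thesis
      using holomorphic_compact_finite_zeros[OF FR _ _ compact_cball T_sub(4)] by simp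
  qed
  then have finT: "finite {\<zeta> \<in> T. F \<zeta> = 0}"
    by (rule finite_subset[rotated]) (use T_sub(3) in auto)
  have "Z \<subseteq> {\<zeta> \<in> T. F \<zeta> = 0}" using T_sub(2) by (auto simp: Z_def)
  then show "finite Z" using finT by (rule finite_subset)
  show "zorder F \<zeta> > 0" if "\<zeta> \<in> Z" for \<zeta>
  proof -
    have "\<zeta> \<in> T" "F \<zeta> = 0" using that T_sub(2) by (auto simp: Z_def)
    moreover have "open T" "connected T" by (auto simp: T_def)
    ultimately show ?thesis
      using zorder_exist_zero[OF FT, of \<zeta>] s(2) sT by auto
  qed
  assume h: "h holomorphic_on UNIV"
  have T_open: "open T" by (simp add: T_def)
  have pimg: "path_image (circlepath c \<epsilon>) \<subseteq> T - {\<zeta> \<in> T. F \<zeta> = 0}"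
    using \<epsilon> nz T_sub(2) by (auto simp: path_image_circlepath)
  have wind0: "winding_number (circlepath c \<epsilon>) z = 0" if "z \<notin> T" for z
  proof (rule winding_number_zero_outside[of _ "cball c \<epsilon>"])
    show "z \<notin> cball c \<epsilon>" using that T_sub(2) by auto
  qed (use \<epsilon> in \<open>auto simp: path_image_circlepath\<close>)
  have wind: "winding_number (circlepath c \<epsilon>) z = (if z \<in> ball c \<epsilon> then 1 else 0)" if "z \<in> {\<zeta> \<in> T. F \<zeta> = 0}" for z
  proof (cases "z \<in> ball c \<epsilon>")
    case True
    then show ?thesis by (simp add: winding_number_circlepath dist_norm norm_minus_commute)
  next
    case False
    then have "z \<notin> cball c \<epsilon>" using that nz by force
    then have "winding_number (circlepath c \<epsilon>) z = 0"
      by (intro winding_number_zero_outside[of _ "cball c \<epsilon>"]) (use \<epsilon> in \<open>auto simp: path_image_circlepath\<close>)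
    then show ?thesis using False by simp
  qed
  have hT: "h holomorphic_on T" using holomorphic_on_subset[OF h] by auto
  have "contour_integral (circlepath c \<epsilon>) (\<lambda>x. deriv F x * h x / F x) = 2 * pi * \<i> *
      (\<Sum>z\<in>{w \<in> T. F w = 0 \<or> w \<in> {}}. winding_number (circlepath c \<epsilon>) z * h z * of_int (zorder F z))"
    using pimg wind0 finT FT T_open hT
    by (intro argument_principle) (auto simp: T_def)
  also have "(\<Sum>z\<in>{w \<in> T. F w = 0 \<or> w \<in> {}}. winding_number (circlepath c \<epsilon>) z * h z * of_int (zorder F z))
      = (\<Sum>z\<in>{w \<in> T. F w = 0}. if z \<in> ball c \<epsilon> then h z * of_int (zorder F z) else 0)"
    by (intro sum.cong) (auto simp: wind)
  also have "\<dots> = (\<Sum>z\<in>{w \<in> T. F w = 0} \<inter> ball c \<epsilon>. h z * of_int (zorder F z))"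
    using finT by (simp add: sum.inter_restrict)
  also have "{w \<in> T. F w = 0} \<inter> ball c \<epsilon> = Z" using T_sub(2) by (auto simp: Z_def)
  finally have val: "contour_integral (circlepath c \<epsilon>) (\<lambda>x. h x * deriv F x / F x) =
      2 * pi * \<i> * (\<Sum>\<zeta>\<in>Z. h \<zeta> * of_int (zorder F \<zeta>))"
    by (simp add: mult.commute)
  have "continuous_on T (deriv F)"
    by (intro holomorphic_on_imp_continuous_on holomorphic_deriv FT T_open)
  then have "continuous_on (path_image (circlepath c \<epsilon>)) (\<lambda>x. h x * deriv F x / F x)"
    using pimg holomorphic_on_imp_continuous_on[OF FT] holomorphic_on_imp_continuous_on[OF hT]
    by (intro continuous_intros) (auto elim!: continuous_on_subset)
  then show "((\<lambda>\<zeta>. h \<zeta> * deriv F \<zeta> / F \<zeta>) has_contour_integral 2 * pi * \<i> * (\<Sum>\<zeta>\<in>Z. h \<zeta> * of_int (zorder F \<zeta>)))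
      (circlepath c \<epsilon>)"
    using has_contour_integral_integral[OF contour_integrable_continuous_circlepath] val by metis
qed

text \<open>
  With \<open>F \<zeta> = p (w + \<zeta> v)\<close> this is \<open>1 / (2 \<pi> \<i>)\<close> times the integral of \<open>h F' / F\<close> over the circle with
  centre \<open>c\<close> and radius \<open>\<epsilon>\<close>.
\<close>

definition zero_moment ::
  "(complex^'n \<Rightarrow> complex) \<Rightarrow> complex^'n \<Rightarrow> (complex \<Rightarrow> complex) \<Rightarrow> complex \<Rightarrow> real \<Rightarrow> complex^'n \<Rightarrow> complex" where
  "zero_moment p v h c \<epsilon> w = integral {0..1} (\<lambda>t. h (c + of_real \<epsilon> * ucirc t)
     * line_deriv p v (w + (c + of_real \<epsilon> * ucirc t) *s v) / p (w + (c + of_real \<epsilon> * ucirc t) *s v)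
     * (of_real \<epsilon> * ucirc t))"

text \<open>
  Here \<open>m \<zeta>\<close> is the multiplicity of the zero \<open>\<zeta>\<close>.
\<close>

lemma zero_moment_eq_sum:
  assumes \<Omega>: "open \<Omega>" and p: "line_holomorphic p \<Omega>" and \<epsilon>: "\<epsilon> > 0"
    and disc: "\<forall>\<zeta>\<in>cball c \<epsilon>. w + \<zeta> *s v \<in> \<Omega>"
    and nz: "\<forall>\<zeta>\<in>sphere c \<epsilon>. p (w + \<zeta> *s v) \<noteq> 0"
  defines "Z \<equiv> {\<zeta> \<in> ball c \<epsilon>. p (w + \<zeta> *s v) = 0}"
  shows "\<exists>m :: complex \<Rightarrow> nat. finite Z \<and> (\<forall>\<zeta>\<in>Z. m \<zeta> > 0) \<and>
    (\<forall>h. h holomorphic_on UNIV \<longrightarrow> zero_moment p v h c \<epsilon> w = (\<Sum>\<zeta>\<in>Z. h \<zeta> * of_nat (m \<zeta>)))"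
proof -
  define F where "F \<zeta> = p (w + \<zeta> *s v)" for \<zeta>
  define S where "S = {\<zeta>. w + \<zeta> *s v \<in> \<Omega>}"
  have S: "open S" "cball c \<epsilon> \<subseteq> S"
    using open_line_preimage[OF \<Omega>] disc by (auto simp: S_def)
  have F: "F holomorphic_on S"
    using p by (simp add: line_holomorphic_def F_def [abs_def] S_def)
  have nzF: "\<forall>\<zeta>\<in>sphere c \<epsilon>. F \<zeta> \<noteq> 0" using nz by (simp add: F_def)
  have Z: "Z = {\<zeta> \<in> ball c \<epsilon>. F \<zeta> = 0}" by (simp add: Z_def F_def)
  note arg = argument_principle_circle[OF S F \<epsilon> nzF, folded Z]
  show ?thesis
  proof (intro exI[of _ "\<lambda>\<zeta>. nat (zorder F \<zeta>)"] conjI ballI allI impI)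
    show "finite Z" by (rule arg(1))
    show "nat (zorder F \<zeta>) > 0" if "\<zeta> \<in> Z" for \<zeta> using arg(2)[OF that] by simp
    fix h assume h: "h holomorphic_on UNIV"
    have circ: "w + (c + of_real \<epsilon> * ucirc t) *s v \<in> \<Omega>" for t
      using \<epsilon> by (intro disc[rule_format]) (simp add: dist_norm norm_mult)
    have deriv_F: "deriv F \<zeta> = line_deriv p v (w + \<zeta> *s v)" if "w + \<zeta> *s v \<in> \<Omega>" for \<zeta>
      unfolding F_def [abs_def] by (rule DERIV_imp_deriv[OF line_holomorphic_has_field_derivative[OF \<Omega> p that]])
    have "((\<lambda>t. h (c + of_real \<epsilon> * ucirc t) * deriv F (c + of_real \<epsilon> * ucirc t) / F (c + of_real \<epsilon> * ucirc t)
        * (of_real \<epsilon> * ucirc t)) has_integral (\<Sum>\<zeta>\<in>Z. h \<zeta> * of_int (zorder F \<zeta>))) {0..1}"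
      by (rule has_contour_integral_circlepath_ucirc[OF arg(3)[OF h]])
    then have "zero_moment p v h c \<epsilon> w = (\<Sum>\<zeta>\<in>Z. h \<zeta> * of_int (zorder F \<zeta>))"
      unfolding zero_moment_def by (simp add: deriv_F[OF circ] F_def integral_unique)
    also have "\<dots> = (\<Sum>\<zeta>\<in>Z. h \<zeta> * of_nat (nat (zorder F \<zeta>)))"
      using arg(2) by (intro sum.cong refl) (simp add: less_imp_le of_nat_nat)
    finally show "zero_moment p v h c \<epsilon> w = (\<Sum>\<zeta>\<in>Z. h \<zeta> * of_nat (nat (zorder F \<zeta>)))" .
  qed
qed

lemma line_holomorphic_zero_moment:
  assumes \<Omega>: "open \<Omega>" and p: "line_holomorphic p \<Omega>" and B: "open B" and h: "continuous_on UNIV h"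
    and circ: "\<And>w \<zeta>. w \<in> B \<Longrightarrow> \<zeta> \<in> sphere c \<epsilon> \<Longrightarrow> w + \<zeta> *s v \<in> \<Omega> \<and> p (w + \<zeta> *s v) \<noteq> 0"
    and \<epsilon>: "\<epsilon> > 0"
  shows "line_holomorphic (zero_moment p v h c \<epsilon>) B"
  unfolding zero_moment_def [abs_def]
proof (rule line_holomorphic_integral[OF B])
  define \<zeta> where "\<zeta> t = c + of_real \<epsilon> * ucirc t" for t
  have \<zeta>: "\<zeta> t \<in> sphere c \<epsilon>" for t using \<epsilon> by (simp add: \<zeta>_def dist_norm norm_mult)
  define D where "D = line_deriv p v"
  have D: "line_holomorphic D \<Omega>" unfolding D_def by (rule line_holomorphic_line_deriv[OF \<Omega> p])
  have c\<zeta>: "continuous_on A \<zeta>" for A unfolding \<zeta>_def [abs_def] by (intro continuous_intros)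
  have arg: "continuous_on (B \<times> {0..1}) (\<lambda>y. fst y + \<zeta> (snd y) *s v)"
    by (intro continuous_intros continuous_on_compose2[OF c\<zeta>]) auto
  have img: "(\<lambda>y. fst y + \<zeta> (snd y) *s v) ` (B \<times> {0..1}) \<subseteq> \<Omega>" using circ \<zeta> by auto
  have "continuous_on (B \<times> {0..1}) (\<lambda>y. D (fst y + \<zeta> (snd y) *s v))"
    "continuous_on (B \<times> {0..1}) (\<lambda>y. p (fst y + \<zeta> (snd y) *s v))"
    using D p by (intro continuous_on_compose2[OF _ arg img]; simp add: line_holomorphic_def)+
  moreover have "continuous_on (B \<times> {0..1}) (\<lambda>y. h (\<zeta> (snd y)))"
    by (rule continuous_on_compose2[OF h continuous_on_compose2[OF c\<zeta>]]) (auto intro: continuous_intros)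
  ultimately have "continuous_on (B \<times> {0..1}) (\<lambda>y. h (\<zeta> (snd y)) * D (fst y + \<zeta> (snd y) *s v)
      / p (fst y + \<zeta> (snd y) *s v) * (of_real \<epsilon> * ucirc (snd y)))"
    using circ \<zeta> by (intro continuous_on_mult continuous_on_divide continuous_on_const
        continuous_on_ucirc_comp continuous_on_snd continuous_on_id) auto
  then show "continuous_on (B \<times> {0..1}) (\<lambda>(w, t). h (c + of_real \<epsilon> * ucirc t)
     * line_deriv p v (w + (c + of_real \<epsilon> * ucirc t) *s v) / p (w + (c + of_real \<epsilon> * ucirc t) *s v)
     * (of_real \<epsilon> * ucirc t))"
    by (simp add: \<zeta>_def D_def case_prod_unfold)
  fix t :: real
  have "line_holomorphic (\<lambda>w. h (\<zeta> t) * D (w + \<zeta> t *s v) / p (w + \<zeta> t *s v) * (of_real \<epsilon> * ucirc t)) B"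
    using circ[OF _ \<zeta>[of t]]
    by (intro line_holomorphic_mult line_holomorphic_divide line_holomorphic_const
        line_holomorphic_shift[OF D] line_holomorphic_shift[OF p]) auto
  then show "line_holomorphic (\<lambda>w. h (c + of_real \<epsilon> * ucirc t)
     * line_deriv p v (w + (c + of_real \<epsilon> * ucirc t) *s v) / p (w + (c + of_real \<epsilon> * ucirc t) *s v)
     * (of_real \<epsilon> * ucirc t)) B"
    by (simp add: \<zeta>_def D_def)
qed

text \<open>
  With \<open>m\<close> the multiplicity of the zero, the moments for \<open>h = 1\<close> and \<open>h = id\<close> are \<open>m\<close> and \<open>m\<close> times \<open>a w\<close>.
  Their quotient is \<open>a w\<close>, even if the multiplicity is greater than one.
\<close>

lemma unique_zero_line_holomorphic:
  assumes \<Omega>: "open \<Omega>" and p: "line_holomorphic p \<Omega>" and B: "open B" and \<epsilon>: "\<epsilon> > 0"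
    and disc: "\<And>w \<zeta>. w \<in> B \<Longrightarrow> \<zeta> \<in> cball c \<epsilon> \<Longrightarrow> w + \<zeta> *s v \<in> \<Omega>"
    and nz: "\<And>w \<zeta>. w \<in> B \<Longrightarrow> \<zeta> \<in> sphere c \<epsilon> \<Longrightarrow> p (w + \<zeta> *s v) \<noteq> 0"
    and a: "\<And>w. w \<in> B \<Longrightarrow> {\<zeta> \<in> ball c \<epsilon>. p (w + \<zeta> *s v) = 0} = {a w}"
  shows "line_holomorphic a B"
proof -
  have moments: "zero_moment p v (\<lambda>_. 1) c \<epsilon> w \<noteq> 0 \<and>
      zero_moment p v (\<lambda>\<zeta>. \<zeta>) c \<epsilon> w / zero_moment p v (\<lambda>_. 1) c \<epsilon> w = a w" if w: "w \<in> B" for w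
  proof -
    obtain m :: "complex \<Rightarrow> nat" where m: "m (a w) > 0"
      "\<And>h. h holomorphic_on UNIV \<Longrightarrow> zero_moment p v h c \<epsilon> w = h (a w) * of_nat (m (a w))"
      using zero_moment_eq_sum[OF \<Omega> p \<epsilon>, of c w v] disc[OF w] nz[OF w] unfolding a[OF w] by auto
    have "zero_moment p v (\<lambda>_. 1) c \<epsilon> w = of_nat (m (a w))"
      "zero_moment p v (\<lambda>\<zeta>. \<zeta>) c \<epsilon> w = a w * of_nat (m (a w))"
      using m(2)[of "\<lambda>_. 1"] m(2)[of "\<lambda>\<zeta>. \<zeta>"] by (auto intro: holomorphic_intros)
    then show ?thesis using m(1) by simp
  qed
  have "w + \<zeta> *s v \<in> \<Omega> \<and> p (w + \<zeta> *s v) \<noteq> 0" if "w \<in> B" "\<zeta> \<in> sphere c \<epsilon>" for w \<zeta>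
    using disc nz that by auto
  then have "line_holomorphic (\<lambda>w. zero_moment p v (\<lambda>\<zeta>. \<zeta>) c \<epsilon> w / zero_moment p v (\<lambda>_. 1) c \<epsilon> w) B"
    using moments by (intro line_holomorphic_divide line_holomorphic_zero_moment[OF \<Omega> p B _ _ \<epsilon>]) (auto intro: continuous_intros)
  then show ?thesis by (rule line_holomorphic_transform) (use moments in blast)
qed

section \<open>Regular points of the zero locus\<close>

text \<open>
  If each of the discs \<open>w + \<zeta> v\<close>, \<open>w \<in> B\<close>, contains exactly one zero \<open>\<zeta> = a w\<close>, then \<open>X\<close> is a graph over the
  hyperplane \<open>x $ k = w1 $ k\<close>, to which \<open>v\<close> is transversal. Subtracting the height \<open>a\<close> in the coordinate
  \<open>k\<close> straightens it.
\<close>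

lemma zero_graph_regular:
  fixes p :: "complex^'n \<Rightarrow> complex" and v :: "complex^'n"
  assumes \<Omega>: "open \<Omega>" and p: "line_holomorphic p \<Omega>" and B: "open B" "w1 \<in> B"
    and v: "v $ k = 1" and \<epsilon>: "\<epsilon> > 0"
    and disc: "\<And>w \<zeta>. w \<in> B \<Longrightarrow> \<zeta> \<in> cball c \<epsilon> \<Longrightarrow> w + \<zeta> *s v \<in> \<Omega>"
    and nz: "\<And>w \<zeta>. w \<in> B \<Longrightarrow> \<zeta> \<in> sphere c \<epsilon> \<Longrightarrow> p (w + \<zeta> *s v) \<noteq> 0"
    and uniq: "\<And>w. w \<in> B \<Longrightarrow> \<exists>!\<zeta>. \<zeta> \<in> ball c \<epsilon> \<and> p (w + \<zeta> *s v) = 0"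
    and \<zeta>1: "\<zeta>1 \<in> ball c \<epsilon>" "p (w1 + \<zeta>1 *s v) = 0"
  shows "w1 + \<zeta>1 *s v \<in> regular_points \<Omega> (zero_locus \<Omega> p)"
proof -
  define a where "a w = (THE \<zeta>. \<zeta> \<in> ball c \<epsilon> \<and> p (w + \<zeta> *s v) = 0)" for w
  have a_iff: "\<zeta> \<in> ball c \<epsilon> \<and> p (w + \<zeta> *s v) = 0 \<longleftrightarrow> \<zeta> = a w" if "w \<in> B" for w \<zeta>
    using theI'[OF uniq[OF that]] uniq[OF that] unfolding a_def by blast
  have a: "line_holomorphic a B"
    using a_iff by (intro unique_zero_line_holomorphic[OF \<Omega> p B(1) \<epsilon> disc nz]) blast+
  \<comment> \<open>\<open>\<pi>\<close> projects along \<open>v\<close> to the hyperplane through \<open>w1\<close> with constant coordinate \<open>k\<close>, \<open>\<sigma>\<close> resets the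
    coordinate \<open>k\<close>, and \<open>\<phi>\<close> and \<open>\<psi>\<close> are the chart and its inverse\<close>
  define \<pi> where "\<pi> x = x - (x $ k - w1 $ k) *s v" for x
  define \<sigma> where "\<sigma> y = (\<chi> i. if i = k then w1 $ k else y $ i)" for y :: "complex^'n"
  define \<phi> where "\<phi> x = (\<chi> i. if i = k then x $ k - w1 $ k - a (\<pi> x) else \<pi> x $ i)" for x
  define \<psi> where "\<psi> y = \<sigma> y + (y $ k + a (\<sigma> y)) *s v" for y
  define W where "W = {x. \<pi> x \<in> B \<and> x $ k - w1 $ k \<in> ball c \<epsilon>}"
  define W' where "W' = {y. \<sigma> y \<in> B \<and> y $ k + a (\<sigma> y) \<in> ball c \<epsilon>}"
  have c\<pi>: "continuous_on A \<pi>" for A unfolding \<pi>_def [abs_def] by (intro continuous_intros)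
  have c\<sigma>: "continuous_on A \<sigma>" for A
    unfolding \<sigma>_def [abs_def]
  proof (rule continuous_on_vec_lambda)
    fix i
    show "continuous_on A (\<lambda>y :: complex^'n. if i = k then w1 $ k else y $ i)"
      by (cases "i = k") (auto intro!: continuous_intros)
  qed
  have \<sigma>B: "open {y. \<sigma> y \<in> B}" and \<pi>B: "open {x. \<pi> x \<in> B}"
    using open_Collect_mem[OF B(1)] c\<pi> c\<sigma> by blast+
  have a\<pi>: "line_holomorphic (\<lambda>x. a (\<pi> x)) {x. \<pi> x \<in> B}"
    by (rule line_holomorphic_compose_affine[OF a c\<pi>, where B = "\<lambda>u. u - u $ k *s v"])
      (auto simp: \<pi>_def vec_eq_iff algebra_simps)
  have a\<sigma>: "line_holomorphic (\<lambda>y. a (\<sigma> y)) {y. \<sigma> y \<in> B}"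
    by (rule line_holomorphic_compose_affine[OF a c\<sigma>, where B = "\<lambda>u. \<chi> i. if i = k then 0 else u $ i"])
      (auto simp: \<sigma>_def vec_eq_iff)
  have "W = {x. \<pi> x \<in> B} \<inter> {x. x $ k - w1 $ k \<in> ball c \<epsilon>}" by (auto simp: W_def)
  moreover have "open {x :: complex^'n. x $ k - w1 $ k \<in> ball c \<epsilon>}"
    by (rule open_Collect_mem) (auto intro!: continuous_intros)
  ultimately have oW: "open W" using \<pi>B by auto
  have "W' = {y \<in> {y. \<sigma> y \<in> B}. y $ k + a (\<sigma> y) \<in> ball c \<epsilon>}" by (auto simp: W'_def)
  also have "\<dots> = {y. \<sigma> y \<in> B} \<inter> (\<lambda>y. y $ k + a (\<sigma> y)) -` ball c \<epsilon>" by auto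
  also have "open \<dots>"
    using a\<sigma> by (intro continuous_open_preimage[OF _ \<sigma>B] continuous_intros) (auto simp: line_holomorphic_def)
  finally have oW': "open W'" .
  have \<pi>k: "\<pi> x $ k = w1 $ k" for x by (simp add: \<pi>_def v)
  have \<sigma>\<phi>: "\<sigma> (\<phi> x) = \<pi> x" for x using \<pi>k[of x] by (auto simp: \<sigma>_def \<phi>_def vec_eq_iff)
  have \<psi>\<phi>: "\<psi> (\<phi> x) = x" for x
    unfolding \<psi>_def \<sigma>\<phi> by (simp add: \<phi>_def) (simp add: \<pi>_def)
  have \<psi>k: "\<psi> y $ k - w1 $ k = y $ k + a (\<sigma> y)" for y
    by (simp add: \<psi>_def v) (simp add: \<sigma>_def)
  have \<pi>\<psi>: "\<pi> (\<psi> y) = \<sigma> y" for y unfolding \<pi>_def \<psi>k by (simp add: \<psi>_def)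
  have \<phi>\<psi>: "\<phi> (\<psi> y) = y" for y
    unfolding \<phi>_def \<pi>\<psi> using \<psi>k[of y] by (auto simp: vec_eq_iff \<sigma>_def)
  have \<phi>W: "\<phi> ` W \<subseteq> W'"
    by (auto simp: W_def W'_def \<sigma>\<phi>) (simp add: \<phi>_def)
  have \<psi>W: "\<psi> ` W' \<subseteq> W" by (auto simp: W_def W'_def \<pi>\<psi> \<psi>k)
  have bij: "bij_betw \<phi> W W'"
    by (rule bij_betw_byWitness[where f' = \<psi>]) (use \<psi>\<phi> \<phi>\<psi> \<phi>W \<psi>W in auto)
  have inv: "inv_into W \<phi> y = \<psi> y" if "y \<in> W'" for y
    using bij that \<psi>W \<phi>\<psi> by (intro inv_into_f_eq) (auto simp: bij_betw_def)
  have hol_\<phi>: "holomorphic_wrt (*s) \<phi> W"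
  proof (rule line_holomorphic_components_imp_holomorphic_wrt[OF oW])
    fix i
    have WB: "W \<subseteq> {x. \<pi> x \<in> B}" by (auto simp: W_def)
    have "line_holomorphic (\<lambda>x. x $ k - w1 $ k - a (\<pi> x)) W"
      by (intro line_holomorphic_intros line_holomorphic_subset[OF a\<pi> WB])
    moreover have "line_holomorphic (\<lambda>x. x $ i - (x $ k - w1 $ k) * v $ i) W"
      by (intro line_holomorphic_intros)
    moreover have "\<phi> x $ i = (if i = k then x $ k - w1 $ k - a (\<pi> x) else x $ i - (x $ k - w1 $ k) * v $ i)" for x
      unfolding \<phi>_def vec_lambda_beta by (cases "i = k") (simp_all only: refl if_True if_False \<pi>_def
          vector_minus_component vector_smult_component)
    ultimately show "line_holomorphic (\<lambda>x. \<phi> x $ i) W"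
      by (cases "i = k") (simp_all only: refl if_True if_False)
  qed
  have hol_\<psi>: "holomorphic_wrt (*s) \<psi> W'"
  proof (rule line_holomorphic_components_imp_holomorphic_wrt[OF oW'])
    fix i
    have WB: "W' \<subseteq> {y. \<sigma> y \<in> B}" by (auto simp: W'_def)
    have "line_holomorphic (\<lambda>y. \<sigma> y $ i) W'"
      by (cases "i = k") (auto simp: \<sigma>_def intro: line_holomorphic_intros)
    then have "line_holomorphic (\<lambda>y. \<sigma> y $ i + (y $ k + a (\<sigma> y)) * v $ i) W'"
      by (intro line_holomorphic_intros line_holomorphic_subset[OF a\<sigma> WB])
    then show "line_holomorphic (\<lambda>y. \<psi> y $ i) W'"
      by (simp only: \<psi>_def vector_add_component vector_smult_component)
  qed
  have chart: "biholomorphic \<phi> W W'"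
    unfolding biholomorphic_def using oW oW' bij hol_\<phi> holomorphic_wrt_transform[OF oW' hol_\<psi>] inv by auto
  have x_eq: "x = \<pi> x + (x $ k - w1 $ k) *s v" for x by (simp add: \<pi>_def)
  have W\<Omega>: "W \<subseteq> \<Omega>"
  proof
    fix x assume "x \<in> W"
    then have "\<pi> x + (x $ k - w1 $ k) *s v \<in> \<Omega>" by (intro disc) (auto simp: W_def)
    then show "x \<in> \<Omega>" using x_eq[of x] by simp
  qed
  have zero_iff: "p x = 0 \<longleftrightarrow> \<phi> x $ k = 0" if "x \<in> W" for x
  proof -
    have "p x = 0 \<longleftrightarrow> p (\<pi> x + (x $ k - w1 $ k) *s v) = 0" using x_eq[of x] by simp
    also have "\<dots> \<longleftrightarrow> x $ k - w1 $ k = a (\<pi> x)"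
      using that a_iff[of "\<pi> x" "x $ k - w1 $ k"] by (auto simp: W_def)
    also have "\<dots> \<longleftrightarrow> \<phi> x $ k = 0" by (simp add: \<phi>_def)
    finally show ?thesis .
  qed
  define X where "X = zero_locus \<Omega> p"
  have "\<phi> ` (X \<inter> W \<inter> W) = {y \<in> W'. \<forall>i. i \<notin> UNIV - {k} \<longrightarrow> y $ i = 0}"
  proof -
    have "\<phi> ` (X \<inter> W \<inter> W) = \<phi> ` {x \<in> W. \<phi> x $ k = 0}"
      using zero_iff W\<Omega> by (intro arg_cong[where f = "image \<phi>"]) (auto simp: X_def zero_locus_def)
    also have "\<dots> = {y \<in> \<phi> ` W. y $ k = 0}" by auto
    also have "\<phi> ` W = W'" using bij by (simp add: bij_betw_def)
    finally show ?thesis by auto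
  qed
  then have "complex_submanifold (CARD('n) - 1) (X \<inter> W)"
    unfolding complex_submanifold_def using chart
    by (intro ballI exI[of _ W] exI[of _ W'] exI[of _ \<phi>] exI[of _ "UNIV - {k}"]) (auto simp: card_Diff_singleton)
  moreover have "\<pi> (w1 + \<zeta>1 *s v) = w1" "(w1 + \<zeta>1 *s v) $ k - w1 $ k = \<zeta>1"
    by (simp_all add: \<pi>_def v)
  then have "w1 + \<zeta>1 *s v \<in> W" using B(2) \<zeta>1(1) by (simp add: W_def v)
  ultimately show ?thesis
    unfolding regular_points_def using oW W\<Omega> \<zeta>1(2) by (auto simp: X_def zero_locus_def)
qed

lemma separating_radius:
  fixes Z :: "'a::metric_space set"
  assumes "finite Z" "open S" "Z \<subseteq> S"
  obtains \<epsilon> where "\<epsilon> > 0" "\<And>a. a \<in> Z \<Longrightarrow> cball a \<epsilon> \<subseteq> S"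
    "\<And>a b. a \<in> Z \<Longrightarrow> b \<in> Z \<Longrightarrow> a \<noteq> b \<Longrightarrow> cball a \<epsilon> \<inter> cball b \<epsilon> = {}"
proof -
  have "\<forall>\<^sub>F \<epsilon> in at_right 0. cball a \<epsilon> \<subseteq> S \<and> (\<forall>b\<in>Z. a \<noteq> b \<longrightarrow> 2 * \<epsilon> < dist a b)" if "a \<in> Z" for a
  proof -
    have "a \<in> S" using assms(3) that by blast
    then obtain d1 where d1: "d1 > 0" "cball a d1 \<subseteq> S"
      using assms(2) unfolding open_contains_cball by blast
    have "\<exists>d>0. \<forall>x\<in>Z. x \<noteq> a \<longrightarrow> d \<le> dist a x"
      by (rule finite_set_avoid[OF assms(1)])
    then obtain d2 where d2: "d2 > 0" "\<forall>b\<in>Z. b \<noteq> a \<longrightarrow> d2 \<le> dist a b"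
      by blast
    show ?thesis
    proof (rule eventually_at_rightI[of 0 "min d1 (d2 / 2)"])
      fix \<epsilon> assume "\<epsilon> \<in> {0<..<min d1 (d2 / 2)}"
      then have "\<epsilon> \<le> d1" "2 * \<epsilon> < d2" by auto
      moreover have "cball a \<epsilon> \<subseteq> cball a d1" using \<open>\<epsilon> \<le> d1\<close> by (rule subset_cball)
      ultimately show "cball a \<epsilon> \<subseteq> S \<and> (\<forall>b\<in>Z. a \<noteq> b \<longrightarrow> 2 * \<epsilon> < dist a b)"
        using d1(2) d2(2) by (auto intro: less_le_trans)
    qed (use d1 d2 in auto)
  qed
  then have "\<forall>\<^sub>F \<epsilon> in at_right 0. \<forall>a\<in>Z. cball a \<epsilon> \<subseteq> S \<and> (\<forall>b\<in>Z. a \<noteq> b \<longrightarrow> 2 * \<epsilon> < dist a b)"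
    by (intro eventually_ball_finite assms(1)) auto
  then have "\<forall>\<^sub>F \<epsilon> in at_right 0. (\<forall>a\<in>Z. cball a \<epsilon> \<subseteq> S \<and> (\<forall>b\<in>Z. a \<noteq> b \<longrightarrow> 2 * \<epsilon> < dist a b)) \<and> \<epsilon> > 0"
    by (intro eventually_conj eventually_at_right_less) auto
  then obtain \<epsilon> :: real where \<epsilon>: "\<epsilon> > 0" "\<forall>a\<in>Z. cball a \<epsilon> \<subseteq> S \<and> (\<forall>b\<in>Z. a \<noteq> b \<longrightarrow> 2 * \<epsilon> < dist a b)"
    by (rule eventually_happens'[OF trivial_limit_at_right_real, THEN exE]) (elim conjE, rule that)
  show ?thesis
  proof (rule that[OF \<epsilon>(1)])
    fix a b assume "a \<in> Z" "b \<in> Z" "a \<noteq> b"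
    then have "2 * \<epsilon> < dist a b" using \<epsilon>(2) by blast
    then have False if "dist a x \<le> \<epsilon>" "dist b x \<le> \<epsilon>" for x
      using dist_triangle2[of a b x] that by linarith
    then show "cball a \<epsilon> \<inter> cball b \<epsilon> = {}" by auto
  qed (use \<epsilon>(2) in blast)
qed

text \<open>
  At a point \<open>w1\<close> with the maximal number of distinct zeros in the disc, every zero is isolated by a small
  circle. Nearby, each small disc still contains a zero, because the number of its zeros counted with
  multiplicity is continuous and does not vanish at \<open>w1\<close>. By maximality it contains only one, so every
  zero moves along a graph.
\<close>

lemma regular_discs_dense:
  fixes p :: "complex^'n \<Rightarrow> complex" and v :: "complex^'n"
  assumes \<Omega>: "open \<Omega>" and p: "line_holomorphic p \<Omega>" and v: "v $ k = 1" and r: "r > 0"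
    and disc: "\<And>w \<zeta>. w \<in> B \<Longrightarrow> \<zeta> \<in> cball 0 r \<Longrightarrow> w + \<zeta> *s v \<in> \<Omega>"
    and nz: "\<And>w \<zeta>. w \<in> B \<Longrightarrow> \<zeta> \<in> sphere 0 r \<Longrightarrow> p (w + \<zeta> *s v) \<noteq> 0"
    and B: "open B" "B \<noteq> {}"
  shows "\<exists>w\<in>B. \<forall>\<zeta>\<in>cball 0 r. w + \<zeta> *s v \<notin> singular_points \<Omega> (zero_locus \<Omega> p)"
proof -
  define Z where "Z w = {\<zeta> \<in> ball 0 r. p (w + \<zeta> *s v) = 0}" for w
  obtain w0 where "w0 \<in> B" using B(2) by blast
  then obtain \<rho> where \<rho>: "\<rho> > 0" "cball w0 \<rho> \<subseteq> B" using B(1) open_contains_cball by blast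
  define B0 where "B0 = ball w0 \<rho>"
  have B0: "B0 \<subseteq> B" "open B0" using \<rho>(2) by (auto simp: B0_def)
  have moment: "\<exists>m :: complex \<Rightarrow> nat. finite (Z w) \<and> (\<forall>\<zeta>\<in>Z w. m \<zeta> > 0) \<and>
    (\<forall>h. h holomorphic_on UNIV \<longrightarrow> zero_moment p v h 0 r w = (\<Sum>\<zeta>\<in>Z w. h \<zeta> * of_nat (m \<zeta>)))" if "w \<in> B" for w
    unfolding Z_def using disc[OF that] nz[OF that] by (intro zero_moment_eq_sum[OF \<Omega> p r]) auto
  have finZ: "finite (Z w)" if "w \<in> B" for w using moment[OF that] by blast
  \<comment> \<open>multiplicities are at least one\<close>
  have card_le: "real (card (Z w)) \<le> cmod (zero_moment p v (\<lambda>_. 1) 0 r w)" if w: "w \<in> B" for w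
  proof -
    obtain m :: "complex \<Rightarrow> nat" where m: "\<forall>\<zeta>\<in>Z w. m \<zeta> > 0"
      "\<forall>h. h holomorphic_on UNIV \<longrightarrow> zero_moment p v h 0 r w = (\<Sum>\<zeta>\<in>Z w. h \<zeta> * of_nat (m \<zeta>))"
      using moment[OF w] by blast
    have "zero_moment p v (\<lambda>_. 1) 0 r w = of_nat (\<Sum>\<zeta>\<in>Z w. m \<zeta>)"
      using m(2)[rule_format, of "\<lambda>_. 1"] by simp
    then have "cmod (zero_moment p v (\<lambda>_. 1) 0 r w) = real (\<Sum>\<zeta>\<in>Z w. m \<zeta>)"
      by (simp only: norm_of_nat)
    moreover have "card (Z w) \<le> (\<Sum>\<zeta>\<in>Z w. m \<zeta>)"
      using sum_mono[of "Z w" "\<lambda>_. 1" m] m(1) by (simp add: Suc_le_eq)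
    ultimately show ?thesis by (simp only: of_nat_le_iff)
  qed
  have "line_holomorphic (zero_moment p v (\<lambda>_. 1) 0 r) B"
    using disc nz by (intro line_holomorphic_zero_moment[OF \<Omega> p B(1) _ _ r]) auto
  then have "continuous_on B (zero_moment p v (\<lambda>_. 1) 0 r)" by (simp add: line_holomorphic_def)
  then obtain M where M: "\<And>w. w \<in> cball w0 \<rho> \<Longrightarrow> cmod (zero_moment p v (\<lambda>_. 1) 0 r w) \<le> M"
    using continuous_bounded_cball[OF _ \<rho>(2)] by blast
  have "card (Z w) < Suc (nat \<lfloor>M\<rfloor>)" if "w \<in> B0" for w
  proof -
    have "real (card (Z w)) \<le> M"
      using card_le[of w] M[of w] that B0(1) by (auto simp: B0_def)
    then show ?thesis by linarith
  qed
  moreover have "w0 \<in> B0" using \<rho>(1) by (simp add: B0_def)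
  ultimately obtain w1 where w1: "w1 \<in> B0" and max: "\<And>w. w \<in> B0 \<Longrightarrow> card (Z w) \<le> card (Z w1)"
    using ex_has_greatest_nat[of "\<lambda>w. w \<in> B0" w0 "\<lambda>w. card (Z w)" "Suc (nat \<lfloor>M\<rfloor>)"] by blast
  have w1B: "w1 \<in> B" using w1 B0(1) by blast
  have finZ1: "finite (Z w1)" by (rule finZ[OF w1B])
  obtain \<epsilon> where \<epsilon>: "\<epsilon> > 0" and \<epsilon>_sub: "\<And>a. a \<in> Z w1 \<Longrightarrow> cball a \<epsilon> \<subseteq> ball 0 r"
    and \<epsilon>_disj: "\<And>a b. a \<in> Z w1 \<Longrightarrow> b \<in> Z w1 \<Longrightarrow> a \<noteq> b \<Longrightarrow> cball a \<epsilon> \<inter> cball b \<epsilon> = {}"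
    using separating_radius[OF finZ1 open_ball, of 0 r] unfolding Z_def by blast
  have disc_a: "w + \<zeta> *s v \<in> \<Omega>" if "a \<in> Z w1" "w \<in> B" "\<zeta> \<in> cball a \<epsilon>" for a w \<zeta>
    using \<epsilon>_sub[OF that(1)] that by (intro disc) auto
  have only_a: "{\<zeta> \<in> ball a \<epsilon>. p (w1 + \<zeta> *s v) = 0} = {a}" and nz1: "\<forall>\<zeta>\<in>sphere a \<epsilon>. p (w1 + \<zeta> *s v) \<noteq> 0"
    if a: "a \<in> Z w1" for a
  proof -
    have *: "\<zeta> = a" if \<zeta>: "\<zeta> \<in> cball a \<epsilon>" "p (w1 + \<zeta> *s v) = 0" for \<zeta>
    proof (rule ccontr)
      assume "\<zeta> \<noteq> a"
      moreover have "\<zeta> \<in> Z w1" using \<zeta> \<epsilon>_sub[OF a] by (auto simp: Z_def)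
      ultimately have "cball a \<epsilon> \<inter> cball \<zeta> \<epsilon> = {}" using \<epsilon>_disj[OF a] by blast
      then show False using \<zeta>(1) \<epsilon> by auto
    qed
    show "{\<zeta> \<in> ball a \<epsilon>. p (w1 + \<zeta> *s v) = 0} = {a}"
      using * a \<epsilon> by (auto simp: Z_def)
    show "\<forall>\<zeta>\<in>sphere a \<epsilon>. p (w1 + \<zeta> *s v) \<noteq> 0"
      using * \<epsilon> by (metis dist_self less_irrefl mem_cball mem_sphere order_refl)
  qed
  have p_cont: "continuous_on \<Omega> p" using p by (simp add: line_holomorphic_def)
  have op: "open {z \<in> \<Omega>. p z \<noteq> 0}"
    using continuous_open_preimage[OF p_cont \<Omega>, of "- {0}"] by (simp add: vimage_def Int_def open_Compl)
  have near: "\<forall>\<^sub>F w in nhds w1. (\<forall>\<zeta>\<in>sphere a \<epsilon>. p (w + \<zeta> *s v) \<noteq> 0) \<and> zero_moment p v (\<lambda>_. 1) a \<epsilon> w \<noteq> 0"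
    if a: "a \<in> Z w1" for a
  proof -
    have "w1 + \<zeta> *s v \<in> {z \<in> \<Omega>. p z \<noteq> 0}" if "\<zeta> \<in> sphere a \<epsilon>" for \<zeta>
      using disc_a[OF a w1B, of \<zeta>] nz1[OF a] that by auto
    from nhd_shift_compact[OF op compact_sphere this]
    obtain d where d: "d > 0" "\<forall>w\<in>ball w1 d. \<forall>\<zeta>\<in>sphere a \<epsilon>. w + \<zeta> *s v \<in> {z \<in> \<Omega>. p z \<noteq> 0}"
      by blast
    then have lh: "line_holomorphic (zero_moment p v (\<lambda>_. 1) a \<epsilon>) (ball w1 d)"
      by (intro line_holomorphic_zero_moment[OF \<Omega> p open_ball _ _ \<epsilon>]) auto
    obtain m :: "complex \<Rightarrow> nat" where m: "m a > 0" "zero_moment p v (\<lambda>_. 1) a \<epsilon> w1 = of_nat (m a)"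
      using zero_moment_eq_sum[OF \<Omega> p \<epsilon>, of a w1 v] disc_a[OF a w1B] nz1[OF a]
      unfolding only_a[OF a] by auto
    have "isCont (zero_moment p v (\<lambda>_. 1) a \<epsilon>) w1"
      using lh d(1) by (simp add: line_holomorphic_def continuous_on_eq_continuous_at)
    then have "(zero_moment p v (\<lambda>_. 1) a \<epsilon> \<longlongrightarrow> zero_moment p v (\<lambda>_. 1) a \<epsilon> w1) (nhds w1)"
      by (simp add: isCont_def tendsto_at_iff_tendsto_nhds)
    then have "\<forall>\<^sub>F w in nhds w1. zero_moment p v (\<lambda>_. 1) a \<epsilon> w \<noteq> 0"
      using m by (intro tendsto_imp_eventually_ne) auto
    moreover have "\<forall>\<^sub>F w in nhds w1. w \<in> ball w1 d"
      using d(1) by (intro eventually_nhds_in_open) auto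
    ultimately show ?thesis
      by eventually_elim (use d(2) in blast)
  qed
  have "\<forall>\<^sub>F w in nhds w1. \<forall>a\<in>Z w1. (\<forall>\<zeta>\<in>sphere a \<epsilon>. p (w + \<zeta> *s v) \<noteq> 0) \<and> zero_moment p v (\<lambda>_. 1) a \<epsilon> w \<noteq> 0"
    by (intro eventually_ball_finite finZ1 ballI near)
  moreover have "\<forall>\<^sub>F w in nhds w1. w \<in> B0"
    using w1 B0(2) by (intro eventually_nhds_in_open)
  ultimately have "\<forall>\<^sub>F w in nhds w1. w \<in> B0 \<and> (\<forall>a\<in>Z w1. (\<forall>\<zeta>\<in>sphere a \<epsilon>. p (w + \<zeta> *s v) \<noteq> 0) \<and> zero_moment p v (\<lambda>_. 1) a \<epsilon> w \<noteq> 0)"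
    by eventually_elim blast
  then obtain B1 where B1: "open B1" "w1 \<in> B1" "B1 \<subseteq> B0"
    and B1_nz: "\<And>a w \<zeta>. a \<in> Z w1 \<Longrightarrow> w \<in> B1 \<Longrightarrow> \<zeta> \<in> sphere a \<epsilon> \<Longrightarrow> p (w + \<zeta> *s v) \<noteq> 0"
    and B1_m: "\<And>a w. a \<in> Z w1 \<Longrightarrow> w \<in> B1 \<Longrightarrow> zero_moment p v (\<lambda>_. 1) a \<epsilon> w \<noteq> 0"
    unfolding eventually_nhds by blast
  have B1B: "B1 \<subseteq> B" using B1(3) B0(1) by blast
  have ex: "\<exists>\<zeta>. \<zeta> \<in> ball a \<epsilon> \<and> p (w + \<zeta> *s v) = 0" if a: "a \<in> Z w1" and w: "w \<in> B1" for a w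
  proof -
    obtain m :: "complex \<Rightarrow> nat" where
      "zero_moment p v (\<lambda>_. 1) a \<epsilon> w = (\<Sum>\<zeta>\<in>{\<zeta> \<in> ball a \<epsilon>. p (w + \<zeta> *s v) = 0}. of_nat (m \<zeta>))"
      using zero_moment_eq_sum[OF \<Omega> p \<epsilon>, of a w v] disc_a[OF a] B1_nz[OF a w] w B1B by fastforce
    then have "{\<zeta> \<in> ball a \<epsilon>. p (w + \<zeta> *s v) = 0} \<noteq> {}" using B1_m[OF a w] by (metis sum.empty)
    then show ?thesis by blast
  qed
  \<comment> \<open>choosing one zero \<open>b a\<close> near every \<open>a\<close> already gives as many zeros as \<open>w1\<close> has, hence all of them\<close>
  have uniq: "\<exists>!\<zeta>. \<zeta> \<in> ball a \<epsilon> \<and> p (w + \<zeta> *s v) = 0" if a: "a \<in> Z w1" and w: "w \<in> B1" for a w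
  proof -
    obtain b where b: "\<And>a. a \<in> Z w1 \<Longrightarrow> b a \<in> ball a \<epsilon> \<and> p (w + b a *s v) = 0"
      using ex[OF _ w] by metis
    have b_in: "b a \<in> cball a \<epsilon>" if "a \<in> Z w1" for a using b[OF that] by auto
    have inj: "inj_on b (Z w1)"
    proof (rule inj_onI)
      fix x y assume "x \<in> Z w1" "y \<in> Z w1" "b x = b y"
      then show "x = y" using \<epsilon>_disj[of x y] b_in[of x] b_in[of y] by (metis disjoint_iff)
    qed
    have sub: "b ` Z w1 \<subseteq> Z w"
    proof
      fix x assume "x \<in> b ` Z w1"
      then obtain a where a: "a \<in> Z w1" "x = b a" by blast
      have "b a \<in> ball 0 r" using b_in[OF a(1)] \<epsilon>_sub[OF a(1)] by blast
      then show "x \<in> Z w" using b[OF a(1)] a(2) by (simp add: Z_def)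
    qed
    have "card (Z w) \<le> card (b ` Z w1)"
      using max[of w] w B1(3) by (auto simp: card_image[OF inj])
    then have img: "b ` Z w1 = Z w"
      using card_seteq[OF _ sub] finZ[of w] w B1B by blast
    have "\<zeta> = b a" if \<zeta>: "\<zeta> \<in> ball a \<epsilon>" "p (w + \<zeta> *s v) = 0" for \<zeta>
    proof -
      have "\<zeta> \<in> cball a \<epsilon>" using \<zeta>(1) by simp
      then have "\<zeta> \<in> ball 0 r" using \<epsilon>_sub[OF a] by blast
      then have "\<zeta> \<in> Z w" using \<zeta>(2) by (simp add: Z_def)
      then obtain a' where a': "a' \<in> Z w1" "\<zeta> = b a'" using img by blast
      then have "\<zeta> \<in> cball a' \<epsilon>" "\<zeta> \<in> cball a \<epsilon>" using b_in \<zeta>(1) by auto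
      then have "a' = a" using \<epsilon>_disj[OF a a'(1)] by blast
      then show ?thesis using a'(2) by simp
    qed
    then show ?thesis using b[OF a] by blast
  qed
  have "w1 + \<zeta> *s v \<notin> singular_points \<Omega> (zero_locus \<Omega> p)" if \<zeta>: "\<zeta> \<in> cball 0 r" for \<zeta>
  proof
    assume sing: "w1 + \<zeta> *s v \<in> singular_points \<Omega> (zero_locus \<Omega> p)"
    then have p0: "p (w1 + \<zeta> *s v) = 0" by (simp add: singular_points_def zero_locus_def)
    then have "\<zeta> \<notin> sphere 0 r" using nz[OF w1B] by blast
    then have a: "\<zeta> \<in> Z w1" using \<zeta> p0 by (auto simp: Z_def)
    have "w1 + \<zeta> *s v \<in> regular_points \<Omega> (zero_locus \<Omega> p)"
    proof (rule zero_graph_regular[OF \<Omega> p B1(1,2) v \<epsilon>, of \<zeta>])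
      show "\<And>w x. w \<in> B1 \<Longrightarrow> x \<in> cball \<zeta> \<epsilon> \<Longrightarrow> w + x *s v \<in> \<Omega>"
        using disc_a[OF a] B1B by blast
      show "\<And>w x. w \<in> B1 \<Longrightarrow> x \<in> sphere \<zeta> \<epsilon> \<Longrightarrow> p (w + x *s v) \<noteq> 0" by (rule B1_nz[OF a])
      show "\<And>w. w \<in> B1 \<Longrightarrow> \<exists>!x. x \<in> ball \<zeta> \<epsilon> \<and> p (w + x *s v) = 0" by (rule uniq[OF a])
    qed (use \<epsilon> p0 in auto)
    then show False using sing by (simp add: singular_points_def)
  qed
  then show ?thesis using w1B by blast
qed

section \<open>Extension across the singular points\<close>

lemma convex_line_preimage:
  fixes C :: "(complex^'n) set"
  assumes "convex C"
  shows "convex {\<zeta>. z + \<zeta> *s u \<in> C}"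
proof (rule convexI)
  fix x y :: complex and a b :: real
  assume *: "x \<in> {\<zeta>. z + \<zeta> *s u \<in> C}" "y \<in> {\<zeta>. z + \<zeta> *s u \<in> C}" "0 \<le> a" "0 \<le> b" "a + b = 1"
  have "a *\<^sub>R (z + x *s u) + b *\<^sub>R (z + y *s u) \<in> C"
    using * by (intro convexD[OF assms]) auto
  also have "a *\<^sub>R (z + x *s u) + b *\<^sub>R (z + y *s u) = (a + b) *\<^sub>R z + (a *\<^sub>R x + b *\<^sub>R y) *s u"
    by (simp add: vec_eq_iff scaleR_conv_of_real [where 'a = complex] algebra_simps)
  finally show "a *\<^sub>R x + b *\<^sub>R y \<in> {\<zeta>. z + \<zeta> *s u \<in> C}" using *(5) by simp
qed

text \<open>
  The identity theorem in several variables: by the one-variable theorem on lines, a ball in \<open>\<Omega>\<close> that meets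
  the interior of the zero set is contained in it, so this interior is also closed in \<open>\<Omega>\<close>.
\<close>

lemma zeros_nowhere_dense:
  fixes p :: "complex^'n \<Rightarrow> complex"
  assumes \<Omega>: "open \<Omega>" "connected \<Omega>" and p: "line_holomorphic p \<Omega>" and nz: "\<exists>z\<in>\<Omega>. p z \<noteq> 0"
    and G: "open G" "G \<noteq> {}" "G \<subseteq> \<Omega>"
  shows "\<exists>z\<in>G. p z \<noteq> 0"
proof (rule ccontr)
  assume contra: "\<not> (\<exists>z\<in>G. p z \<noteq> 0)"
  \<comment> \<open>the interior of the zero set\<close>
  define A where "A = \<Union>{N. open N \<and> N \<subseteq> \<Omega> \<and> (\<forall>w\<in>N. p w = 0)}"
  have A: "open A" "A \<subseteq> \<Omega>" "\<And>w. w \<in> A \<Longrightarrow> p w = 0" "G \<subseteq> A"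
    using G contra by (auto simp: A_def)
  have "open (\<Omega> - A)"
    unfolding open_contains_ball
  proof
    fix z assume z: "z \<in> \<Omega> - A"
    then obtain e where e: "e > 0" "ball z e \<subseteq> \<Omega>" using \<Omega>(1) open_contains_ball by blast
    have "ball z e \<inter> A = {}"
    proof (rule ccontr)
      assume "ball z e \<inter> A \<noteq> {}"
      then obtain y where y: "y \<in> ball z e" "y \<in> A" by blast
      have "p w = 0" if w: "w \<in> ball z e" for w
      proof -
        define S where "S = {\<zeta>. y + \<zeta> *s (w - y) \<in> ball z e}"
        define T where "T = S \<inter> {\<zeta>. y + \<zeta> *s (w - y) \<in> A}"
        have S: "open S" "connected S"
          unfolding S_def by (intro open_line_preimage convex_connected convex_line_preimage open_ball convex_ball)+
        have T: "open T" unfolding T_def using S(1) open_line_preimage[OF A(1)] by blast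
        have "(\<lambda>\<zeta>. p (y + \<zeta> *s (w - y))) holomorphic_on {\<zeta>. y + \<zeta> *s (w - y) \<in> \<Omega>}"
          using p unfolding line_holomorphic_def by blast
        then have hol: "(\<lambda>\<zeta>. p (y + \<zeta> *s (w - y))) holomorphic_on S"
          by (rule holomorphic_on_subset) (use e(2) in \<open>auto simp: S_def simp del: mem_ball\<close>)
        have "0 \<in> T" using y by (simp add: T_def S_def)
        then have "T \<noteq> {}" by blast
        moreover have "1 \<in> S" using w by (simp add: S_def)
        ultimately have "p (y + 1 *s (w - y)) = 0"
          using analytic_continuation_open[OF T S(1) _ S(2) _ hol holomorphic_on_const[of 0], of 1] A(3)
          by (auto simp: T_def)
        then show ?thesis by simp
      qed
      then have "ball z e \<subseteq> A" using e(2) unfolding A_def by (intro Union_upper) auto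
      then show False using z e(1) centre_in_ball[of z e] by blast
    qed
    then show "\<exists>e>0. ball z e \<subseteq> \<Omega> - A" using e by blast
  qed
  moreover obtain z where "z \<in> \<Omega> - A" using nz A(3) by blast
  ultimately show False
    using connectedD[OF \<Omega>(2) A(1), of "\<Omega> - A"] A(2,4) G by blast
qed

text \<open>
  On a complex line through \<open>z\<close> and a nearby point where \<open>p\<close> does not vanish, the zeros close to \<open>z\<close> are
  finite in number, so all but finitely many small radii avoid them.
\<close>

lemma nonvanishing_circle_exists:
  fixes p :: "complex^'n \<Rightarrow> complex"
  assumes \<Omega>: "open \<Omega>" "connected \<Omega>" and p: "line_holomorphic p \<Omega>" and nz: "\<exists>z\<in>\<Omega>. p z \<noteq> 0"
    and z: "z \<in> \<Omega>"
  shows "\<exists>(v :: complex^'n) k r. v $ k = 1 \<and> r > 0 \<and> (\<forall>\<zeta>\<in>cball 0 r. z + \<zeta> *s v \<in> \<Omega>) \<and>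
    (\<forall>\<zeta>\<in>sphere 0 r. p (z + \<zeta> *s v) \<noteq> 0)"
proof -
  obtain e where e: "e > 0" "ball z e \<subseteq> \<Omega>" using \<Omega>(1) z open_contains_ball by blast
  have "ball z e - {z} \<noteq> {}"
    using perfect_choose_dist[OF e(1), of z] by (metis Diff_iff dist_commute empty_iff mem_ball singletonD)
  moreover have "open (ball z e - {z})" "ball z e - {z} \<subseteq> \<Omega>" using e(2) by auto
  ultimately have "\<exists>y\<in>ball z e - {z}. p y \<noteq> 0"
    by (intro zeros_nowhere_dense[OF \<Omega> p nz])
  then obtain y where y: "y \<in> ball z e" "y \<noteq> z" "p y \<noteq> 0" by blast
  define u where "u = y - z"
  obtain k where k: "u $ k \<noteq> 0" using y(2) by (auto simp: u_def vec_eq_iff)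
  define v where "v = (1 / u $ k) *s u"
  define \<rho> where "\<rho> = cmod (u $ k)"
  have \<rho>: "\<rho> > 0" using k by (simp add: \<rho>_def)
  have v: "v $ k = 1" "(u $ k) *s v = u" using k by (simp_all add: v_def vector_smult_assoc)
  have nv: "\<rho> * norm v = norm u"
    using norm_vector_scalar_mult[of "u $ k" v] by (simp add: \<rho>_def v(2))
  define S where "S = {\<zeta>. z + \<zeta> *s v \<in> ball z e}"
  have S: "open S" "connected S"
    unfolding S_def by (intro open_line_preimage convex_connected convex_line_preimage open_ball convex_ball)+
  have KS: "cball 0 \<rho> \<subseteq> S"
  proof
    fix \<zeta> :: complex assume "\<zeta> \<in> cball 0 \<rho>"
    then have "norm (\<zeta> *s v) \<le> norm u"
      unfolding nv[symmetric] by (simp add: norm_vector_scalar_mult mult_right_mono)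
    moreover have "norm u < e" using y(1) by (simp add: u_def dist_norm norm_minus_commute)
    ultimately show "\<zeta> \<in> S" by (simp add: S_def dist_norm)
  qed
  have "(\<lambda>\<zeta>. p (z + \<zeta> *s v)) holomorphic_on {\<zeta>. z + \<zeta> *s v \<in> \<Omega>}"
    using p by (simp add: line_holomorphic_def)
  then have hol: "(\<lambda>\<zeta>. p (z + \<zeta> *s v)) holomorphic_on S"
    by (rule holomorphic_on_subset) (use e(2) in \<open>auto simp: S_def simp del: mem_ball\<close>)
  have pu: "p (z + (u $ k) *s v) \<noteq> 0" using y(3) unfolding v(2) by (simp add: u_def)
  have ukS: "u $ k \<in> S" using KS by (auto simp: \<rho>_def)
  have fin: "finite {\<zeta> \<in> cball 0 \<rho>. p (z + \<zeta> *s v) = 0}"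
  proof (cases "(\<lambda>\<zeta>. p (z + \<zeta> *s v)) constant_on S")
    case True
    then have "p (z + \<zeta> *s v) = p (z + (u $ k) *s v)" if "\<zeta> \<in> S" for \<zeta>
      using that ukS unfolding constant_on_def by metis
    then have "{\<zeta> \<in> cball 0 \<rho>. p (z + \<zeta> *s v) = 0} = {}" using pu KS by auto
    then show ?thesis by (metis finite.emptyI)
  next
    case False
    then show ?thesis using holomorphic_compact_finite_zeros[OF hol S compact_cball KS] by simp
  qed
  have "infinite {0<..<\<rho>}" using \<rho> by simp
  then have "{0<..<\<rho>} - norm ` {\<zeta> \<in> cball 0 \<rho>. p (z + \<zeta> *s v) = 0} \<noteq> {}"
    using finite_imageI[OF fin, of norm] by (metis Diff_infinite_finite finite.emptyI)
  then obtain r where "r \<in> {0<..<\<rho>} - norm ` {\<zeta> \<in> cball 0 \<rho>. p (z + \<zeta> *s v) = 0}" by blast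
  then have r: "0 < r" "r < \<rho>" "r \<notin> norm ` {\<zeta> \<in> cball 0 \<rho>. p (z + \<zeta> *s v) = 0}"
    by (simp_all only: Diff_iff greaterThanLessThan_iff simp_thms)
  show ?thesis
  proof (intro exI[of _ v] exI[of _ k] exI[of _ r] conjI v(1) r(1) ballI)
    fix \<zeta> :: complex assume "\<zeta> \<in> cball 0 r"
    then have "\<zeta> \<in> S" using KS r(2) by (auto simp: subset_iff)
    then show "z + \<zeta> *s v \<in> \<Omega>" using e(2) by (auto simp: S_def simp del: mem_ball)
  next
    fix \<zeta> :: complex assume "\<zeta> \<in> sphere 0 r"
    then have "norm \<zeta> = r" by simp
    then show "p (z + \<zeta> *s v) \<noteq> 0" using r(2,3) by force
  qed
qed

text \<open>
  Complex differentiability at a point is meaningful only if the map is defined nearby, hence the need for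
  an open domain. A chart domain around a regular point consists of points off \<open>X\<close> and regular points.
\<close>

lemma open_nonsingular:
  fixes p :: "complex^'n \<Rightarrow> complex"
  assumes \<Omega>: "open \<Omega>" and p: "continuous_on \<Omega> p"
  shows "open (\<Omega> - singular_points \<Omega> (zero_locus \<Omega> p))"
proof -
  let ?X = "zero_locus \<Omega> p"
  define R where "R = \<Union>{U. open U \<and> U \<subseteq> \<Omega> \<and> complex_submanifold (CARD('n) - 1) (?X \<inter> U)}"
  have "regular_points \<Omega> ?X = ?X \<inter> R"
    by (auto simp: regular_points_def R_def)
  then have "\<Omega> - singular_points \<Omega> ?X = (\<Omega> \<inter> p -` (- {0})) \<union> R"
    by (auto simp: singular_points_def zero_locus_def R_def)
  moreover have "open R" by (auto simp: R_def)
  moreover have "open (\<Omega> \<inter> p -` (- {0}))"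
    by (intro continuous_open_preimage[OF p \<Omega>]) auto
  ultimately show ?thesis by auto
qed

lemma continuous_agree_on_dense:
  fixes f g :: "'a::topological_space \<Rightarrow> 'b::t2_space"
  assumes U: "open U" and f: "continuous_on U f" and g: "continuous_on U g"
    and dense: "\<And>N. open N \<Longrightarrow> N \<noteq> {} \<Longrightarrow> N \<subseteq> U \<Longrightarrow> \<exists>w\<in>N. f w = g w"
    and z: "z \<in> U"
  shows "f z = g z"
proof (rule ccontr)
  assume "f z \<noteq> g z"
  from hausdorff[OF this]
  obtain S T where ST: "open S" "open T" "f z \<in> S" "g z \<in> T" "S \<inter> T = {}"
    by blast
  define N where "N = (U \<inter> f -` S) \<inter> (U \<inter> g -` T)"
  have "open N" unfolding N_def
    by (rule open_Int[OF continuous_open_preimage[OF f U ST(1)] continuous_open_preimage[OF g U ST(2)]])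
  moreover have "z \<in> N" using z ST by (simp add: N_def)
  moreover have "N \<subseteq> U" by (auto simp: N_def)
  ultimately obtain w where "w \<in> N" "f w = g w" using dense[of N] by blast
  then show False using ST(5) by (auto simp: N_def)
qed

text \<open>
  The extension is the mean of \<open>f\<close> over circles in the zero-free part of \<open>\<Omega>\<close>. It agrees with \<open>f\<close> at the
  centres of discs without singular points, and such centres are dense.
\<close>

lemma local_extension:
  fixes p :: "complex^'n \<Rightarrow> complex"
    and scaleC :: "complex \<Rightarrow>
      'v::{real_vector, uniform_topological_group_add, topological_ab_group_add, t2_space} \<Rightarrow> 'v"
    and f :: "complex^'n \<Rightarrow> 'v"
  assumes \<Omega>: "open \<Omega>" "connected \<Omega>" and p: "line_holomorphic p \<Omega>" and nz: "\<exists>z\<in>\<Omega>. p z \<noteq> 0"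
    and qc: "quasi_complete_lcs scaleC"
    and f: "holomorphic_wrt scaleC f (\<Omega> - singular_points \<Omega> (zero_locus \<Omega> p))"
    and z0: "z0 \<in> \<Omega>"
  shows "\<exists>B g. open B \<and> z0 \<in> B \<and> B \<subseteq> \<Omega> \<and> holomorphic_wrt scaleC g B \<and>
    (\<forall>z\<in>B - singular_points \<Omega> (zero_locus \<Omega> p). g z = f z)"
proof -
  define Xs where "Xs = singular_points \<Omega> (zero_locus \<Omega> p)"
  have lcs: "complex_lcs scaleC" using qc by (simp add: quasi_complete_lcs_def)
  have p_cont: "continuous_on \<Omega> p" using p by (simp add: line_holomorphic_def)
  have W: "open (\<Omega> - Xs)" unfolding Xs_def by (rule open_nonsingular[OF \<Omega>(1) p_cont])
  have fW: "holomorphic_wrt scaleC f (\<Omega> - Xs)" using f by (simp add: Xs_def)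
  have op: "open (\<Omega> \<inter> p -` (- {0}))"
    by (intro continuous_open_preimage[OF p_cont \<Omega>(1)]) auto
  obtain v :: "complex^'n" and k r where v: "v $ k = 1" and r: "r > 0"
    and in_\<Omega>: "\<And>\<zeta>. \<zeta> \<in> cball 0 r \<Longrightarrow> z0 + \<zeta> *s v \<in> \<Omega>"
    and nz_z0: "\<And>\<zeta>. \<zeta> \<in> sphere 0 r \<Longrightarrow> p (z0 + \<zeta> *s v) \<noteq> 0"
    using nonvanishing_circle_exists[OF \<Omega> p nz z0] by blast
  obtain d1 where d1: "d1 > 0" "\<forall>w\<in>ball z0 d1. \<forall>\<zeta>\<in>cball 0 r. w + \<zeta> *s v \<in> \<Omega>"
    using nhd_shift_compact[OF \<Omega>(1) compact_cball in_\<Omega>] by blast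
  have "z0 + \<zeta> *s v \<in> \<Omega> \<inter> p -` (- {0})" if "\<zeta> \<in> sphere 0 r" for \<zeta>
    using in_\<Omega>[of \<zeta>] nz_z0[OF that] that by auto
  from nhd_shift_compact[OF op compact_sphere this]
  obtain d2 where d2: "d2 > 0" "\<forall>w\<in>ball z0 d2. \<forall>\<zeta>\<in>sphere 0 r. w + \<zeta> *s v \<in> \<Omega> \<inter> p -` (- {0})"
    by blast
  define B where "B = ball z0 (min d1 d2)"
  have B: "open B" "z0 \<in> B" using d1(1) d2(1) by (auto simp: B_def)
  have disc: "w + \<zeta> *s v \<in> \<Omega>" if "w \<in> B" "\<zeta> \<in> cball 0 r" for w \<zeta>
    using that d1(2) by (auto simp: B_def)
  have circ: "w + \<zeta> *s v \<in> \<Omega>" "p (w + \<zeta> *s v) \<noteq> 0" if "w \<in> B" "\<zeta> \<in> sphere 0 r" for w \<zeta>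
    using d2(2) that by (auto simp: B_def)
  have B_sub: "B \<subseteq> \<Omega>" using disc[of _ 0] r by auto
  have ur: "of_real r * ucirc t \<in> sphere 0 r" for t using r by (simp add: norm_mult)
  have circ_W: "w + (of_real r * ucirc t) *s v \<in> \<Omega> - Xs" if "w \<in> B" for w t
    using circ[OF that ur[of t]] by (auto simp: Xs_def singular_points_def zero_locus_def)
  obtain g where g: "holomorphic_wrt scaleC g B"
    and mean: "\<forall>l. cfunctional scaleC l \<longrightarrow> (\<forall>z\<in>B.
      ((\<lambda>t. l (f (z + (of_real r * ucirc t) *s v))) has_integral l (g z)) {0..1})"
    using circle_mean_holomorphic[OF qc W fW B(1) circ_W] by blast
  have good: "f w = g w" if w: "w \<in> B" and reg: "\<forall>\<zeta>\<in>cball 0 r. w + \<zeta> *s v \<notin> Xs" for w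
  proof (rule cfunctionals_separate[OF lcs])
    fix l assume l: "cfunctional scaleC l"
    have "(\<lambda>\<zeta>. l (f (w + \<zeta> *s v))) holomorphic_on {\<zeta>. w + \<zeta> *s v \<in> \<Omega> - Xs}"
      using cfunctional_comp_holomorphic[OF lcs W fW l] by (simp add: line_holomorphic_def)
    then have hol: "(\<lambda>\<zeta>. l (f (w + \<zeta> *s v))) holomorphic_on cball 0 r"
      by (rule holomorphic_on_subset) (use disc[OF w] reg in auto)
    have "((\<lambda>t. l (f (w + (0 + of_real r * ucirc t) *s v))) has_integral l (f (w + 0 *s v))) {0..1}"
      by (rule mean_value_circle[where f = "\<lambda>\<zeta>. l (f (w + \<zeta> *s v))"])
        (use hol r in \<open>auto intro: holomorphic_on_imp_continuous_on holomorphic_on_subset\<close>)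
    then show "l (f w) = l (g w)"
      using has_integral_unique[OF _ mean[rule_format, OF l w]] by simp
  qed
  have "f z = g z" if z: "z \<in> B - Xs" for z
  proof (rule continuous_agree_on_dense[where U = "B \<inter> (\<Omega> - Xs)"])
    show "open (B \<inter> (\<Omega> - Xs))" using B(1) W by blast
    show "continuous_on (B \<inter> (\<Omega> - Xs)) f"
      using holomorphic_wrt_imp_continuous_on[OF lcs fW] by (rule continuous_on_subset) auto
    show "continuous_on (B \<inter> (\<Omega> - Xs)) g"
      using holomorphic_wrt_imp_continuous_on[OF lcs g] by (rule continuous_on_subset) auto
    show "z \<in> B \<inter> (\<Omega> - Xs)" using z B_sub by auto
    fix N assume N: "open N" "N \<noteq> {}" "N \<subseteq> B \<inter> (\<Omega> - Xs)"
    have NB: "w \<in> B" if "w \<in> N" for w using N(3) that by blast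
    have "\<exists>w\<in>N. \<forall>\<zeta>\<in>cball 0 r. w + \<zeta> *s v \<notin> singular_points \<Omega> (zero_locus \<Omega> p)"
      by (rule regular_discs_dense[OF \<Omega>(1) p v r _ _ N(1,2)]) (use disc circ NB in blast)+
    then show "\<exists>w\<in>N. f w = g w" using good NB unfolding Xs_def by blast
  qed
  then show ?thesis using B B_sub g unfolding Xs_def by (intro exI[of _ B] exI[of _ g]) auto
qed

theorem theorem18p1:
  fixes \<Omega> X X\<^sub>s :: "(complex^'n) set"
    and p :: "complex^'n \<Rightarrow> complex"
    and scaleC :: "complex \<Rightarrow>
      'v::{real_vector, uniform_topological_group_add, topological_ab_group_add, t2_space} \<Rightarrow> 'v"
    and f :: "complex^'n \<Rightarrow> 'v"
  assumes "open \<Omega>" and "connected \<Omega>"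
    and "holomorphic_wrt (*) p \<Omega>" and "\<exists>z\<in>\<Omega>. p z \<noteq> 0"
    and "X = zero_locus \<Omega> p" and "X\<^sub>s = singular_points \<Omega> X"
    and "quasi_complete_lcs scaleC"
    and "holomorphic_wrt scaleC f (\<Omega> - X\<^sub>s)"
  shows "\<exists>g. holomorphic_wrt scaleC g \<Omega> \<and> (\<forall>z\<in>\<Omega> - X\<^sub>s. g z = f z) \<and>
    (\<forall>g'. holomorphic_wrt scaleC g' \<Omega> \<and> (\<forall>z\<in>\<Omega> - X\<^sub>s. g' z = f z) \<longrightarrow> (\<forall>z\<in>\<Omega>. g' z = g z))"
proof -
  have lcs: "complex_lcs scaleC" using assms(7) by (simp add: quasi_complete_lcs_def)
  have p: "line_holomorphic p \<Omega>" by (rule holomorphic_wrt_imp_line_holomorphic[OF assms(1,3)])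
  have Xs: "X\<^sub>s = singular_points \<Omega> (zero_locus \<Omega> p)" by (simp add: assms(5,6))
  have agree: "h z = h' z"
    if U: "open U" "U \<subseteq> \<Omega>" and h: "holomorphic_wrt scaleC h U" "holomorphic_wrt scaleC h' U"
      and eq: "\<And>w. w \<in> U - X\<^sub>s \<Longrightarrow> h w = h' w" and z: "z \<in> U" for U h h' z
  proof (rule continuous_agree_on_dense[OF U(1) _ _ _ z])
    show "continuous_on U h" "continuous_on U h'"
      using h by (auto intro: holomorphic_wrt_imp_continuous_on[OF lcs])
    fix N assume N: "open N" "N \<noteq> {}" "N \<subseteq> U"
    then obtain w where w: "w \<in> N" "p w \<noteq> 0"
      using zeros_nowhere_dense[OF assms(1,2) p assms(4)] U(2) by (meson order_trans)
    then have "w \<notin> X\<^sub>s" by (simp add: Xs singular_points_def zero_locus_def)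
    then show "\<exists>w\<in>N. h w = h' w" using w(1) N(3) eq by blast
  qed
  have "\<forall>z0\<in>\<Omega>. \<exists>B g. open B \<and> z0 \<in> B \<and> B \<subseteq> \<Omega> \<and> holomorphic_wrt scaleC g B \<and> (\<forall>z\<in>B - X\<^sub>s. g z = f z)"
    using local_extension[OF assms(1,2) p assms(4,7) assms(8)[unfolded Xs]] unfolding Xs by blast
  then obtain B g where Bg: "\<And>z0. z0 \<in> \<Omega> \<Longrightarrow> open (B z0) \<and> z0 \<in> B z0 \<and> B z0 \<subseteq> \<Omega> \<and>
      holomorphic_wrt scaleC (g z0) (B z0) \<and> (\<forall>z\<in>B z0 - X\<^sub>s. g z0 z = f z)"
    by metis
  \<comment> \<open>the local extensions coincide on overlaps, so each may be evaluated at its own centre\<close>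
  define G where "G z = g z z" for z
  have G_eq: "g z0 z = G z" if z0: "z0 \<in> \<Omega>" and z: "z \<in> B z0" for z0 z
  proof -
    have z\<Omega>: "z \<in> \<Omega>" using Bg[OF z0] z by blast
    have "holomorphic_wrt scaleC (g z0) (B z0 \<inter> B z)" "holomorphic_wrt scaleC (g z) (B z0 \<inter> B z)"
      using Bg[OF z0] Bg[OF z\<Omega>] by (auto simp: holomorphic_wrt_def)
    then have "g z0 z = g z z"
      by (rule agree[rotated 2]) (use Bg[OF z0] Bg[OF z\<Omega>] z in auto)
    then show ?thesis by (simp add: G_def)
  qed
  have G: "holomorphic_wrt scaleC G \<Omega>"
    unfolding holomorphic_wrt_def
  proof
    fix z assume z: "z \<in> \<Omega>"
    have "holomorphic_wrt scaleC G (B z)"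
      using Bg[OF z] G_eq[OF z] by (intro holomorphic_wrt_transform[of "B z" scaleC "g z" G]) auto
    then show "\<exists>L. Vector_Spaces.linear (*s) scaleC L \<and>
        ((\<lambda>h. (1 / norm h) *\<^sub>R (G (z + h) - G z - L h)) \<longlongrightarrow> 0) (at 0)"
      using Bg[OF z] unfolding holomorphic_wrt_def by blast
  qed
  moreover have Gf: "\<forall>z\<in>\<Omega> - X\<^sub>s. G z = f z" using Bg by (auto simp: G_def)
  moreover have "g' z = G z" if "holomorphic_wrt scaleC g' \<Omega>" "\<forall>z\<in>\<Omega> - X\<^sub>s. g' z = f z" "z \<in> \<Omega>" for g' z
  proof (rule agree[OF assms(1) order_refl that(1) G _ that(3)])
    show "g' w = G w" if "w \<in> \<Omega> - X\<^sub>s" for w using that \<open>\<forall>z\<in>\<Omega> - X\<^sub>s. g' z = f z\<close> Gf by simp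
  qed
  ultimately show ?thesis by blast
qed

end
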